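(* Let $\lambda>1$ and let $f:\mathbb R^2\setminus\{0\}\to\mathbb R$ satisfy $f(\lambda x)=\lambda^{-1}f(x)$. Assume $f\in L^2(\mathcal A)$, where $\mathcal A=B_\lambda\setminus B_1$. Let $u(x,t)=(e^{t\Delta}f)(x)$ be the corresponding solution of the heat equation and define $$U_0(y,s)=\sqrt t\,u(x,t),\qquad y=\frac{x}{\sqrt t},\quad s=\log t .$$ Then, with $T=2\log\lambda$, $$\frac1{C(\lambda)}\|f\|_{L^2(\mathcal A)}\le\sup_{0\le s\le T}\|\nabla_yU_0(\cdot,s)\|_{L^2(\mathbb R^2)}\le C(\lambda)\|f\|_{L^2(\mathcal A)}$$ for some constant $C(\lambda)$.
   Context: $(e^{t\Delta}f)(x)=\int_{\mathbb R^2}\frac1{4\pi t}e^{-|x-z|^2/(4t)}f(z)\,dz$, and $B_\lambda\setminus B_1=\{x\in\mathbb R^2:1\le|x|<\lambda\}$. The constant $C(\lambda)$ depends only on $\lambda$ (not on $f$). *)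

theory Defs
  imports "HOL-Analysis.Analysis"
begin

definition annulus :: "real \<Rightarrow> (real^2) set" where
  "annulus lam = {x. 1 \<le> norm x \<and> norm x < lam}"

text \<open>
  The \<open>L\<^sup>2\<close> norm takes values in \<^typ>\<open>ennreal\<close>, so that no finiteness is presupposed. There is no
  square root on \<^typ>\<open>ennreal\<close>, and \<^const>\<open>enn2real\<close> maps the infinite value to \<open>0\<close>; hence the
  case distinction.
\<close>

definition L2norm :: "(real^2) set \<Rightarrow> (real^2 \<Rightarrow> 'b::real_normed_vector) \<Rightarrow> ennreal" where
  "L2norm A g =
     (let I = (\<integral>\<^sup>+x\<in>A. ennreal ((norm (g x))\<^sup>2) \<partial>lebesgue)
      in if I = \<infinity> then \<infinity> else ennreal (sqrt (enn2real I)))"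

definition in_L2 :: "(real^2) set \<Rightarrow> (real^2 \<Rightarrow> 'b::real_normed_vector) \<Rightarrow> bool" where
  "in_L2 A g \<longleftrightarrow> set_borel_measurable lebesgue A g \<and> L2norm A g < \<infinity>"

text \<open>
  A function on the punctured plane is represented by a total function, about whose value at the
  origin nothing is assumed; that value does not affect any of the integrals.
\<close>

definition discretely_self_similar :: "real \<Rightarrow> (real^2 \<Rightarrow> real) \<Rightarrow> bool" where
  "discretely_self_similar lam f \<longleftrightarrow> (\<forall>x. x \<noteq> 0 \<longrightarrow> f (lam *\<^sub>R x) = inverse lam * f x)"

definition heat_solution :: "(real^2 \<Rightarrow> real) \<Rightarrow> real^2 \<Rightarrow> real \<Rightarrow> real" where
  "heat_solution f x t =
     (LINT z|lebesgue. 1 / (4 * pi * t) * exp (- (norm (x - z))\<^sup>2 / (4 * t)) * f z)"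

text \<open>Similarity variables: \<open>y = x / sqrt t\<close> and \<open>s = ln t\<close>, that is, \<open>x = sqrt t *\<^sub>R y\<close> and \<open>t = exp s\<close>.\<close>

definition U0 :: "(real^2 \<Rightarrow> real) \<Rightarrow> real^2 \<Rightarrow> real \<Rightarrow> real" where
  "U0 f y s = (let t = exp s in sqrt t * heat_solution f (sqrt t *\<^sub>R y) t)"

definition gradient :: "(real^2 \<Rightarrow> real) \<Rightarrow> real^2 \<Rightarrow> real^2" where
  "gradient g y = (THE D. GDERIV g y :> D)"

end

theory Submission
  imports Defs "HOL-Probability.Distributions"
begin

text \<open>
  Write \<open>P\<^sub>t\<close> for convolution with the heat kernel, \<open>u\<^sub>t = P\<^sub>t f\<close> and \<open>\<lambda>\<close> for \<open>lam\<close>. In the original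
  variables the square of the gradient norm at \<open>s = ln t\<close> is \<open>t \<parallel>\<nabla>u\<^sub>t\<parallel>\<^sup>2\<close>, and self-similarity of
  \<open>f\<close> becomes \<open>u(\<lambda>x, \<lambda>\<^sup>2t) = u(x, t) / \<lambda>\<close>.

  The theorem is an energy balance. Formally \<open>\<parallel>u\<^sub>1\<parallel>\<^sup>2 - \<parallel>u\<^sub>t\<parallel>\<^sup>2\<close> with \<open>t = \<lambda>\<^sup>2\<close> is twice the dissipation
  \<open>\<integral> \<parallel>\<nabla>u\<parallel>\<^sup>2\<close> between these times. For nonzero data both energies are infinite, because the solution
  is of size \<open>1/|x|\<close> in mean square. Their difference is finite: by self-similarity the energy of
  \<open>u\<close> at time \<open>\<lambda>\<^sup>2\<close> in a ball of radius \<open>R\<close> is the energy at time \<open>1\<close> in the ball of radius \<open>R/\<lambda>\<close>,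
  so what remains is the energy of \<open>u\<^sub>1\<close> in one annulus of size \<open>R\<close>. Scaled back to size one this is the
  energy in an annulus at a time that tends to \<open>0\<close>, hence comparable to the energy of \<open>f\<close> there.

  To avoid differentiating in time, the dissipation is replaced by the variance
  \<open>V = P\<^sub>\<tau>(u\<^sub>s\<^sup>2) - (P\<^sub>\<tau> u\<^sub>s)\<^sup>2\<close> with \<open>s + \<tau> = \<lambda>\<^sup>2 s\<close>. Two Poincare-type inequalities link it to the gradient:
  \<open>|\<nabla>u|\<^sup>2 \<le> (4/\<tau>) V\<close> pointwise at time \<open>s + \<tau>\<close> (\<open>norm_heat_grad_le_var\<close>), and
  \<open>\<integral> V \<le> 16 \<tau> \<parallel>\<nabla>u\<^sub>s\<parallel>\<^sup>2\<close> (\<open>nn_integral_heat_var_le\<close>). It remains to compare \<open>\<integral> V\<close> with the integral of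
  \<open>f\<^sup>2\<close> over the annulus.

  Gaussian weights serve as cut-off functions. As \<open>P\<^sub>\<tau>\<close> maps them to Gaussian weights, the
  localised balance holds without boundary terms (\<open>energy_identity_self_similar\<close>). For the upper bound
  (\<open>energy_drop_le\<close>) the difference of two weights of widths comparable to \<open>R\<close> is small where \<open>|x|\<close> is much
  smaller or much larger than \<open>R\<close>, and a Cauchy-Schwarz estimate with the singular weight \<open>1/|z|\<close>
  (\<open>heat_square_le\<close>) bounds \<open>u\<^sub>s\<^sup>2\<close> by \<open>f\<^sup>2\<close> there. For the lower bound
  (\<open>annulus_energy_le_energy_drop\<close>) the heat flow converges weakly to \<open>f\<close> as time tends to zero, and
  a nonnegative quadratic form is lower semicontinuous under weak convergence.
\<close>

section \<open>Gaussian weights and the heat semigroup on nonnegative functions\<close>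

definition heat_kernel :: "real \<Rightarrow> real^2 \<Rightarrow> real" where
  "heat_kernel t z = exp (- (norm z)\<^sup>2 / (4 * t)) / (4 * pi * t)"

definition gauss_weight :: "real \<Rightarrow> real^2 \<Rightarrow> real" where
  "gauss_weight r x = exp (- (norm x)\<^sup>2 / (4 * r))"

text \<open>
  The heat semigroup on nonnegative functions, possibly with infinite values: here Tonelli's theorem
  needs no integrability, and the real-valued statements are derived from these.
\<close>

definition heat_nn :: "real \<Rightarrow> (real^2 \<Rightarrow> ennreal) \<Rightarrow> real^2 \<Rightarrow> ennreal" where
  "heat_nn t h x = (\<integral>\<^sup>+z. ennreal (heat_kernel t (x - z)) * h z \<partial>lborel)"

definition heat :: "real \<Rightarrow> (real^2 \<Rightarrow> real) \<Rightarrow> real^2 \<Rightarrow> real" where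
  "heat t g x = (LINT z|lborel. heat_kernel t (x - z) * g z)"

lemma heat_kernel_measurable [measurable]: "heat_kernel t \<in> borel_measurable borel"
  unfolding heat_kernel_def[abs_def] by measurable

lemma gauss_weight_measurable [measurable]: "gauss_weight r \<in> borel_measurable borel"
  unfolding gauss_weight_def[abs_def] by measurable

lemma heat_nn_measurable [measurable]:
  assumes [measurable]: "h \<in> borel_measurable borel"
  shows "heat_nn t h \<in> borel_measurable borel"
  unfolding heat_nn_def[abs_def] by measurable

lemma heat_measurable [measurable]:
  assumes [measurable]: "g \<in> borel_measurable borel"
  shows "heat t g \<in> borel_measurable borel"
  unfolding heat_def[abs_def] by measurable

lemma heat_kernel_nonneg: "t > 0 \<Longrightarrow> heat_kernel t z \<ge> 0"
  by (simp add: heat_kernel_def)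

lemma heat_kernel_minus: "heat_kernel t (- z) = heat_kernel t z"
  by (simp add: heat_kernel_def)

lemma heat_kernel_commute: "heat_kernel t (x - z) = heat_kernel t (z - x)"
  by (simp add: heat_kernel_def norm_minus_commute)

lemma gauss_weight_pos: "gauss_weight r x > 0"
  by (simp add: gauss_weight_def)

lemma gauss_weight_nonneg: "gauss_weight r x \<ge> 0"
  by (simp add: gauss_weight_def)

lemma gauss_weight_le_1: "r > 0 \<Longrightarrow> gauss_weight r x \<le> 1"
  by (simp add: gauss_weight_def)

lemma gauss_weight_mono: "0 < r \<Longrightarrow> r \<le> r' \<Longrightarrow> gauss_weight r x \<le> gauss_weight r' x"
  by (simp add: gauss_weight_def divide_left_mono)

lemma heat_kernel_eq_weight: "heat_kernel t z = gauss_weight t z / (4 * pi * t)"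
  by (simp add: heat_kernel_def gauss_weight_def)

lemma nn_integral_affine:
  fixes t :: "real^2" and h :: "real^2 \<Rightarrow> ennreal"
  assumes [measurable]: "h \<in> borel_measurable borel" and c: "c \<noteq> 0"
  shows "(\<integral>\<^sup>+x. h x \<partial>lborel) = ennreal (c\<^sup>2) * (\<integral>\<^sup>+x. h (t + c *\<^sub>R x) \<partial>lborel)"
proof -
  have "(\<integral>\<^sup>+x. h x \<partial>lborel) = (\<integral>\<^sup>+x. h x \<partial>(density (distr lborel borel (\<lambda>x. t + c *\<^sub>R x)) (\<lambda>_. ennreal (\<bar>c\<bar>^DIM(real^2)))))"
    using lborel_affine[OF c, of t] by simp
  also have "\<dots> = ennreal (c\<^sup>2) * (\<integral>\<^sup>+x. h (t + c *\<^sub>R x) \<partial>lborel)"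
    by (simp add: nn_integral_density nn_integral_distr nn_integral_cmult)
  finally show ?thesis .
qed

lemma nn_integral_reflect:
  fixes a :: "real^2" and h :: "real^2 \<Rightarrow> ennreal"
  assumes [measurable]: "h \<in> borel_measurable borel"
  shows "(\<integral>\<^sup>+x. h (a - x) \<partial>lborel) = (\<integral>\<^sup>+x. h x \<partial>lborel)"
  using nn_integral_affine[of h "-1" a] by simp

lemma nn_integral_translate:
  fixes a :: "real^2" and h :: "real^2 \<Rightarrow> ennreal"
  assumes [measurable]: "h \<in> borel_measurable borel"
  shows "(\<integral>\<^sup>+x. h (x - a) \<partial>lborel) = (\<integral>\<^sup>+x. h x \<partial>lborel)"
  using nn_integral_affine[of h "1" "-a"] by simp

text \<open>
  After rescaling to \<open>exp (-|z|\<^sup>2)\<close> the integral over the plane is the square of the one-dimensional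
  Gaussian integral.
\<close>

lemma nn_integral_gauss_weight:
  assumes t: "t > 0"
  shows "(\<integral>\<^sup>+z. ennreal (gauss_weight t z) \<partial>lborel) = ennreal (4 * pi * t)"
proof -
  have full: "(\<integral>\<^sup>+x. ennreal (exp (- x\<^sup>2)) \<partial>lborel) = ennreal (sqrt pi)"
  proof -
    have hb: "has_bochner_integral lborel (\<lambda>x. exp (- x\<^sup>2) :: real) (2 * (sqrt pi / 2))"
      using has_bochner_integral_even_function[OF gaussian_moment_0] by simp
    then have "(\<integral>\<^sup>+x. ennreal (exp (- x\<^sup>2)) \<partial>lborel) = ennreal (LINT x|lborel. exp (- x\<^sup>2))"
      by (intro nn_integral_eq_integral) (auto simp: has_bochner_integral_iff)
    with hb show ?thesis by (simp add: has_bochner_integral_iff)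
  qed
  have "ennreal (exp (- (norm z)\<^sup>2)) = (\<Prod>b\<in>Basis. ennreal (exp (- (z \<bullet> b)\<^sup>2)))" for z :: "real^2"
  proof -
    have "(norm z)\<^sup>2 = (\<Sum>b\<in>Basis. (z \<bullet> b)\<^sup>2)"
      unfolding power2_norm_eq_inner by (subst euclidean_inner) (simp add: power2_eq_square)
    then show ?thesis by (simp add: prod_ennreal exp_sum sum_negf[symmetric])
  qed
  then have one: "(\<integral>\<^sup>+z. ennreal (exp (- (norm (z::real^2))\<^sup>2)) \<partial>lborel) = ennreal pi"
    using nn_integral_lborel_prod[of "\<lambda>(_::real^2) x. ennreal (exp (- x\<^sup>2))"]
    by (simp add: full ennreal_power)
  have "(\<integral>\<^sup>+z. ennreal (gauss_weight t z) \<partial>lborel)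
      = ennreal ((2 * sqrt t)\<^sup>2) * (\<integral>\<^sup>+z. ennreal (gauss_weight t (0 + (2 * sqrt t) *\<^sub>R z)) \<partial>lborel)"
    using t by (intro nn_integral_affine) auto
  also have "(\<lambda>z. gauss_weight t (0 + (2 * sqrt t) *\<^sub>R z)) = (\<lambda>z. exp (- (norm z)\<^sup>2))"
    using t by (auto simp: gauss_weight_def fun_eq_iff power_mult_distrib)
  finally show ?thesis using t by (simp add: one power_mult_distrib ennreal_mult' mult_ac ennreal_mult)
qed

lemma nn_integral_heat_kernel:
  assumes t: "t > 0"
  shows "(\<integral>\<^sup>+z. ennreal (heat_kernel t (x - z)) \<partial>lborel) = 1"
proof -
  have "(\<integral>\<^sup>+z. ennreal (heat_kernel t (x - z)) \<partial>lborel) = (\<integral>\<^sup>+z. ennreal (heat_kernel t z) \<partial>lborel)"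
    by (rule nn_integral_reflect) measurable
  also have "\<dots> = (\<integral>\<^sup>+z. ennreal (1 / (4 * pi * t)) * ennreal (gauss_weight t z) \<partial>lborel)"
    using t by (simp add: heat_kernel_eq_weight gauss_weight_nonneg flip: ennreal_mult)
  also have "\<dots> = 1"
    using t by (simp add: nn_integral_cmult nn_integral_gauss_weight flip: ennreal_mult)
  finally show ?thesis .
qed

text \<open>
  Completing the square in \<open>z\<close>: a product of two Gaussians in \<open>z\<close> is a Gaussian in \<open>z\<close> with a shifted centre,
  times a factor independent of \<open>z\<close>.
\<close>

lemma heat_kernel_mult_weight:
  assumes s: "s > 0" and r: "r > 0"
  shows "heat_kernel s (x - z) * gauss_weight r z
    = r / (r + s) * gauss_weight (r + s) x * heat_kernel (r * s / (r + s)) ((r / (r + s)) *\<^sub>R x - z)"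
proof -
  have rs: "r + s > 0" using assms by simp
  have n1: "(norm (x - z))\<^sup>2 = (norm x)\<^sup>2 - 2 * (x \<bullet> z) + (norm z)\<^sup>2"
    by (simp add: power2_norm_eq_inner inner_diff inner_commute)
  have n2: "(norm ((r / (r + s)) *\<^sub>R x - z))\<^sup>2
      = (r / (r + s))\<^sup>2 * (norm x)\<^sup>2 - 2 * (r / (r + s)) * (x \<bullet> z) + (norm z)\<^sup>2"
    unfolding power2_norm_eq_inner
    by (simp add: inner_diff inner_commute power2_eq_square)
  have "- (norm (x - z))\<^sup>2 / (4 * s) - (norm z)\<^sup>2 / (4 * r)
     = - (norm x)\<^sup>2 / (4 * (r + s)) - (norm ((r / (r + s)) *\<^sub>R x - z))\<^sup>2 / (4 * (r * s / (r + s)))"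
    unfolding n1 n2 using s r rs
    by (simp add: divide_simps power2_eq_square) algebra
  then have e: "exp (- (norm (x - z))\<^sup>2 / (4 * s)) * exp (- (norm z)\<^sup>2 / (4 * r))
     = exp (- (norm x)\<^sup>2 / (4 * (r + s))) * exp (- (norm ((r / (r + s)) *\<^sub>R x - z))\<^sup>2 / (4 * (r * s / (r + s))))"
    by (metis (no_types) exp_add diff_conv_add_uminus minus_divide_left)
  show ?thesis
    unfolding heat_kernel_def gauss_weight_def using e s r rs
    by (simp add: divide_simps)
qed

text \<open>
  The reason for using Gaussian cut-offs: the heat semigroup only widens and lowers them.
\<close>

lemma heat_nn_gauss_weight:
  assumes s: "s > 0" and r: "r > 0"
  shows "heat_nn s (\<lambda>z. ennreal (gauss_weight r z)) x = ennreal (r / (r + s) * gauss_weight (r + s) x)"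
proof -
  have "heat_nn s (\<lambda>z. ennreal (gauss_weight r z)) x
    = (\<integral>\<^sup>+z. ennreal (r / (r + s) * gauss_weight (r + s) x)
        * ennreal (heat_kernel (r * s / (r + s)) ((r / (r + s)) *\<^sub>R x - z)) \<partial>lborel)"
    unfolding heat_nn_def
    by (intro nn_integral_cong)
       (use s r in \<open>simp add: heat_kernel_mult_weight gauss_weight_nonneg heat_kernel_nonneg flip: ennreal_mult\<close>)
  also have "\<dots> = ennreal (r / (r + s) * gauss_weight (r + s) x)"
    using s r by (simp add: nn_integral_cmult nn_integral_heat_kernel)
  finally show ?thesis .
qed

lemma heat_nn_gauss_weight_le:
  assumes "s > 0" "r > 0"
  shows "heat_nn s (\<lambda>z. ennreal (gauss_weight r z)) x \<le> ennreal (gauss_weight (r + s) x)"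
  unfolding heat_nn_gauss_weight[OF assms]
  using assms by (intro ennreal_leI mult_left_le_one_le) (auto simp: gauss_weight_nonneg)

lemma heat_nn_symmetric:
  assumes [measurable]: "a \<in> borel_measurable borel" "b \<in> borel_measurable borel"
  shows "(\<integral>\<^sup>+x. a x * heat_nn t b x \<partial>lborel) = (\<integral>\<^sup>+z. b z * heat_nn t a z \<partial>lborel)"
proof -
  have "(\<integral>\<^sup>+x. a x * heat_nn t b x \<partial>lborel)
      = (\<integral>\<^sup>+x. (\<integral>\<^sup>+z. a x * (ennreal (heat_kernel t (x - z)) * b z) \<partial>lborel) \<partial>lborel)"
    unfolding heat_nn_def by (subst nn_integral_cmult) auto
  also have "\<dots> = (\<integral>\<^sup>+z. (\<integral>\<^sup>+x. a x * (ennreal (heat_kernel t (x - z)) * b z) \<partial>lborel) \<partial>lborel)"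
    by (rule lborel_pair.Fubini') measurable
  also have "\<dots> = (\<integral>\<^sup>+z. (\<integral>\<^sup>+x. b z * (ennreal (heat_kernel t (z - x)) * a x) \<partial>lborel) \<partial>lborel)"
    by (simp add: heat_kernel_commute mult_ac)
  also have "\<dots> = (\<integral>\<^sup>+z. b z * heat_nn t a z \<partial>lborel)"
    unfolding heat_nn_def by (subst nn_integral_cmult) auto
  finally show ?thesis .
qed

lemma heat_nn_kernel:
  assumes s: "s > 0" and t: "t > 0"
  shows "(\<integral>\<^sup>+y. ennreal (heat_kernel t (x - y)) * ennreal (heat_kernel s (y - z)) \<partial>lborel)
    = ennreal (heat_kernel (s + t) (x - z))"
proof -
  have "(\<integral>\<^sup>+y. ennreal (heat_kernel t (x - y)) * ennreal (heat_kernel s (y - z)) \<partial>lborel)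
    = (\<integral>\<^sup>+y. ennreal (heat_kernel t ((x - z) - (y - z))) * ennreal (heat_kernel s (y - z)) \<partial>lborel)"
    by simp
  also have "\<dots> = (\<integral>\<^sup>+y. ennreal (heat_kernel t ((x - z) - y)) * ennreal (heat_kernel s y) \<partial>lborel)"
    by (rule nn_integral_translate[where h = "\<lambda>y. ennreal (heat_kernel t ((x - z) - y)) * ennreal (heat_kernel s y)"]) measurable
  also have "\<dots> = ennreal (1 / (4 * pi * s)) * heat_nn t (\<lambda>z. ennreal (gauss_weight s z)) (x - z)"
    unfolding heat_nn_def using s t
    by (subst nn_integral_cmult[symmetric])
       (auto intro!: nn_integral_cong simp: heat_kernel_eq_weight gauss_weight_nonneg simp flip: ennreal_mult)
  also have "\<dots> = ennreal (heat_kernel (s + t) (x - z))"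
    using s t by (simp add: heat_nn_gauss_weight heat_kernel_eq_weight gauss_weight_nonneg flip: ennreal_mult)
  finally show ?thesis .
qed

lemma heat_nn_semigroup:
  assumes [measurable]: "h \<in> borel_measurable borel" and s: "s > 0" and t: "t > 0"
  shows "heat_nn t (heat_nn s h) x = heat_nn (s + t) h x"
proof -
  have "heat_nn t (heat_nn s h) x
    = (\<integral>\<^sup>+y. (\<integral>\<^sup>+z. ennreal (heat_kernel t (x - y)) * (ennreal (heat_kernel s (y - z)) * h z) \<partial>lborel) \<partial>lborel)"
    unfolding heat_nn_def by (subst nn_integral_cmult) auto
  also have "\<dots> = (\<integral>\<^sup>+z. (\<integral>\<^sup>+y. ennreal (heat_kernel t (x - y)) * (ennreal (heat_kernel s (y - z)) * h z) \<partial>lborel) \<partial>lborel)"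
    by (rule lborel_pair.Fubini') measurable
  also have "\<dots> = (\<integral>\<^sup>+z. h z * (\<integral>\<^sup>+y. ennreal (heat_kernel t (x - y)) * ennreal (heat_kernel s (y - z)) \<partial>lborel) \<partial>lborel)"
    by (subst nn_integral_cmult[symmetric]) (auto simp: mult_ac)
  also have "\<dots> = heat_nn (s + t) h x"
    unfolding heat_nn_kernel[OF s t] heat_nn_def by (simp add: mult.commute)
  finally show ?thesis .
qed

section \<open>Functions integrable against every Gaussian\<close>

text \<open>
  A class of initial data that is stable under the heat flow, multiplication by \<open>|z|\<close> and subtraction
  of constants, and that contains the self-similar data of the theorem, which are in general not square integrable.
\<close>

definition gauss_integrable :: "(real^2 \<Rightarrow> real) \<Rightarrow> bool" where
  "gauss_integrable g \<longleftrightarrow> g \<in> borel_measurable borel \<and>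
     (\<forall>r>0. (\<integral>\<^sup>+z. ennreal \<bar>g z\<bar> * ennreal (gauss_weight r z) \<partial>lborel) < \<infinity>)"

lemma gauss_integrableD:
  assumes "gauss_integrable g" "r > 0"
  shows "integrable lborel (\<lambda>z. gauss_weight r z * g z)"
proof -
  have [measurable]: "g \<in> borel_measurable borel" using assms by (simp add: gauss_integrable_def)
  show ?thesis
    using assms unfolding gauss_integrable_def
    by (intro integrableI_bounded)
       (auto simp: abs_mult gauss_weight_nonneg mult.commute ennreal_mult)
qed

lemma gauss_integrable_const: "gauss_integrable (\<lambda>_. c)"
proof -
  have "(\<integral>\<^sup>+z. ennreal \<bar>c\<bar> * ennreal (gauss_weight r z) \<partial>lborel) < \<infinity>" if "r > 0" for r
    using that by (subst nn_integral_cmult) (auto simp: nn_integral_gauss_weight ennreal_mult_less_top)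
  then show ?thesis by (auto simp: gauss_integrable_def)
qed

lemma gauss_integrable_diff:
  assumes "gauss_integrable f" "gauss_integrable g"
  shows "gauss_integrable (\<lambda>z. f z - g z)"
proof -
  have [measurable]: "f \<in> borel_measurable borel" "g \<in> borel_measurable borel"
    using assms by (auto simp: gauss_integrable_def)
  have "(\<integral>\<^sup>+z. ennreal \<bar>f z - g z\<bar> * ennreal (gauss_weight r z) \<partial>lborel) < \<infinity>" if r: "r > 0" for r
  proof -
    have "(\<integral>\<^sup>+z. ennreal \<bar>f z - g z\<bar> * ennreal (gauss_weight r z) \<partial>lborel)
       \<le> (\<integral>\<^sup>+z. ennreal \<bar>f z\<bar> * ennreal (gauss_weight r z) + ennreal \<bar>g z\<bar> * ennreal (gauss_weight r z) \<partial>lborel)"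
      by (intro nn_integral_mono)
         (auto simp: distrib_right[symmetric] simp flip: ennreal_plus intro!: mult_right_mono)
    also have "\<dots> < \<infinity>"
      using assms r by (subst nn_integral_add) (auto simp: gauss_integrable_def)
    finally show ?thesis .
  qed
  then show ?thesis by (auto simp: gauss_integrable_def)
qed

text \<open>
  Doubling the width of a Gaussian pays for a polynomial factor.
\<close>

lemma norm_mult_gauss_weight_le:
  assumes r: "r > 0"
  shows "norm z * gauss_weight r z \<le> (1 + 8 * r) * gauss_weight (2 * r) z"
proof -
  define a where "a = (norm z)\<^sup>2 / (8 * r)"
  have a0: "a \<ge> 0" using r by (simp add: a_def)
  have "norm z \<le> 1 + (norm z)\<^sup>2"
    using zero_le_power2[of "norm z - 1/2"] by (simp add: power2_eq_square algebra_simps)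
  also have "(norm z)\<^sup>2 = 8 * r * a" using r by (simp add: a_def)
  also have "1 + 8 * r * a \<le> exp a + 8 * r * exp a"
    using r a0 exp_ge_add_one_self[of a] by (intro add_mono mult_left_mono) linarith+
  finally have "norm z * gauss_weight r z \<le> ((1 + 8 * r) * exp a) * gauss_weight r z"
    by (intro mult_right_mono) (auto simp: gauss_weight_nonneg algebra_simps)
  also have "\<dots> = (1 + 8 * r) * gauss_weight (2 * r) z"
    using r unfolding gauss_weight_def a_def by (simp flip: exp_add)
  finally show ?thesis .
qed

lemma gauss_integrable_norm_mult:
  assumes "gauss_integrable g"
  shows "gauss_integrable (\<lambda>z. norm (z - a) * g z)"
proof -
  have [measurable]: "g \<in> borel_measurable borel" using assms by (simp add: gauss_integrable_def)
  have "(\<integral>\<^sup>+z. ennreal \<bar>norm (z - a) * g z\<bar> * ennreal (gauss_weight r z) \<partial>lborel) < \<infinity>" if r: "r > 0" for r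
  proof -
    define C where "C = norm a + 1 + 8 * r"
    have C: "C \<ge> 0" using r by (simp add: C_def)
    have "\<bar>norm (z - a) * g z\<bar> * gauss_weight r z \<le> C * (\<bar>g z\<bar> * gauss_weight (2 * r) z)" for z
    proof -
      have "norm (z - a) * gauss_weight r z \<le> (norm z + norm a) * gauss_weight r z"
        by (intro mult_right_mono norm_triangle_ineq4 gauss_weight_nonneg)
      also have "\<dots> \<le> (norm a + 1 + 8 * r) * gauss_weight (2 * r) z"
        using norm_mult_gauss_weight_le[OF r, of z] gauss_weight_mono[of r "2 * r" z] r
          mult_left_mono[of "gauss_weight r z" "gauss_weight (2 * r) z" "norm a"]
        by (simp add: algebra_simps)
      finally have "\<bar>g z\<bar> * (norm (z - a) * gauss_weight r z) \<le> \<bar>g z\<bar> * ((norm a + 1 + 8 * r) * gauss_weight (2 * r) z)"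
        by (intro mult_left_mono) auto
      then show ?thesis by (simp add: abs_mult mult_ac C_def)
    qed
    then have "(\<integral>\<^sup>+z. ennreal \<bar>norm (z - a) * g z\<bar> * ennreal (gauss_weight r z) \<partial>lborel)
       \<le> (\<integral>\<^sup>+z. ennreal C * (ennreal \<bar>g z\<bar> * ennreal (gauss_weight (2 * r) z)) \<partial>lborel)"
      using r C by (intro nn_integral_mono) (auto simp: gauss_weight_nonneg simp flip: ennreal_mult)
    also have "\<dots> < \<infinity>"
      using assms r by (subst nn_integral_cmult) (auto simp: gauss_integrable_def ennreal_mult_less_top)
    finally show ?thesis .
  qed
  then show ?thesis by (auto simp: gauss_integrable_def)
qed

text \<open>
  From \<open>|z|\<^sup>2 \<le> 2|x - z|\<^sup>2 + 2|x|\<^sup>2\<close>.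
\<close>

lemma heat_kernel_le_weight:
  assumes t: "t > 0"
  shows "heat_kernel t (x - z) \<le> exp ((norm x)\<^sup>2 / (4 * t)) / (4 * pi * t) * gauss_weight (2 * t) z"
proof -
  have "(norm z)\<^sup>2 \<le> (norm (x - z) + norm x)\<^sup>2"
    by (intro power_mono) (metis norm_minus_commute norm_triangle_sub add.commute, simp)
  also have "\<dots> \<le> 2 * (norm (x - z))\<^sup>2 + 2 * (norm x)\<^sup>2"
    using zero_le_power2[of "norm (x - z) - norm x"] by (simp add: power2_eq_square algebra_simps)
  finally have "- (norm (x - z))\<^sup>2 / (4 * t) \<le> (norm x)\<^sup>2 / (4 * t) + - (norm z)\<^sup>2 / (4 * (2 * t))"
    using t by (simp add: field_simps)
  then have "exp (- (norm (x - z))\<^sup>2 / (4 * t)) \<le> exp ((norm x)\<^sup>2 / (4 * t)) * exp (- (norm z)\<^sup>2 / (4 * (2 * t)))"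
    by (simp flip: exp_add)
  then show ?thesis
    using t unfolding heat_kernel_def gauss_weight_def by (simp add: divide_right_mono)
qed

lemma heat_nn_finite:
  assumes "gauss_integrable g" and t: "t > 0"
  shows "heat_nn t (\<lambda>z. ennreal \<bar>g z\<bar>) x < \<infinity>"
proof -
  have [measurable]: "g \<in> borel_measurable borel" using assms by (simp add: gauss_integrable_def)
  define C where "C = exp ((norm x)\<^sup>2 / (4 * t)) / (4 * pi * t)"
  have C: "C \<ge> 0" using t by (simp add: C_def)
  have "heat_kernel t (x - z) * \<bar>g z\<bar> \<le> C * (\<bar>g z\<bar> * gauss_weight (2 * t) z)" for z
    using mult_right_mono[OF heat_kernel_le_weight[OF t, of x z], of "\<bar>g z\<bar>"] by (simp add: C_def mult_ac)
  then have "heat_nn t (\<lambda>z. ennreal \<bar>g z\<bar>) x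
     \<le> (\<integral>\<^sup>+z. ennreal C * (ennreal \<bar>g z\<bar> * ennreal (gauss_weight (2 * t) z)) \<partial>lborel)"
    unfolding heat_nn_def using t C
    by (intro nn_integral_mono) (auto simp: gauss_weight_nonneg heat_kernel_nonneg simp flip: ennreal_mult)
  also have "\<dots> < \<infinity>"
    using assms t by (subst nn_integral_cmult) (auto simp: gauss_integrable_def ennreal_mult_less_top)
  finally show ?thesis .
qed

lemma integrable_heat:
  assumes "gauss_integrable g" and t: "t > 0"
  shows "integrable lborel (\<lambda>z. heat_kernel t (x - z) * g z)"
proof -
  have [measurable]: "g \<in> borel_measurable borel" using assms by (simp add: gauss_integrable_def)
  show ?thesis
    using heat_nn_finite[OF assms, of x] unfolding heat_nn_def
    by (intro integrableI_bounded) (auto simp: abs_mult heat_kernel_nonneg t ennreal_mult)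
qed

lemma heat_abs_le:
  assumes "gauss_integrable g" and t: "t > 0"
  shows "ennreal \<bar>heat t g x\<bar> \<le> heat_nn t (\<lambda>z. ennreal \<bar>g z\<bar>) x"
  using integral_norm_bound_ennreal[OF integrable_heat[OF assms, of x]]
  by (simp add: heat_def heat_nn_def abs_mult heat_kernel_nonneg t ennreal_mult)

lemma heat_nonneg_eq:
  assumes "gauss_integrable g" and t: "t > 0" and "\<And>z. g z \<ge> 0"
  shows "ennreal (heat t g x) = heat_nn t (\<lambda>z. ennreal (g z)) x"
  unfolding heat_def heat_nn_def
  using nn_integral_eq_integral[OF integrable_heat[OF assms(1,2), of x]] assms
  by (simp add: heat_kernel_nonneg ennreal_mult)

lemma heat_const: "t > 0 \<Longrightarrow> heat t (\<lambda>_. c) x = c"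
proof -
  assume t: "t > 0"
  have "ennreal (heat t (\<lambda>_. 1) x) = 1"
    using heat_nonneg_eq[OF gauss_integrable_const t, of 1 x] t
    by (simp add: heat_nn_def nn_integral_heat_kernel)
  then have "heat t (\<lambda>_. 1) x = 1" by (simp add: ennreal_eq_1)
  then show ?thesis by (simp add: heat_def)
qed

lemma heat_diff:
  assumes "gauss_integrable f" "gauss_integrable g" "t > 0"
  shows "heat t (\<lambda>z. f z - g z) x = heat t f x - heat t g x"
  unfolding heat_def
  using integrable_heat[OF assms(1,3), of x] integrable_heat[OF assms(2,3), of x]
  by (simp add: right_diff_distrib)

lemma gauss_integrable_heat:
  assumes f: "gauss_integrable f" and s: "s > 0"
  shows "gauss_integrable (heat s f)"
proof -
  have [measurable]: "f \<in> borel_measurable borel" using assms by (simp add: gauss_integrable_def)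
  have "(\<integral>\<^sup>+z. ennreal \<bar>heat s f z\<bar> * ennreal (gauss_weight r z) \<partial>lborel) < \<infinity>" if r: "r > 0" for r
  proof -
    have "(\<integral>\<^sup>+z. ennreal \<bar>heat s f z\<bar> * ennreal (gauss_weight r z) \<partial>lborel)
      \<le> (\<integral>\<^sup>+z. ennreal (gauss_weight r z) * heat_nn s (\<lambda>z. ennreal \<bar>f z\<bar>) z \<partial>lborel)"
      by (subst mult.commute) (intro nn_integral_mono mult_left_mono heat_abs_le f s, simp)
    also have "\<dots> = (\<integral>\<^sup>+z. ennreal \<bar>f z\<bar> * heat_nn s (\<lambda>z. ennreal (gauss_weight r z)) z \<partial>lborel)"
      by (rule heat_nn_symmetric) auto
    also have "\<dots> \<le> (\<integral>\<^sup>+z. ennreal \<bar>f z\<bar> * ennreal (gauss_weight (r + s) z) \<partial>lborel)"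
      by (intro nn_integral_mono mult_left_mono heat_nn_gauss_weight_le s r) simp
    also have "\<dots> < \<infinity>" using f r s by (simp add: gauss_integrable_def)
    finally show ?thesis .
  qed
  then show ?thesis by (auto simp: gauss_integrable_def)
qed

lemma heat_semigroup:
  assumes f: "gauss_integrable f" and s: "s > 0" and t: "t > 0"
  shows "heat t (heat s f) x = heat (s + t) f x"
proof -
  have [measurable]: "f \<in> borel_measurable borel" using assms by (simp add: gauss_integrable_def)
  define F where "F = (\<lambda>y z. heat_kernel t (x - y) * (heat_kernel s (y - z) * f z))"
  have [measurable]: "case_prod F \<in> borel_measurable (lborel \<Otimes>\<^sub>M lborel)"
    unfolding F_def by measurable
  have int: "integrable (lborel \<Otimes>\<^sub>M lborel) (case_prod F)"
  proof (rule integrableI_bounded)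
    have "(\<integral>\<^sup>+p. ennreal (norm (case_prod F p)) \<partial>(lborel \<Otimes>\<^sub>M lborel))
      = (\<integral>\<^sup>+y. (\<integral>\<^sup>+z. ennreal (norm (F y z)) \<partial>lborel) \<partial>lborel)"
      by (subst lborel.nn_integral_fst[symmetric]) auto
    also have "\<dots> = heat_nn t (heat_nn s (\<lambda>z. ennreal \<bar>f z\<bar>)) x"
      unfolding heat_nn_def F_def
      by (subst nn_integral_cmult[symmetric])
         (auto simp: abs_mult heat_kernel_nonneg s t ennreal_mult intro!: nn_integral_cong)
    also have "\<dots> < \<infinity>"
      using s t by (subst heat_nn_semigroup) (auto intro!: heat_nn_finite[OF f, unfolded infinity_ennreal_def])
    finally show "(\<integral>\<^sup>+p. ennreal (norm (case_prod F p)) \<partial>(lborel \<Otimes>\<^sub>M lborel)) < \<infinity>" .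
  qed measurable
  have "heat t (heat s f) x = (LINT y|lborel. LINT z|lborel. F y z)"
    unfolding heat_def F_def by simp
  also have "\<dots> = (LINT z|lborel. LINT y|lborel. F y z)"
    by (rule lborel_pair.Fubini_integral[OF int, symmetric])
  also have "\<dots> = (LINT z|lborel. (LINT y|lborel. heat_kernel t (x - y) * heat_kernel s (y - z)) * f z)"
    unfolding F_def by (simp flip: mult.assoc)
  also have "(\<lambda>z. LINT y|lborel. heat_kernel t (x - y) * heat_kernel s (y - z)) = (\<lambda>z. heat_kernel (s + t) (x - z))"
  proof
    fix z
    have "(LINT y|lborel. heat_kernel t (x - y) * heat_kernel s (y - z)) =
        enn2real (\<integral>\<^sup>+y. ennreal (heat_kernel t (x - y) * heat_kernel s (y - z)) \<partial>lborel)"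
      by (rule integral_eq_nn_integral) (auto simp: heat_kernel_nonneg s t)
    also have "\<dots> = heat_kernel (s + t) (x - z)"
      using heat_nn_kernel[OF s t, of x z] s t
      by (simp add: ennreal_mult heat_kernel_nonneg)
    finally show "(LINT y|lborel. heat_kernel t (x - y) * heat_kernel s (y - z)) = heat_kernel (s + t) (x - z)" .
  qed
  finally show ?thesis by (simp add: heat_def)
qed

section \<open>The spatial gradient of a heat flow\<close>

definition exp_integrable :: "(real^2 \<Rightarrow> real) \<Rightarrow> bool" where
  "exp_integrable m \<longleftrightarrow> m \<in> borel_measurable borel \<and>
     (\<forall>K. integrable lborel (\<lambda>z. exp (K * norm z) * m z))"

text \<open>
  Up to a Gaussian factor in \<open>x\<close>, the heat flow is a two-sided Laplace transform evaluated at \<open>x / 2t\<close>.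
  The transform is easy to differentiate under the integral sign, because \<open>exp (x \<bullet> z)\<close> is multiplicative in \<open>x\<close>.
\<close>

definition laplace :: "(real^2 \<Rightarrow> real) \<Rightarrow> real^2 \<Rightarrow> real" where
  "laplace m x = (LINT z|lborel. exp (x \<bullet> z) * m z)"

lemma integrable_dominated:
  fixes f g :: "real^2 \<Rightarrow> real"
  assumes "integrable lborel g" "f \<in> borel_measurable borel" "\<And>z. \<bar>f z\<bar> \<le> \<bar>g z\<bar>"
  shows "integrable lborel f"
proof (rule Bochner_Integration.integrable_bound[OF assms(1)])
  show "f \<in> borel_measurable lborel" using assms(2) by simp
  show "AE z in lborel. norm (f z) \<le> norm (g z)"
    using assms(3) by (intro AE_I2) simp
qed

lemma exp_inner_le: "exp (x \<bullet> z) \<le> exp (norm x * norm z)"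
  using Cauchy_Schwarz_ineq2[of x z] by simp

lemma integrable_laplace:
  assumes "exp_integrable m"
  shows "integrable lborel (\<lambda>z. exp (x \<bullet> z) * m z)"
proof -
  have [measurable]: "m \<in> borel_measurable borel" using assms by (simp add: exp_integrable_def)
  show ?thesis
  proof (rule integrable_dominated)
    show "integrable lborel (\<lambda>z. exp (norm x * norm z) * m z)"
      using assms unfolding exp_integrable_def by blast
    show "(\<lambda>z. exp (x \<bullet> z) * m z) \<in> borel_measurable borel" by measurable
    show "\<bar>exp (x \<bullet> z) * m z\<bar> \<le> \<bar>exp (norm x * norm z) * m z\<bar>" for z
      unfolding abs_mult abs_exp_cancel by (intro mult_right_mono exp_inner_le) simp
  qed
qed

lemma exp_integrable_inner_mult:
  assumes "exp_integrable m"
  shows "exp_integrable (\<lambda>z. (z \<bullet> v) * m z)"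
proof -
  have [measurable]: "m \<in> borel_measurable borel" using assms by (simp add: exp_integrable_def)
  have "integrable lborel (\<lambda>z. exp (K * norm z) * ((z \<bullet> v) * m z))" for K
  proof (rule integrable_dominated)
    show "integrable lborel (\<lambda>z. norm v * (exp ((K + 1) * norm z) * m z))"
      using assms unfolding exp_integrable_def by (intro integrable_mult_right) blast
    fix z :: "real^2"
    have "\<bar>z \<bullet> v\<bar> \<le> norm v * norm z"
      using Cauchy_Schwarz_ineq2[of z v] by (simp add: mult.commute)
    also have "\<dots> \<le> norm v * exp (norm z)"
      using exp_ge_add_one_self[of "norm z"] by - (rule mult_left_mono, linarith, simp)
    finally have "\<bar>z \<bullet> v\<bar> \<le> norm v * exp (norm z)" .
    then have "(exp (K * norm z) * \<bar>m z\<bar>) * \<bar>z \<bullet> v\<bar> \<le> (exp (K * norm z) * \<bar>m z\<bar>) * (norm v * exp (norm z))"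
      by (intro mult_left_mono) auto
    moreover have "exp ((K + 1) * norm z) = exp (K * norm z) * exp (norm z)"
      by (simp add: distrib_right flip: exp_add)
    ultimately show "\<bar>exp (K * norm z) * ((z \<bullet> v) * m z)\<bar> \<le> \<bar>norm v * (exp ((K + 1) * norm z) * m z)\<bar>"
      by (simp add: abs_mult mult_ac)
  qed measurable
  then show ?thesis by (auto simp: exp_integrable_def)
qed

lemma exp_Taylor1_bound: "\<bar>exp d - 1 - d\<bar> \<le> d\<^sup>2 / 2 * exp \<bar>d\<bar>" for d :: real
proof -
  obtain t where t: "\<bar>t\<bar> \<le> \<bar>d\<bar>" "exp d = (\<Sum>m<2. d ^ m / fact m) + exp t / fact 2 * d ^ 2"
    using Maclaurin_exp_le[of d 2] by blast
  have "exp t \<le> exp \<bar>d\<bar>" using t(1) by simp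
  then have "exp t * d\<^sup>2 \<le> exp \<bar>d\<bar> * d\<^sup>2" by (intro mult_right_mono) auto
  then show ?thesis using t(2) by (simp add: eval_nat_numeral abs_mult mult_ac)
qed

text \<open>
  The first-order Taylor remainder of \<open>h \<mapsto> exp ((x + h) \<bullet> z)\<close> is at most \<open>|h|\<^sup>2\<close> times an exponential in \<open>|z|\<close>
  when \<open>|h| \<le> 1\<close>, and this exponential is integrable against \<open>m\<close>.
\<close>

lemma laplace_has_derivative:
  assumes m: "exp_integrable m"
  shows "(laplace m has_derivative (\<lambda>h. laplace (\<lambda>z. (z \<bullet> h) * m z) x)) (at x)"
proof -
  have [measurable]: "m \<in> borel_measurable borel" using assms by (simp add: exp_integrable_def)
  define D where "D = (\<lambda>h. laplace (\<lambda>z. (z \<bullet> h) * m z) x)"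
  note int = integrable_laplace[OF exp_integrable_inner_mult[OF m]]
  have "linear D"
    unfolding D_def laplace_def
    by (rule linearI) (use int in \<open>simp_all add: inner_right_distrib distrib_left distrib_right mult_ac\<close>)
  then have bl: "bounded_linear D" by (simp add: linear_conv_bounded_linear)
  define B where "B = (LINT z|lborel. exp ((norm x + 2) * norm z) * \<bar>m z\<bar>)"
  have iB: "integrable lborel (\<lambda>z. exp ((norm x + 2) * norm z) * \<bar>m z\<bar>)"
  proof -
    have "integrable lborel (\<lambda>z. \<bar>exp ((norm x + 2) * norm z) * m z\<bar>)"
      using m unfolding exp_integrable_def by (intro integrable_abs) blast
    then show ?thesis by (simp add: abs_mult)
  qed
  have rem: "\<bar>laplace m (x + h) - laplace m x - D h\<bar> \<le> B * (norm h)\<^sup>2" if h: "norm h \<le> 1" for h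
  proof -
    have pw: "\<bar>exp ((x + h) \<bullet> z) * m z - exp (x \<bullet> z) * m z - exp (x \<bullet> z) * ((z \<bullet> h) * m z)\<bar>
        \<le> (norm h)\<^sup>2 * (exp ((norm x + 2) * norm z) * \<bar>m z\<bar>)" for z
    proof -
      have zh: "\<bar>z \<bullet> h\<bar> \<le> norm z * norm h" by (rule Cauchy_Schwarz_ineq2)
      also have "\<dots> \<le> norm z" using h by (simp add: mult_left_le)
      finally have zh': "\<bar>z \<bullet> h\<bar> \<le> norm z" .
      have sq: "(z \<bullet> h)\<^sup>2 \<le> (norm z)\<^sup>2 * (norm h)\<^sup>2"
        using power_mono[OF zh, of 2] by (simp add: power_mult_distrib)
      have q: "(norm z)\<^sup>2 / 2 \<le> exp (norm z)"
        using exp_lower_Taylor_quadratic[OF norm_ge_zero, of z] norm_ge_zero[of z] by linarith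
      have "(z \<bullet> h)\<^sup>2 / 2 * exp \<bar>z \<bullet> h\<bar> \<le> (norm h)\<^sup>2 * ((norm z)\<^sup>2 / 2) * exp (norm z)"
        using sq zh' by (intro mult_mono) (auto simp: mult_ac)
      also have "\<dots> \<le> (norm h)\<^sup>2 * exp (norm z) * exp (norm z)"
        using q by (intro mult_right_mono mult_left_mono) auto
      finally have e: "\<bar>exp (z \<bullet> h) - 1 - (z \<bullet> h)\<bar> \<le> (norm h)\<^sup>2 * exp (2 * norm z)"
        using exp_Taylor1_bound[of "z \<bullet> h"] by (simp add: mult.assoc flip: exp_add)
      have "\<bar>exp ((x + h) \<bullet> z) * m z - exp (x \<bullet> z) * m z - exp (x \<bullet> z) * ((z \<bullet> h) * m z)\<bar>
         = exp (x \<bullet> z) * \<bar>m z\<bar> * \<bar>exp (z \<bullet> h) - 1 - (z \<bullet> h)\<bar>"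
      proof -
        have "exp ((x + h) \<bullet> z) * m z - exp (x \<bullet> z) * m z - exp (x \<bullet> z) * ((z \<bullet> h) * m z)
          = exp (x \<bullet> z) * m z * (exp (z \<bullet> h) - 1 - (z \<bullet> h))"
          by (simp add: inner_left_distrib exp_add inner_commute algebra_simps)
        then show ?thesis by (simp add: abs_mult)
      qed
      also have "\<dots> \<le> exp (norm x * norm z) * \<bar>m z\<bar> * ((norm h)\<^sup>2 * exp (2 * norm z))"
        by (intro mult_mono e exp_inner_le) auto
      also have "\<dots> = (norm h)\<^sup>2 * (exp ((norm x + 2) * norm z) * \<bar>m z\<bar>)"
      proof -
        have "exp ((norm x + 2) * norm z) = exp (norm x * norm z) * exp (2 * norm z)"
          by (simp add: distrib_right flip: exp_add)
        then show ?thesis by (simp only: mult_ac)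
      qed
      finally show ?thesis .
    qed
    have "laplace m (x + h) - laplace m x - D h
      = (LINT z|lborel. exp ((x + h) \<bullet> z) * m z - exp (x \<bullet> z) * m z - exp (x \<bullet> z) * ((z \<bullet> h) * m z))"
      unfolding D_def laplace_def
      using integrable_laplace[OF m] int by simp
    also have "\<bar>\<dots>\<bar> \<le> (LINT z|lborel. (norm h)\<^sup>2 * (exp ((norm x + 2) * norm z) * \<bar>m z\<bar>))"
      by (intro order_trans[OF integral_abs_bound] integral_mono pw integrable_abs
            Bochner_Integration.integrable_diff integrable_laplace m int integrable_mult_right iB)
    also have "\<dots> = B * (norm h)\<^sup>2" by (simp add: B_def)
    finally show ?thesis .
  qed
  have lim: "((\<lambda>h. norm (laplace m (x + h) - laplace m x - D h) / norm h) \<longlongrightarrow> 0) (at 0)"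
  proof (rule Lim_null_comparison)
    show "((\<lambda>h. B * norm h) \<longlongrightarrow> 0) (at (0::real^2))"
      by (auto intro!: tendsto_eq_intros)
    have "\<forall>\<^sub>F h in at (0::real^2). norm h < 1" 
      using eventually_at[of "\<lambda>h. norm h < 1" "0::real^2" UNIV] by (auto intro!: exI[of _ 1])
    then show "\<forall>\<^sub>F h in at 0. norm (norm (laplace m (x + h) - laplace m x - D h) / norm h) \<le> B * norm h"
    proof eventually_elim
      case (elim h)
      then show ?case using rem[of h]
        by (cases "h = 0") (auto simp: divide_simps power2_eq_square mult_ac)
    qed
  qed
  have "(laplace m has_derivative D) (at x)"
    unfolding has_derivative_at by (rule conjI[OF bl lim])
  then show ?thesis by (simp only: D_def)
qed

lemma continuous_on_laplace: "exp_integrable m \<Longrightarrow> continuous_on UNIV (laplace m)"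
  by (intro continuous_at_imp_continuous_on ballI has_derivative_continuous[OF laplace_has_derivative])

definition heat_grad :: "real \<Rightarrow> (real^2 \<Rightarrow> real) \<Rightarrow> real^2 \<Rightarrow> real^2" where
  "heat_grad t g x = (LINT z|lborel. (heat_kernel t (x - z) * g z / (2 * t)) *\<^sub>R (z - x))"

lemma integrable_heat_grad:
  assumes g: "gauss_integrable g" and t: "t > 0"
  shows "integrable lborel (\<lambda>z. (heat_kernel t (x - z) * g z / (2 * t)) *\<^sub>R (z - x))"
proof -
  have [measurable]: "g \<in> borel_measurable borel" using assms by (simp add: gauss_integrable_def)
  have "integrable lborel (\<lambda>z. (1 / (2 * t)) * (heat_kernel t (x - z) * (norm (z - x) * g z)))"
    by (intro integrable_mult_right integrable_heat gauss_integrable_norm_mult g t)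
  then show ?thesis
    by (rule Bochner_Integration.integrable_bound) (auto simp: abs_mult mult_ac)
qed

lemma exp_integrable_gauss:
  assumes g: "gauss_integrable g" and t: "t > 0"
  shows "exp_integrable (\<lambda>z. gauss_weight t z * g z / (4 * pi * t))"
proof -
  have [measurable]: "g \<in> borel_measurable borel" using assms by (simp add: gauss_integrable_def)
  have "integrable lborel (\<lambda>z. exp (K * norm z) * (gauss_weight t z * g z / (4 * pi * t)))" for K
  proof (rule integrable_dominated)
    show "integrable lborel (\<lambda>z. exp (2 * t * K\<^sup>2) / (4 * pi * t) * (gauss_weight (2 * t) z * g z))"
      using t by (intro integrable_mult_right gauss_integrableD g) auto
    fix z :: "real^2"
    define a where "a = (norm z)\<^sup>2 / (8 * t)"
    have "0 \<le> (norm z - 4 * t * K)\<^sup>2 / (8 * t)" using t by simp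
    also have "\<dots> = a - K * norm z + 2 * t * K\<^sup>2"
      using t by (simp add: a_def power2_eq_square field_simps)
    finally have "K * norm z + - (2 * a) \<le> 2 * t * K\<^sup>2 + - a" by simp
    moreover have "- (norm z)\<^sup>2 / (4 * t) = - (2 * a)" "- (norm z)\<^sup>2 / (4 * (2 * t)) = - a"
      using t by (simp_all add: a_def)
    ultimately have "K * norm z + - (norm z)\<^sup>2 / (4 * t) \<le> 2 * t * K\<^sup>2 + - (norm z)\<^sup>2 / (4 * (2 * t))"
      by simp
    then have "exp (K * norm z) * gauss_weight t z \<le> exp (2 * t * K\<^sup>2) * gauss_weight (2 * t) z"
      unfolding gauss_weight_def by (simp flip: exp_add)
    then have "(exp (K * norm z) * gauss_weight t z) * (\<bar>g z\<bar> / (4 * pi * t))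
        \<le> (exp (2 * t * K\<^sup>2) * gauss_weight (2 * t) z) * (\<bar>g z\<bar> / (4 * pi * t))"
      using t by (intro mult_right_mono) auto
    then show "\<bar>exp (K * norm z) * (gauss_weight t z * g z / (4 * pi * t))\<bar>
       \<le> \<bar>exp (2 * t * K\<^sup>2) / (4 * pi * t) * (gauss_weight (2 * t) z * g z)\<bar>"
      using t by (simp add: abs_mult gauss_weight_nonneg mult_ac)
  qed measurable
  then show ?thesis by (auto simp: exp_integrable_def)
qed

lemma heat_kernel_factor:
  "t > 0 \<Longrightarrow> heat_kernel t (x - z) = gauss_weight t x * (exp ((x /\<^sub>R (2 * t)) \<bullet> z) * (gauss_weight t z / (4 * pi * t)))"
proof -
  assume t: "t > 0"
  have n: "(norm (x - z))\<^sup>2 = (norm x)\<^sup>2 - 2 * (x \<bullet> z) + (norm z)\<^sup>2"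
    by (simp add: power2_norm_eq_inner inner_diff inner_commute)
  have "- (norm (x - z))\<^sup>2 / (4 * t) = - (norm x)\<^sup>2 / (4 * t) + ((x /\<^sub>R (2 * t)) \<bullet> z + - (norm z)\<^sup>2 / (4 * t))"
    unfolding n using t by (simp add: field_simps)
  then show ?thesis
    unfolding heat_kernel_def gauss_weight_def by (simp only: exp_add) simp
qed

text \<open>
  Every directional component of the gradient is expressed through Laplace transforms; this gives
  both its identification as a derivative and its continuity.
\<close>

lemma heat_grad_inner:
  assumes g: "gauss_integrable g" and t: "t > 0"
    and m_def: "m = (\<lambda>z. gauss_weight t z * g z / (4 * pi * t))"
  shows "heat_grad t g x \<bullet> h
    = gauss_weight t x * (laplace (\<lambda>z. (z \<bullet> h) * m z) (x /\<^sub>R (2 * t)) - (x \<bullet> h) * laplace m (x /\<^sub>R (2 * t))) / (2 * t)"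
proof -
  have m: "exp_integrable m" unfolding m_def by (rule exp_integrable_gauss[OF g t])
  define y where "y = x /\<^sub>R (2 * t)"
  have "heat_grad t g x \<bullet> h = (LINT z|lborel. (heat_kernel t (x - z) * g z / (2 * t)) *\<^sub>R (z - x) \<bullet> h)"
    unfolding heat_grad_def by (rule integral_inner_left[symmetric]) (rule integrable_heat_grad[OF g t])
  also have "\<dots> = (LINT z|lborel. gauss_weight t x / (2 * t) * (exp (y \<bullet> z) * ((z \<bullet> h) * m z)
        - (x \<bullet> h) * (exp (y \<bullet> z) * m z)))"
  proof (intro Bochner_Integration.integral_cong refl)
    fix z
    have hk: "heat_kernel t (x - z) = gauss_weight t x * (exp (y \<bullet> z) * (gauss_weight t z / (4 * pi * t)))"
      unfolding y_def by (rule heat_kernel_factor[OF t])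
    show "(heat_kernel t (x - z) * g z / (2 * t)) *\<^sub>R (z - x) \<bullet> h
      = gauss_weight t x / (2 * t) * (exp (y \<bullet> z) * ((z \<bullet> h) * m z) - (x \<bullet> h) * (exp (y \<bullet> z) * m z))"
      unfolding hk m_def inner_scaleR_left inner_diff_left right_diff_distrib by (simp add: mult_ac)
  qed
  also have "\<dots> = gauss_weight t x / (2 * t) * ((LINT z|lborel. exp (y \<bullet> z) * ((z \<bullet> h) * m z))
       - (x \<bullet> h) * (LINT z|lborel. exp (y \<bullet> z) * m z))"
    using integrable_laplace[OF m] integrable_laplace[OF exp_integrable_inner_mult[OF m]] by simp
  finally show ?thesis by (simp add: laplace_def y_def)
qed

lemma heat_has_gradient:
  assumes g: "gauss_integrable g" and t: "t > 0"
  shows "GDERIV (heat t g) x :> heat_grad t g x"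
proof -
  define m where "m = (\<lambda>z. gauss_weight t z * g z / (4 * pi * t))"
  have m: "exp_integrable m" unfolding m_def by (rule exp_integrable_gauss[OF g t])
  have eq: "heat t g = (\<lambda>x. gauss_weight t x * laplace m (x /\<^sub>R (2 * t)))"
  proof
    fix x
    have "heat t g x = (LINT z|lborel. gauss_weight t x * (exp ((x /\<^sub>R (2 * t)) \<bullet> z) * m z))"
      unfolding heat_def by (intro Bochner_Integration.integral_cong refl) (simp add: heat_kernel_factor[OF t] m_def)
    then show "heat t g x = gauss_weight t x * laplace m (x /\<^sub>R (2 * t))"
      by (simp add: laplace_def)
  qed
  have gw: "gauss_weight t = (\<lambda>x. exp (- (x \<bullet> x) / (4 * t)))"
    by (simp add: gauss_weight_def fun_eq_iff power2_norm_eq_inner)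
  have d1: "(gauss_weight t has_derivative (\<lambda>h. gauss_weight t x * (- (x \<bullet> h) / (2 * t)))) (at x)"
    unfolding gw using t by (auto intro!: derivative_eq_intros simp: inner_commute field_simps)
  have lin: "((\<lambda>x. x /\<^sub>R (2 * t)) has_derivative (\<lambda>h. h /\<^sub>R (2 * t))) (at x)"
    by (auto intro!: derivative_eq_intros)
  have d2: "((\<lambda>x. laplace m (x /\<^sub>R (2 * t))) has_derivative
      (\<lambda>h. laplace (\<lambda>z. (z \<bullet> (h /\<^sub>R (2 * t))) * m z) (x /\<^sub>R (2 * t)))) (at x)"
    using has_derivative_compose[OF lin laplace_has_derivative[OF m]] .
  have "(heat t g has_derivative (\<lambda>h. h \<bullet> heat_grad t g x)) (at x)"
    unfolding eq
  proof (rule has_derivative_eq_rhs[OF has_derivative_mult[OF d1 d2]], rule ext)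
    fix h
    have "laplace (\<lambda>z. (z \<bullet> (h /\<^sub>R (2 * t))) * m z) (x /\<^sub>R (2 * t))
       = laplace (\<lambda>z. (z \<bullet> h) * m z) (x /\<^sub>R (2 * t)) / (2 * t)"
      unfolding laplace_def
      by (subst integral_divide_zero[symmetric]) (rule Bochner_Integration.integral_cong, auto simp: field_simps)
    then show "gauss_weight t x * laplace (\<lambda>z. (z \<bullet> (h /\<^sub>R (2 * t))) * m z) (x /\<^sub>R (2 * t)) +
         gauss_weight t x * (- (x \<bullet> h) / (2 * t)) * laplace m (x /\<^sub>R (2 * t)) = h \<bullet> heat_grad t g x"
      using heat_grad_inner[OF g t m_def, of x h] t
      by (simp add: inner_commute[of h "heat_grad t g x"] field_simps)
  qed
  then show ?thesis by (simp add: gderiv_def)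
qed

lemma continuous_on_heat_grad:
  assumes g: "gauss_integrable g" and t: "t > 0"
  shows "continuous_on UNIV (heat_grad t g)"
proof -
  define m where "m = (\<lambda>z. gauss_weight t z * g z / (4 * pi * t))"
  have m: "exp_integrable m" unfolding m_def by (rule exp_integrable_gauss[OF g t])
  have c: "continuous_on UNIV (\<lambda>x. laplace k (x /\<^sub>R (2 * t)))" if "exp_integrable k" for k
    by (rule continuous_on_compose2[OF continuous_on_laplace[OF that]]) (auto intro!: continuous_intros)
  have gwc: "continuous_on UNIV (gauss_weight t)"
    unfolding gauss_weight_def[abs_def] using t by (auto intro!: continuous_intros)
  show ?thesis
  proof (subst continuous_on_componentwise, safe)
    fix b :: "real^2" assume "b \<in> Basis"
    have "continuous_on UNIV (\<lambda>x. gauss_weight t x * (laplace (\<lambda>z. (z \<bullet> b) * m z) (x /\<^sub>R (2 * t)) - (x \<bullet> b) * laplace m (x /\<^sub>R (2 * t))) / (2 * t))"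
      using t by (intro continuous_intros c m exp_integrable_inner_mult gwc) auto
    then show "continuous_on UNIV (\<lambda>x. heat_grad t g x \<bullet> b)"
      unfolding heat_grad_inner[OF g t m_def] .
  qed
qed

section \<open>The variance of the heat semigroup\<close>

lemma gauss_integrable_cmult:
  assumes "gauss_integrable g"
  shows "gauss_integrable (\<lambda>z. c * g z)"
proof -
  have [measurable]: "g \<in> borel_measurable borel" using assms by (simp add: gauss_integrable_def)
  have "(\<integral>\<^sup>+z. ennreal \<bar>c * g z\<bar> * ennreal (gauss_weight r z) \<partial>lborel) < \<infinity>" if r: "r > 0" for r
  proof -
    have "(\<integral>\<^sup>+z. ennreal \<bar>c * g z\<bar> * ennreal (gauss_weight r z) \<partial>lborel)
       = ennreal \<bar>c\<bar> * (\<integral>\<^sup>+z. ennreal \<bar>g z\<bar> * ennreal (gauss_weight r z) \<partial>lborel)"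
      by (subst nn_integral_cmult[symmetric]) (auto simp: abs_mult ennreal_mult mult_ac)
    then show ?thesis using assms r by (simp add: gauss_integrable_def ennreal_mult_less_top)
  qed
  then show ?thesis by (auto simp: gauss_integrable_def)
qed

lemma heat_cmult: "heat t (\<lambda>z. c * g z) x = c * heat t g x"
  unfolding heat_def by (subst integral_mult_right_zero[symmetric]) (simp add: mult_ac)

text \<open>
  The variance of \<open>g\<close> under the probability density \<open>y \<mapsto> heat_kernel t (x - y)\<close>.
\<close>

definition heat_var :: "real \<Rightarrow> (real^2 \<Rightarrow> real) \<Rightarrow> real^2 \<Rightarrow> real" where
  "heat_var t g x = heat t (\<lambda>y. (g y - heat t g x)\<^sup>2) x"

lemma gauss_integrable_square_diff:
  assumes g: "gauss_integrable g" and g2: "gauss_integrable (\<lambda>y. (g y)\<^sup>2)"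
  shows "gauss_integrable (\<lambda>y. (g y - a)\<^sup>2)"
proof -
  have "(\<lambda>y. (g y - a)\<^sup>2) = (\<lambda>y. (g y)\<^sup>2 - (2 * a * g y - a\<^sup>2))"
    by (simp add: power2_diff fun_eq_iff)
  then show ?thesis
    by (auto intro!: gauss_integrable_diff g2 gauss_integrable_cmult g gauss_integrable_const)
qed

text \<open>
  The decomposition of a second moment about \<open>a\<close> into variance and squared bias. The mean thus
  minimises the second moment, and \<open>a = 0\<close> expresses the variance as a difference of energy densities.
\<close>

lemma heat_square_diff:
  assumes g: "gauss_integrable g" and g2: "gauss_integrable (\<lambda>y. (g y)\<^sup>2)" and t: "t > 0"
  shows "heat t (\<lambda>y. (g y - a)\<^sup>2) x = heat_var t g x + (heat t g x - a)\<^sup>2"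
proof -
  have *: "heat t (\<lambda>y. (g y - b)\<^sup>2) x = heat t (\<lambda>y. (g y)\<^sup>2) x - (2 * b * heat t g x - b\<^sup>2)" for b
  proof -
    have "(\<lambda>y. (g y - b)\<^sup>2) = (\<lambda>y. (g y)\<^sup>2 - (2 * b * g y - b\<^sup>2))"
      by (simp add: power2_diff fun_eq_iff)
    then show ?thesis
      using heat_diff[OF g2 gauss_integrable_diff[OF gauss_integrable_cmult[OF g, of "2 * b"] gauss_integrable_const[of "b\<^sup>2"]] t, of x]
        heat_diff[OF gauss_integrable_cmult[OF g, of "2 * b"] gauss_integrable_const[of "b\<^sup>2"] t, of x]
      by (simp add: heat_cmult heat_const t)
  qed
  show ?thesis unfolding heat_var_def * by (simp add: power2_eq_square algebra_simps)
qed

lemma heat_square: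
  assumes "gauss_integrable g" "gauss_integrable (\<lambda>y. (g y)\<^sup>2)" "t > 0"
  shows "heat t (\<lambda>y. (g y)\<^sup>2) x = heat_var t g x + (heat t g x)\<^sup>2"
  using heat_square_diff[OF assms, of 0 x] by simp

lemma heat_nonneg: "t > 0 \<Longrightarrow> (\<And>z. g z \<ge> 0) \<Longrightarrow> heat t g x \<ge> 0"
  unfolding heat_def by (intro Bochner_Integration.integral_nonneg) (auto simp: heat_kernel_nonneg)

lemma heat_var_nonneg: "t > 0 \<Longrightarrow> heat_var t g x \<ge> 0"
  unfolding heat_var_def by (intro heat_nonneg) auto

lemma norm_square_heat_kernel_le:
  assumes t: "t > 0"
  shows "(norm z)\<^sup>2 * heat_kernel t z \<le> 16 * t * heat_kernel (2 * t) z"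
proof -
  define a where "a = (norm z)\<^sup>2 / (8 * t)"
  have "a * exp (- (2 * a)) \<le> exp a * exp (- (2 * a))"
    using exp_ge_add_one_self[of a] by (intro mult_right_mono) (linarith, simp)
  also have "\<dots> = exp (- a)" by (simp flip: exp_add)
  finally have "8 * t * (a * exp (- (2 * a))) / (4 * pi * t) \<le> 8 * t * exp (- a) / (4 * pi * t)"
    using t by (intro divide_right_mono mult_left_mono) auto
  moreover have "- (norm z)\<^sup>2 / (4 * t) = - (2 * a)" "- (norm z)\<^sup>2 / (4 * (2 * t)) = - a"
      "(norm z)\<^sup>2 = 8 * t * a"
    using t by (simp_all add: a_def)
  ultimately show ?thesis
    using t unfolding heat_kernel_def by (simp only:) (simp add: field_simps)
qed

lemma nn_integral_norm_square_heat_kernel: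
  assumes t: "t > 0"
  shows "(\<integral>\<^sup>+z. ennreal ((norm z)\<^sup>2 * heat_kernel t z) \<partial>lborel) \<le> ennreal (16 * t)"
proof -
  have "(\<integral>\<^sup>+z. ennreal ((norm z)\<^sup>2 * heat_kernel t z) \<partial>lborel)
      \<le> (\<integral>\<^sup>+z. ennreal (16 * t) * ennreal (heat_kernel (2 * t) (0 - z)) \<partial>lborel)"
    using t norm_square_heat_kernel_le[OF t]
    by (intro nn_integral_mono) (auto simp: heat_kernel_nonneg heat_kernel_minus simp flip: ennreal_mult intro!: ennreal_leI)
  also have "\<dots> = ennreal (16 * t)"
    using t nn_integral_heat_kernel[of "2 * t" 0] by (subst nn_integral_cmult) auto
  finally show ?thesis .
qed

lemma GDERIV_unique:
  assumes "GDERIV g x :> a" "GDERIV g x :> b"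
  shows "a = b"
proof -
  have "(\<lambda>h. h \<bullet> a) = (\<lambda>h. h \<bullet> b)"
    using assms unfolding gderiv_def by (rule has_derivative_unique)
  then show ?thesis by (simp only: fun_eq_iff vector_eq_ldot)
qed

lemma heat_grad_shift:
  assumes g: "gauss_integrable g" and t: "t > 0"
  shows "heat_grad t (\<lambda>y. g y - c) x = heat_grad t g x"
proof -
  have g': "gauss_integrable (\<lambda>y. g y - c)"
    by (intro gauss_integrable_diff g gauss_integrable_const)
  have eq: "heat t (\<lambda>y. g y - c) = (\<lambda>x. heat t g x - c)"
    using heat_diff[OF g gauss_integrable_const[of c] t] by (simp add: heat_const t fun_eq_iff)
  have "GDERIV (\<lambda>x. heat t g x - c) x :> heat_grad t (\<lambda>y. g y - c) x"
    using heat_has_gradient[OF g' t, of x] unfolding eq .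
  moreover have "GDERIV (\<lambda>x. heat t g x - c) x :> heat_grad t g x"
    using has_derivative_diff[OF heat_has_gradient[OF g t, of x, unfolded gderiv_def] has_derivative_const[of c]]
    by (simp add: gderiv_def)
  ultimately show ?thesis by (rule GDERIV_unique)
qed

text \<open>
  The kernel of the gradient does not see constants, so \<open>g\<close> may be replaced by its deviation from the mean
  at \<open>x\<close>. Cauchy-Schwarz then splits off the variance from the second moment of the heat kernel.
\<close>

lemma norm_heat_grad_le_var:
  assumes g: "gauss_integrable g" and g2: "gauss_integrable (\<lambda>y. (g y)\<^sup>2)" and t: "t > 0"
  shows "(norm (heat_grad t g x))\<^sup>2 \<le> 4 / t * heat_var t g x"
proof -
  have [measurable]: "g \<in> borel_measurable borel" using g by (simp add: gauss_integrable_def)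
  define k where "k = (\<lambda>y. g y - heat t g x)"
  have [measurable]: "k \<in> borel_measurable borel" unfolding k_def by measurable
  have k: "gauss_integrable k"
    unfolding k_def by (intro gauss_integrable_diff g gauss_integrable_const)
  have k2: "gauss_integrable (\<lambda>y. (k y)\<^sup>2)"
    unfolding k_def by (rule gauss_integrable_square_diff[OF g g2])
  define a where "a = (\<lambda>z. ennreal (sqrt (heat_kernel t (x - z)) * norm (x - z) / (2 * t)))"
  define b where "b = (\<lambda>z. ennreal (sqrt (heat_kernel t (x - z)) * \<bar>k z\<bar>))"
  have [measurable]: "a \<in> borel_measurable borel" "b \<in> borel_measurable borel"
    unfolding a_def b_def by measurable
  have "ennreal (norm (heat_grad t g x)) = ennreal (norm (heat_grad t k x))"
    unfolding k_def by (simp add: heat_grad_shift[OF g t])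
  also have "\<dots> \<le> (\<integral>\<^sup>+z. ennreal (norm ((heat_kernel t (x - z) * k z / (2 * t)) *\<^sub>R (z - x))) \<partial>lborel)"
    unfolding heat_grad_def by (rule integral_norm_bound_ennreal[OF integrable_heat_grad[OF k t]])
  also have "\<dots> = (\<integral>\<^sup>+z. a z * b z \<partial>lborel)"
    unfolding a_def b_def
    by (intro nn_integral_cong)
       (use t in \<open>simp add: heat_kernel_nonneg abs_mult norm_minus_commute mult_ac flip: ennreal_mult\<close>)
  finally have "(ennreal (norm (heat_grad t g x)))\<^sup>2 \<le> (\<integral>\<^sup>+z. a z * b z \<partial>lborel)\<^sup>2"
    by (rule power_mono) simp
  also have "\<dots> \<le> (\<integral>\<^sup>+z. (a z)\<^sup>2 \<partial>lborel) * (\<integral>\<^sup>+z. (b z)\<^sup>2 \<partial>lborel)"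
    by (rule Cauchy_Schwarz_nn_integral) auto
  also have "(\<integral>\<^sup>+z. (b z)\<^sup>2 \<partial>lborel) = ennreal (heat_var t g x)"
    using heat_nonneg_eq[OF k2 t, of x] t
    by (simp add: b_def heat_var_def heat_nn_def k_def ennreal_power power_mult_distrib heat_kernel_nonneg ennreal_mult)
  also have "(\<integral>\<^sup>+z. (a z)\<^sup>2 \<partial>lborel) \<le> ennreal (4 / t)"
  proof -
    have "(\<integral>\<^sup>+z. (a z)\<^sup>2 \<partial>lborel) = (\<integral>\<^sup>+z. ennreal (1 / (4 * t\<^sup>2)) * ennreal ((norm (x - z))\<^sup>2 * heat_kernel t (x - z)) \<partial>lborel)"
      using t by (intro nn_integral_cong)
        (simp add: a_def ennreal_power power_mult_distrib power_divide heat_kernel_nonneg mult_ac flip: ennreal_mult)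
    also have "\<dots> = ennreal (1 / (4 * t\<^sup>2)) * (\<integral>\<^sup>+z. ennreal ((norm (x - z))\<^sup>2 * heat_kernel t (x - z)) \<partial>lborel)"
      by (rule nn_integral_cmult) measurable
    also have "(\<integral>\<^sup>+z. ennreal ((norm (x - z))\<^sup>2 * heat_kernel t (x - z)) \<partial>lborel) = (\<integral>\<^sup>+z. ennreal ((norm z)\<^sup>2 * heat_kernel t z) \<partial>lborel)"
      by (rule nn_integral_reflect) measurable
    also have "ennreal (1 / (4 * t\<^sup>2)) * \<dots> \<le> ennreal (1 / (4 * t\<^sup>2)) * ennreal (16 * t)"
      by (intro mult_left_mono nn_integral_norm_square_heat_kernel t) simp
    also have "\<dots> = ennreal (4 / t)"
      using t by (simp add: power2_eq_square flip: ennreal_mult)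
    finally show ?thesis .
  qed
  finally have "ennreal ((norm (heat_grad t g x))\<^sup>2) \<le> ennreal (4 / t * heat_var t g x)"
    using t heat_var_nonneg[OF t, of g x]
    by (subst ennreal_mult) (simp_all add: ennreal_power mult_right_mono)
  then show ?thesis
    using t heat_var_nonneg[OF t, of g x] by (subst (asm) ennreal_le_iff) auto
qed

lemma square_increment_le_integral:
  fixes \<phi> \<phi>' :: "real \<Rightarrow> real"
  assumes d: "\<And>\<theta>. (\<phi> has_real_derivative \<phi>' \<theta>) (at \<theta>)" and c: "continuous_on UNIV \<phi>'"
  shows "ennreal ((\<phi> 1 - \<phi> 0)\<^sup>2) \<le> (\<integral>\<^sup>+\<theta>. ennreal ((\<phi>' \<theta>)\<^sup>2) * indicator {0..1} \<theta> \<partial>lborel)"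
proof -
  have [measurable]: "\<phi>' \<in> borel_measurable borel" using c by (rule borel_measurable_continuous_onI)
  have cont: "isCont \<phi>' x" for x using c by (simp add: continuous_on_eq_continuous_at)
  have int: "integrable lborel (\<lambda>x. \<phi>' x * indicator {0..1} x)"
    using borel_integrable_atLeastAtMost[of 0 1 \<phi>'] cont by (simp add: mult.commute)
  have "\<phi> 1 - \<phi> 0 = (LINT x|lborel. \<phi>' x * indicator {0..1} x)"
    by (rule integral_FTC_Icc_real[symmetric]) (use d cont in auto)
  then have "ennreal \<bar>\<phi> 1 - \<phi> 0\<bar> \<le> (\<integral>\<^sup>+x. ennreal (norm (\<phi>' x * indicator {0..1} x)) \<partial>lborel)"
    using integral_norm_bound_ennreal[OF int] by simp
  also have "\<dots> = (\<integral>\<^sup>+x. (ennreal \<bar>\<phi>' x\<bar> * indicator {0..1} x) * indicator {0..1} x \<partial>lborel)"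
    by (intro nn_integral_cong) (auto split: split_indicator)
  finally have "(ennreal \<bar>\<phi> 1 - \<phi> 0\<bar>)\<^sup>2 \<le> (\<integral>\<^sup>+x. (ennreal \<bar>\<phi>' x\<bar> * indicator {0..1} x) * indicator {0..1} x \<partial>lborel)\<^sup>2"
    by (rule power_mono) simp
  also have "\<dots> \<le> (\<integral>\<^sup>+x. (ennreal \<bar>\<phi>' x\<bar> * indicator {0..1} x)\<^sup>2 \<partial>lborel) * (\<integral>\<^sup>+x. (indicator {0..1::real} x)\<^sup>2 \<partial>lborel)"
    by (rule Cauchy_Schwarz_nn_integral) auto
  also have "(\<integral>\<^sup>+x. (indicator {0..1::real} x)\<^sup>2 \<partial>lborel) = 1"
  proof -
    have "(\<lambda>x. (indicator {0..1::real} x)\<^sup>2 :: ennreal) = indicator {0..1}"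
      by (auto split: split_indicator simp: fun_eq_iff)
    then show ?thesis by simp
  qed
  also have "(\<integral>\<^sup>+x. (ennreal \<bar>\<phi>' x\<bar> * indicator {0..1} x)\<^sup>2 \<partial>lborel) = (\<integral>\<^sup>+\<theta>. ennreal ((\<phi>' \<theta>)\<^sup>2) * indicator {0..1} \<theta> \<partial>lborel)"
    by (intro nn_integral_cong) (auto split: split_indicator simp: ennreal_power)
  finally show ?thesis by (simp add: ennreal_power)
qed

text \<open>
  Integrate the derivative along the segment from \<open>x\<close> to \<open>x - w\<close>, apply Cauchy-Schwarz, and use that translations
  preserve the integral over \<open>x\<close>.
\<close>

lemma nn_integral_square_increment_le:
  fixes g :: "real^2 \<Rightarrow> real" and G :: "real^2 \<Rightarrow> real^2"
  assumes d: "\<And>x. GDERIV g x :> G x" and c: "continuous_on UNIV G"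
  shows "(\<integral>\<^sup>+x. ennreal ((g (x - w) - g x)\<^sup>2) \<partial>lborel) \<le> ennreal ((norm w)\<^sup>2) * (\<integral>\<^sup>+x. ennreal ((norm (G x))\<^sup>2) \<partial>lborel)"
proof -
  let ?I = "\<lambda>x \<theta>. ennreal ((norm w)\<^sup>2) * (ennreal ((norm (G (x - \<theta> *\<^sub>R w)))\<^sup>2) * indicator {0..1} \<theta>)"
  have [measurable]: "G \<in> borel_measurable borel" using c by (rule borel_measurable_continuous_onI)
  have "ennreal ((g (x - w) - g x)\<^sup>2)
      \<le> (\<integral>\<^sup>+\<theta>. ?I x \<theta> \<partial>lborel)" for x
  proof -
    define \<phi> where "\<phi> = (\<lambda>\<theta>. g (x - \<theta> *\<^sub>R w))"
    define \<phi>' where "\<phi>' = (\<lambda>\<theta>. - (w \<bullet> G (x - \<theta> *\<^sub>R w)))"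
    have "(\<phi> has_real_derivative \<phi>' \<theta>) (at \<theta>)" for \<theta>
    proof -
      have "((\<lambda>\<theta>. x - \<theta> *\<^sub>R w) has_derivative (\<lambda>h. - (h *\<^sub>R w))) (at \<theta>)"
        by (auto intro!: derivative_eq_intros)
      from has_derivative_compose[OF this d[unfolded gderiv_def]] show ?thesis
        unfolding \<phi>_def \<phi>'_def has_field_derivative_def
        by (rule has_derivative_eq_rhs) (simp add: fun_eq_iff)
    qed
    moreover have "continuous_on UNIV \<phi>'"
      unfolding \<phi>'_def by (intro continuous_intros continuous_on_compose2[OF c]) auto
    ultimately have "ennreal ((\<phi> 1 - \<phi> 0)\<^sup>2) \<le> (\<integral>\<^sup>+\<theta>. ennreal ((\<phi>' \<theta>)\<^sup>2) * indicator {0..1} \<theta> \<partial>lborel)"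
      by (rule square_increment_le_integral)
    also have "\<dots> \<le> (\<integral>\<^sup>+\<theta>. ?I x \<theta> \<partial>lborel)"
    proof (rule nn_integral_mono)
      fix \<theta> :: real
      have "(\<phi>' \<theta>)\<^sup>2 \<le> (norm w * norm (G (x - \<theta> *\<^sub>R w)))\<^sup>2"
        unfolding \<phi>'_def using Cauchy_Schwarz_ineq2[of w "G (x - \<theta> *\<^sub>R w)"] power_mono[of "\<bar>w \<bullet> G (x - \<theta> *\<^sub>R w)\<bar>" _ 2]
        by simp
      then have "ennreal ((\<phi>' \<theta>)\<^sup>2) \<le> ennreal ((norm w)\<^sup>2) * ennreal ((norm (G (x - \<theta> *\<^sub>R w)))\<^sup>2)"
        by (simp add: power_mult_distrib flip: ennreal_mult)
      then show "ennreal ((\<phi>' \<theta>)\<^sup>2) * indicator {0..1} \<theta> \<le> ?I x \<theta>"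
        by (auto split: split_indicator)
    qed
    finally show ?thesis by (simp add: \<phi>_def)
  qed
  then have "(\<integral>\<^sup>+x. ennreal ((g (x - w) - g x)\<^sup>2) \<partial>lborel)
    \<le> (\<integral>\<^sup>+x. (\<integral>\<^sup>+\<theta>. ?I x \<theta> \<partial>lborel) \<partial>lborel)"
    by (intro nn_integral_mono)
  also have "\<dots> = (\<integral>\<^sup>+\<theta>. (\<integral>\<^sup>+x. ?I x \<theta> \<partial>lborel) \<partial>lborel)"
    by (rule lborel_pair.Fubini') measurable
  also have "\<dots> = (\<integral>\<^sup>+\<theta>. ennreal ((norm w)\<^sup>2) * (\<integral>\<^sup>+x. ennreal ((norm (G x))\<^sup>2) \<partial>lborel) * indicator {0..1::real} \<theta> \<partial>lborel)"
  proof (rule nn_integral_cong)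
    fix \<theta> :: real
    have "(\<integral>\<^sup>+x. ennreal ((norm (G (x - \<theta> *\<^sub>R w)))\<^sup>2) \<partial>lborel) = (\<integral>\<^sup>+x. ennreal ((norm (G x))\<^sup>2) \<partial>lborel)"
      by (rule nn_integral_translate) measurable
    then show "(\<integral>\<^sup>+x. ?I x \<theta> \<partial>lborel)
        = ennreal ((norm w)\<^sup>2) * (\<integral>\<^sup>+x. ennreal ((norm (G x))\<^sup>2) \<partial>lborel) * indicator {0..1::real} \<theta>"
      by (simp add: nn_integral_cmult nn_integral_multc mult.assoc)
  qed
  also have "\<dots> = ennreal ((norm w)\<^sup>2) * (\<integral>\<^sup>+x. ennreal ((norm (G x))\<^sup>2) \<partial>lborel)"
    by (subst nn_integral_cmult) auto
  finally show ?thesis .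
qed

lemma heat_var_measurable [measurable]:
  assumes "gauss_integrable g" "gauss_integrable (\<lambda>y. (g y)\<^sup>2)" "t > 0"
  shows "heat_var t g \<in> borel_measurable borel"
proof -
  have [measurable]: "g \<in> borel_measurable borel" using assms by (simp add: gauss_integrable_def)
  have "heat_var t g = (\<lambda>x. heat t (\<lambda>y. (g y)\<^sup>2) x - (heat t g x)\<^sup>2)"
    using heat_square[OF assms] by (simp add: fun_eq_iff)
  also have "\<dots> \<in> borel_measurable borel" by measurable
  finally show ?thesis .
qed

text \<open>
  The variance about the mean is at most the second moment about \<open>g x\<close>. That moment averages the squared
  increments \<open>(g (x - w) - g x)\<^sup>2\<close> over \<open>w\<close>, which leads to the second moment of the heat kernel.
\<close>

lemma nn_integral_heat_var_le:
  fixes g :: "real^2 \<Rightarrow> real" and G :: "real^2 \<Rightarrow> real^2"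
  assumes g: "gauss_integrable g" and g2: "gauss_integrable (\<lambda>y. (g y)\<^sup>2)" and t: "t > 0"
    and d: "\<And>x. GDERIV g x :> G x" and c: "continuous_on UNIV G"
  shows "(\<integral>\<^sup>+x. ennreal (heat_var t g x) \<partial>lborel) \<le> ennreal (16 * t) * (\<integral>\<^sup>+x. ennreal ((norm (G x))\<^sup>2) \<partial>lborel)"
proof -
  have [measurable]: "g \<in> borel_measurable borel" using g by (simp add: gauss_integrable_def)
  define I where "I = (\<integral>\<^sup>+x. ennreal ((norm (G x))\<^sup>2) \<partial>lborel)"
  have "ennreal (heat_var t g x) \<le> (\<integral>\<^sup>+w. ennreal (heat_kernel t w) * ennreal ((g (x - w) - g x)\<^sup>2) \<partial>lborel)" for x
  proof -
    have "ennreal (heat_var t g x) \<le> ennreal (heat t (\<lambda>y. (g y - g x)\<^sup>2) x)"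
      unfolding heat_square_diff[OF g g2 t] by (intro ennreal_leI) simp
    also have "\<dots> = heat_nn t (\<lambda>y. ennreal ((g y - g x)\<^sup>2)) x"
      by (rule heat_nonneg_eq[OF gauss_integrable_square_diff[OF g g2] t]) simp
    also have "\<dots> = (\<integral>\<^sup>+z. ennreal (heat_kernel t (x - z)) * ennreal ((g (x - (x - z)) - g x)\<^sup>2) \<partial>lborel)"
      by (simp add: heat_nn_def)
    also have "\<dots> = (\<integral>\<^sup>+w. ennreal (heat_kernel t w) * ennreal ((g (x - w) - g x)\<^sup>2) \<partial>lborel)"
      by (rule nn_integral_reflect[where h = "\<lambda>w. ennreal (heat_kernel t w) * ennreal ((g (x - w) - g x)\<^sup>2)"]) measurable
    finally show ?thesis .
  qed
  then have "(\<integral>\<^sup>+x. ennreal (heat_var t g x) \<partial>lborel)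
     \<le> (\<integral>\<^sup>+x. (\<integral>\<^sup>+w. ennreal (heat_kernel t w) * ennreal ((g (x - w) - g x)\<^sup>2) \<partial>lborel) \<partial>lborel)"
    by (intro nn_integral_mono)
  also have "\<dots> = (\<integral>\<^sup>+w. (\<integral>\<^sup>+x. ennreal (heat_kernel t w) * ennreal ((g (x - w) - g x)\<^sup>2) \<partial>lborel) \<partial>lborel)"
    by (rule lborel_pair.Fubini') measurable
  also have "\<dots> = (\<integral>\<^sup>+w. ennreal (heat_kernel t w) * (\<integral>\<^sup>+x. ennreal ((g (x - w) - g x)\<^sup>2) \<partial>lborel) \<partial>lborel)"
    by (subst nn_integral_cmult) auto
  also have "\<dots> \<le> (\<integral>\<^sup>+w. ennreal (heat_kernel t w) * (ennreal ((norm w)\<^sup>2) * I) \<partial>lborel)"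
    unfolding I_def by (intro nn_integral_mono mult_left_mono nn_integral_square_increment_le d c) simp
  also have "\<dots> = (\<integral>\<^sup>+w. ennreal ((norm w)\<^sup>2 * heat_kernel t w) \<partial>lborel) * I"
    using t by (subst nn_integral_multc[symmetric]) (auto simp: ennreal_mult heat_kernel_nonneg mult_ac)
  also have "\<dots> \<le> ennreal (16 * t) * I"
    by (intro mult_right_mono nn_integral_norm_square_heat_kernel t) simp
  finally show ?thesis by (simp add: I_def)
qed

section \<open>Discretely self-similar functions\<close>

lemma integral_affine:
  fixes h :: "real^2 \<Rightarrow> real"
  assumes [measurable]: "h \<in> borel_measurable borel" and c: "c \<noteq> 0"
  shows "(LINT x|lborel. h x) = c\<^sup>2 * (LINT x|lborel. h (t + c *\<^sub>R x))"
proof -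
  have "(LINT x|lborel. h x) = (LINT x|(density (distr lborel borel (\<lambda>x. t + c *\<^sub>R x)) (\<lambda>_. ennreal (\<bar>c\<bar>^DIM(real^2)))). h x)"
    using lborel_affine[OF c, of t] by simp
  also have "\<dots> = c\<^sup>2 * (LINT x|lborel. h (t + c *\<^sub>R x))"
    by (subst integral_density) (simp_all add: integral_distr)
  finally show ?thesis .
qed

lemma sets_annulus [measurable]: "annulus lam \<in> sets borel"
  unfolding annulus_def by measurable

text \<open>
  Borel measurability and the scaling law at the origin can be arranged by changing the data on a
  null set. The law at the origin forces \<open>f 0 = 0\<close>.
\<close>

locale dss =
  fixes lam :: real and f :: "real^2 \<Rightarrow> real"
  assumes lam: "lam > 1"
    and f_measurable [measurable]: "f \<in> borel_measurable borel"
    and f_scale: "\<And>x. f (lam *\<^sub>R x) = f x / lam"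
begin

definition annulus_energy :: ennreal where
  "annulus_energy = (\<integral>\<^sup>+x\<in>annulus lam. ennreal ((f x)\<^sup>2) \<partial>lborel)"

definition radial_square :: "real^2 \<Rightarrow> ennreal" where
  "radial_square x = ennreal (norm x * (f x)\<^sup>2)"

definition scaling_factor :: "real \<Rightarrow> bool" where
  "scaling_factor c \<longleftrightarrow> c > 0 \<and> (\<forall>x. f (c *\<^sub>R x) = f x / c)"

lemma radial_square_measurable [measurable]: "radial_square \<in> borel_measurable borel"
  unfolding radial_square_def[abs_def] by measurable

lemma lam_pos: "lam > 0" using lam by simp

lemma f_zero: "f 0 = 0"
proof -
  have "f 0 = f 0 / lam" using f_scale[of 0] by simp
  then show ?thesis using lam by (simp add: field_simps)
qed

lemma scale_pos: "scaling_factor c \<Longrightarrow> c > 0" by (simp add: scaling_factor_def)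

lemma scale_f: "scaling_factor c \<Longrightarrow> f (c *\<^sub>R x) = f x / c" by (simp add: scaling_factor_def)

lemma scale_power: "scaling_factor (lam ^ k)"
proof (induction k)
  case (Suc k)
  have "f (lam ^ Suc k *\<^sub>R x) = f x / lam ^ Suc k" for x
    using scale_f[OF Suc, of x] f_scale[of "lam ^ k *\<^sub>R x"] by (simp add: mult.commute)
  then show ?case using lam by (simp add: scaling_factor_def)
qed (simp add: scaling_factor_def)

lemma scale_inverse: "scaling_factor c \<Longrightarrow> scaling_factor (1 / c)"
proof -
  assume c: "scaling_factor c"
  have "f ((1 / c) *\<^sub>R x) = f x / (1 / c)" for x
    using scale_f[OF c, of "(1 / c) *\<^sub>R x"] scale_pos[OF c] by (simp add: field_simps)
  then show ?thesis using scale_pos[OF c] by (simp add: scaling_factor_def)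
qed

lemma scale_lam: "scaling_factor lam" using scale_power[of 1] by simp

text \<open>
  In two dimensions the area factor \<open>c\<^sup>2\<close> cancels the scaling of \<open>f\<^sup>2\<close>: all annuli of the self-similar decomposition
  carry the same energy.
\<close>

lemma nn_integral_shell:
  assumes c: "scaling_factor c"
  shows "(\<integral>\<^sup>+x. ennreal ((f x)\<^sup>2) * indicator {x. c \<le> norm x \<and> norm x < c * lam} x \<partial>lborel) = annulus_energy"
proof -
  let ?S = "{x. c \<le> norm x \<and> norm x < c * lam}"
  note c0 = scale_pos[OF c]
  have "(\<integral>\<^sup>+x. ennreal ((f x)\<^sup>2) * indicator ?S x \<partial>lborel)
     = ennreal (c\<^sup>2) * (\<integral>\<^sup>+x. ennreal ((f (0 + c *\<^sub>R x))\<^sup>2) * indicator ?S (0 + c *\<^sub>R x) \<partial>lborel)"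
    using c0 by (intro nn_integral_affine[where h = "\<lambda>x. ennreal ((f x)\<^sup>2) * indicator ?S x"]) auto
  also have "\<dots> = (\<integral>\<^sup>+x. ennreal (c\<^sup>2) * (ennreal ((f (0 + c *\<^sub>R x))\<^sup>2) * indicator ?S (0 + c *\<^sub>R x)) \<partial>lborel)"
    by (rule nn_integral_cmult[symmetric]) measurable
  also have "\<dots> = annulus_energy"
    unfolding annulus_energy_def
  proof (rule nn_integral_cong)
    fix x :: "real^2"
    have "indicator ?S (0 + c *\<^sub>R x) = (indicator (annulus lam) x :: ennreal)"
      using c0 by (auto simp: indicator_def annulus_def)
    moreover have "ennreal (c\<^sup>2) * ennreal ((f (0 + c *\<^sub>R x))\<^sup>2) = ennreal ((f x)\<^sup>2)"
      using c0 by (simp add: scale_f[OF c] power_divide flip: ennreal_mult)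
    ultimately show "ennreal (c\<^sup>2) * (ennreal ((f (0 + c *\<^sub>R x))\<^sup>2) * indicator ?S (0 + c *\<^sub>R x))
       = ennreal ((f x)\<^sup>2) * indicator (annulus lam) x"
      by (simp add: mult.assoc[symmetric])
  qed
  finally show ?thesis .
qed

lemma ex_shell_outer:
  assumes "norm (x::real^2) \<ge> 1"
  shows "\<exists>k::nat. lam ^ k \<le> norm x \<and> norm x < lam ^ k * lam"
proof -
  define k where "k = (LEAST k. norm x < lam ^ Suc k)"
  obtain n where "norm x < lam ^ n" using real_arch_pow[OF lam] by blast
  then have ex: "norm x < lam ^ Suc n" using lam by (smt (verit) power_Suc mult_le_cancel_right1 zero_less_power)
  have k: "norm x < lam ^ Suc k" unfolding k_def by (rule LeastI[of _ n]) (rule ex)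
  have "lam ^ k \<le> norm x"
  proof (cases k)
    case (Suc j)
    then show ?thesis using not_less_Least[of j "\<lambda>k. norm x < lam ^ Suc k"] by (simp add: k_def)
  qed (use assms in simp)
  with k show ?thesis by (auto simp: mult.commute)
qed

lemma ex_shell_inner:
  assumes "norm (x::real^2) < 1" "x \<noteq> 0"
  shows "\<exists>k::nat. 1 / lam ^ Suc k \<le> norm x \<and> norm x < 1 / lam ^ Suc k * lam"
proof -
  define k where "k = (LEAST k. 1 / lam ^ Suc k \<le> norm x)"
  have "0 < norm x" using assms by simp
  obtain n where n: "1 / norm x < lam ^ n" using real_arch_pow[OF lam] by blast
  also have "lam ^ n \<le> lam ^ Suc n" using lam by simp
  finally have "1 / lam ^ Suc n \<le> norm x"
    using \<open>0 < norm x\<close> lam_pos by (simp add: field_simps)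
  then have k: "1 / lam ^ Suc k \<le> norm x" unfolding k_def by (rule LeastI)
  have "norm x < 1 / lam ^ k"
  proof (cases k)
    case (Suc j)
    then show ?thesis using not_less_Least[of j "\<lambda>k. 1 / lam ^ Suc k \<le> norm x"] by (simp add: k_def not_le)
  qed (use assms in simp)
  with k show ?thesis using lam_pos by (auto simp: field_simps)
qed

text \<open>
  On the annulus of radius \<open>lam\<^sup>k\<close> the weight is of order \<open>1 / lam\<close> to the power \<open>|k|\<close>, so the equal energies of the annuli are summed
  against two geometric series.
\<close>

lemma nn_integral_min_weight:
  "(\<integral>\<^sup>+x. ennreal ((f x)\<^sup>2) * ennreal (min (norm x) (1 / norm x)) \<partial>lborel) \<le> ennreal (2 * lam / (lam - 1)) * annulus_energy"
proof -
  define S where "S = (\<lambda>c (x::real^2). indicator {x. c \<le> norm x \<and> norm x < c * lam} x :: ennreal)"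
  have [measurable]: "S c \<in> borel_measurable borel" for c unfolding S_def by measurable
  define p where "p = (\<lambda>k::nat. ennreal ((1 / lam) ^ k))"
  have geom: "(\<Sum>k. p k) = ennreal (lam / (lam - 1))"
  proof -
    have "(\<lambda>k. (1 / lam) ^ k) sums (1 / (1 - 1 / lam))" using lam by (intro geometric_sums) simp
    then have "(\<Sum>k. p k) = ennreal (1 / (1 - 1 / lam))"
      unfolding p_def using lam by (intro sums_unique[symmetric] sums_ennreal[THEN iffD2]) auto
    also have "1 / (1 - 1 / lam) = lam / (lam - 1)" using lam by (simp add: field_simps)
    finally show ?thesis .
  qed
  have pw: "ennreal (min (norm x) (1 / norm x)) \<le> (\<Sum>k. p k * S (lam ^ k) x) + (\<Sum>k. p k * S (1 / lam ^ Suc k) x)" for x :: "real^2"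
  proof -
    consider "x = 0" | "norm x \<ge> 1" | "norm x < 1" "x \<noteq> 0" by linarith
    then show ?thesis
    proof cases
      case 2
      then obtain k where k: "lam ^ k \<le> norm x" "norm x < lam ^ k * lam" using ex_shell_outer by blast
      have "0 < lam ^ k" using lam_pos by simp
      have "min (norm x) (1 / norm x) \<le> 1 / norm x" by simp
      also have "\<dots> \<le> 1 / lam ^ k" using k(1) \<open>0 < lam ^ k\<close> by (intro divide_left_mono mult_pos_pos) auto
      finally have "ennreal (min (norm x) (1 / norm x)) \<le> p k * S (lam ^ k) x"
        using k by (auto simp: p_def S_def power_one_over intro!: ennreal_leI)
      also have "\<dots> = (\<Sum>j\<in>{k}. p j * S (lam ^ j) x)" by simp
      also have "\<dots> \<le> (\<Sum>k. p k * S (lam ^ k) x)" by (rule sum_le_suminf) auto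
      finally show ?thesis by (rule order_trans) simp
    next
      case 3
      then obtain k where k: "1 / lam ^ Suc k \<le> norm x" "norm x < 1 / lam ^ Suc k * lam" using ex_shell_inner by blast
      have "0 < lam ^ k" using lam_pos by simp
      have "min (norm x) (1 / norm x) \<le> norm x" by simp
      also have "\<dots> \<le> 1 / lam ^ k" using k(2) lam_pos by (simp add: field_simps)
      finally have "ennreal (min (norm x) (1 / norm x)) \<le> p k * S (1 / lam ^ Suc k) x"
        using k by (auto simp: p_def S_def power_one_over intro!: ennreal_leI)
      also have "\<dots> = (\<Sum>j\<in>{k}. p j * S (1 / lam ^ Suc j) x)" by simp
      also have "\<dots> \<le> (\<Sum>k. p k * S (1 / lam ^ Suc k) x)" by (rule sum_le_suminf) auto
      finally show ?thesis by (rule order_trans) simp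
    qed simp
  qed
  have shells: "(\<integral>\<^sup>+x. ennreal ((f x)\<^sup>2) * (\<Sum>k. p k * S (c k) x) \<partial>lborel) = ennreal (lam / (lam - 1)) * annulus_energy"
    if c: "\<And>k. scaling_factor (c k)" for c
  proof -
    have "(\<integral>\<^sup>+x. ennreal ((f x)\<^sup>2) * (\<Sum>k. p k * S (c k) x) \<partial>lborel)
      = (\<integral>\<^sup>+x. (\<Sum>k. p k * (ennreal ((f x)\<^sup>2) * S (c k) x)) \<partial>lborel)"
      by (simp add: ennreal_suminf_cmult[symmetric] mult_ac)
    also have "\<dots> = (\<Sum>k. (\<integral>\<^sup>+x. p k * (ennreal ((f x)\<^sup>2) * S (c k) x) \<partial>lborel))"
      by (rule nn_integral_suminf) measurable
    also have "\<dots> = (\<Sum>k. p k * annulus_energy)"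
      by (simp add: nn_integral_cmult) (simp add: S_def nn_integral_shell[OF c])
    also have "\<dots> = ennreal (lam / (lam - 1)) * annulus_energy" by (simp add: geom)
    finally show ?thesis .
  qed
  have "(\<integral>\<^sup>+x. ennreal ((f x)\<^sup>2) * ennreal (min (norm x) (1 / norm x)) \<partial>lborel)
    \<le> (\<integral>\<^sup>+x. ennreal ((f x)\<^sup>2) * (\<Sum>k. p k * S (lam ^ k) x) + ennreal ((f x)\<^sup>2) * (\<Sum>k. p k * S (1 / lam ^ Suc k) x) \<partial>lborel)"
    unfolding distrib_left[symmetric] by (intro nn_integral_mono mult_left_mono pw) simp
  also have "\<dots> = ennreal (lam / (lam - 1)) * annulus_energy + ennreal (lam / (lam - 1)) * annulus_energy"
    by (subst nn_integral_add) (auto simp: shells scale_power scale_inverse[OF scale_power] simp del: power_Suc)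
  also have "\<dots> = ennreal (2 * lam / (lam - 1)) * annulus_energy"
    using lam by (simp add: distrib_right[symmetric] flip: ennreal_plus)
  finally show ?thesis .
qed

lemma nn_integral_radial_square_weight:
  assumes r: "r > 0"
  shows "(\<integral>\<^sup>+x. radial_square x * ennreal (gauss_weight r x) \<partial>lborel) \<le> ennreal (max 1 (4 * r) * (2 * lam / (lam - 1))) * annulus_energy"
proof -
  have pw: "norm x * gauss_weight r x \<le> max 1 (4 * r) * min (norm x) (1 / norm x)" for x :: "real^2"
  proof (cases "norm x < 1 \<or> x = 0")
    case True
    have "norm x * gauss_weight r x \<le> norm x * 1"
      by (intro mult_left_mono gauss_weight_le_1 r) simp
    also have "\<dots> = 1 * min (norm x) (1 / norm x)"
    proof (cases "x = 0")
      case False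
      have "norm x * norm x < 1 * 1" using True False by (intro mult_strict_mono) auto
      then show ?thesis using False by (simp add: min_def field_simps)
    qed simp
    also have "\<dots> \<le> max 1 (4 * r) * min (norm x) (1 / norm x)"
      by (intro mult_right_mono) auto
    finally show ?thesis .
  next
    case False
    define a where "a = (norm x)\<^sup>2 / (4 * r)"
    have a: "a > 0" using False r by (simp add: a_def)
    have "a * exp (- a) \<le> exp a * exp (- a)" using exp_ge_add_one_self[of a] by (intro mult_right_mono) (linarith, simp)
    then have "a * exp (- a) \<le> 1" by (simp flip: exp_add)
    then have "(norm x * norm x) * gauss_weight r x \<le> 4 * r"
      using r by (simp add: a_def gauss_weight_def power2_eq_square field_simps)
    then have "norm x * gauss_weight r x \<le> 4 * r * (1 / norm x)"
      using False by (simp add: field_simps)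
    also have "\<dots> = 4 * r * min (norm x) (1 / norm x)"
    proof -
      have "1 / norm x \<le> 1" using False by simp
      then have "min (norm x) (1 / norm x) = 1 / norm x" using False by (intro min_absorb2) linarith
      then show ?thesis by simp
    qed
    also have "\<dots> \<le> max 1 (4 * r) * min (norm x) (1 / norm x)"
      by (intro mult_right_mono) auto
    finally show ?thesis .
  qed
  have "(\<integral>\<^sup>+x. radial_square x * ennreal (gauss_weight r x) \<partial>lborel)
     \<le> (\<integral>\<^sup>+x. ennreal (max 1 (4 * r)) * (ennreal ((f x)\<^sup>2) * ennreal (min (norm x) (1 / norm x))) \<partial>lborel)"
  proof (rule nn_integral_mono)
    fix x
    have "(f x)\<^sup>2 * (norm x * gauss_weight r x) \<le> (f x)\<^sup>2 * (max 1 (4 * r) * min (norm x) (1 / norm x))"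
      by (intro mult_left_mono pw) simp
    then have "norm x * (f x)\<^sup>2 * gauss_weight r x \<le> max 1 (4 * r) * ((f x)\<^sup>2 * min (norm x) (1 / norm x))"
      by (simp add: mult_ac)
    then show "radial_square x * ennreal (gauss_weight r x) \<le> ennreal (max 1 (4 * r)) * (ennreal ((f x)\<^sup>2) * ennreal (min (norm x) (1 / norm x)))"
      by (simp add: radial_square_def gauss_weight_nonneg flip: ennreal_mult)
  qed
  also have "\<dots> \<le> ennreal (max 1 (4 * r)) * (ennreal (2 * lam / (lam - 1)) * annulus_energy)"
    by (subst nn_integral_cmult) (auto intro!: mult_left_mono nn_integral_min_weight)
  also have "\<dots> = ennreal (max 1 (4 * r) * (2 * lam / (lam - 1))) * annulus_energy"
    using lam by (subst ennreal_mult) (auto simp: mult.assoc)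
  finally show ?thesis .
qed

lemma nn_integral_radial_square_weight_scale:
  assumes mu: "scaling_factor mu"
  shows "(\<integral>\<^sup>+x. radial_square x * ennreal (gauss_weight (mu\<^sup>2 * r) x) \<partial>lborel)
      = ennreal mu * (\<integral>\<^sup>+x. radial_square x * ennreal (gauss_weight r x) \<partial>lborel)"
proof -
  note m0 = scale_pos[OF mu]
  have "(\<integral>\<^sup>+x. radial_square x * ennreal (gauss_weight (mu\<^sup>2 * r) x) \<partial>lborel)
      = ennreal (mu\<^sup>2) * (\<integral>\<^sup>+x. radial_square (0 + mu *\<^sub>R x) * ennreal (gauss_weight (mu\<^sup>2 * r) (0 + mu *\<^sub>R x)) \<partial>lborel)"
    using m0 by (intro nn_integral_affine[where h = "\<lambda>x. radial_square x * ennreal (gauss_weight (mu\<^sup>2 * r) x)"]) auto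
  also have "\<dots> = (\<integral>\<^sup>+x. ennreal (mu\<^sup>2) * (radial_square (0 + mu *\<^sub>R x) * ennreal (gauss_weight (mu\<^sup>2 * r) (0 + mu *\<^sub>R x))) \<partial>lborel)"
    by (rule nn_integral_cmult[symmetric]) measurable
  also have "\<dots> = (\<integral>\<^sup>+x. ennreal mu * (radial_square x * ennreal (gauss_weight r x)) \<partial>lborel)"
  proof (rule nn_integral_cong)
    fix x
    have 1: "gauss_weight (mu\<^sup>2 * r) (0 + mu *\<^sub>R x) = gauss_weight r x"
      using m0 by (simp add: gauss_weight_def power_mult_distrib)
    have 2: "ennreal (mu\<^sup>2) * radial_square (0 + mu *\<^sub>R x) = ennreal mu * radial_square x"
      using m0 by (simp add: radial_square_def scale_f[OF mu] power_divide power2_eq_square flip: ennreal_mult)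
    show "ennreal (mu\<^sup>2) * (radial_square (0 + mu *\<^sub>R x) * ennreal (gauss_weight (mu\<^sup>2 * r) (0 + mu *\<^sub>R x))) = ennreal mu * (radial_square x * ennreal (gauss_weight r x))"
      unfolding 1 mult.assoc[symmetric] 2 ..
  qed
  also have "\<dots> = ennreal mu * (\<integral>\<^sup>+x. radial_square x * ennreal (gauss_weight r x) \<partial>lborel)"
    by (rule nn_integral_cmult) measurable
  finally show ?thesis .
qed

text \<open>
  The parabolic scaling of the heat equation carries the self-similarity of \<open>f\<close> over to the solution.
\<close>

lemma heat_scale:
  assumes mu: "scaling_factor mu"
  shows "heat (mu\<^sup>2 * s) f (mu *\<^sub>R x) = heat s f x / mu"
proof -
  note m0 = scale_pos[OF mu]
  have "heat (mu\<^sup>2 * s) f (mu *\<^sub>R x) = mu\<^sup>2 * (LINT z|lborel. heat_kernel (mu\<^sup>2 * s) (mu *\<^sub>R x - (0 + mu *\<^sub>R z)) * f (0 + mu *\<^sub>R z))"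
    unfolding heat_def using m0
    by (intro integral_affine[where h = "\<lambda>z. heat_kernel (mu\<^sup>2 * s) (mu *\<^sub>R x - z) * f z"]) auto
  also have "\<dots> = (LINT z|lborel. mu\<^sup>2 * (heat_kernel (mu\<^sup>2 * s) (mu *\<^sub>R x - (0 + mu *\<^sub>R z)) * f (0 + mu *\<^sub>R z)))"
    by simp
  also have "\<dots> = (LINT z|lborel. heat_kernel s (x - z) * f z / mu)"
  proof (rule Bochner_Integration.integral_cong[OF refl])
    fix z
    have "heat_kernel (mu\<^sup>2 * s) (mu *\<^sub>R x - (0 + mu *\<^sub>R z)) = heat_kernel s (x - z) / mu\<^sup>2"
      using m0 by (simp add: heat_kernel_def power_mult_distrib mult_ac flip: scaleR_diff_right)
    then show "mu\<^sup>2 * (heat_kernel (mu\<^sup>2 * s) (mu *\<^sub>R x - (0 + mu *\<^sub>R z)) * f (0 + mu *\<^sub>R z)) = heat_kernel s (x - z) * f z / mu"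
      using m0 by (simp add: scale_f[OF mu])
  qed
  finally show ?thesis by (simp add: heat_def)
qed

end

interpretation inv_norm: dss 2 "\<lambda>x::real^2. inverse (norm x)"
  by unfold_locales auto

section \<open>Decay of the solution\<close>

lemma inv_norm_radial_square: "inv_norm.radial_square x = ennreal (inverse (norm x))"
  by (cases "x = 0") (simp_all add: inv_norm.radial_square_def power2_eq_square)

lemma inv_norm_annulus_energy_finite: "inv_norm.annulus_energy < \<infinity>"
proof -
  have "inv_norm.annulus_energy \<le> (\<integral>\<^sup>+x. indicator (cball 0 2 :: (real^2) set) x \<partial>lborel)"
    unfolding inv_norm.annulus_energy_def
  proof (rule nn_integral_mono)
    fix x :: "real^2"
    have "inverse (norm x) \<le> 1" if "1 \<le> norm x" using that by (simp add: inverse_le_1_iff)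
    then have "(inverse (norm x))\<^sup>2 \<le> 1" if "1 \<le> norm x" using that by (simp add: power_le_one)
    then show "ennreal ((inverse (norm x))\<^sup>2) * indicator (annulus 2) x \<le> indicator (cball 0 2) x"
      by (auto simp: indicator_def annulus_def intro!: ennreal_le_1[THEN iffD2])
  qed
  also have "\<dots> < \<infinity>"
    using emeasure_compact_finite[of "cball 0 2 :: (real^2) set"] by simp
  finally show ?thesis .
qed

text \<open>
  The function \<open>1/|x|\<close> is itself discretely self-similar for the ratio 2, so the estimates for general
  data also give its local integrability.
\<close>

lemma inv_norm_weight_finite:
  assumes "r > 0"
  shows "(\<integral>\<^sup>+x. ennreal (inverse (norm (x::real^2))) * ennreal (gauss_weight r x) \<partial>lborel) < \<infinity>"
  using order.strict_trans1[OF inv_norm.nn_integral_radial_square_weight[OF assms]] inv_norm_annulus_energy_finite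
  by (simp add: inv_norm_radial_square ennreal_mult_less_top)

definition inv_norm_mass :: ennreal where
  "inv_norm_mass = (\<integral>\<^sup>+x. ennreal (inverse (norm x)) * indicator (ball (0::real^2) 1) x \<partial>lborel)"

lemma inv_norm_mass_finite: "inv_norm_mass < \<infinity>"
proof -
  have "inv_norm_mass \<le> (\<integral>\<^sup>+x. ennreal (exp (1/4)) * (ennreal (inverse (norm (x::real^2))) * ennreal (gauss_weight 1 x)) \<partial>lborel)"
    unfolding inv_norm_mass_def
  proof (rule nn_integral_mono)
    fix x :: "real^2"
    have "1 \<le> exp (1/4) * gauss_weight 1 x" if "norm x < 1"
    proof -
      have "(norm x)\<^sup>2 \<le> 1" using that by (simp add: power_le_one)
      then show ?thesis unfolding gauss_weight_def by (simp flip: exp_add)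
    qed
    then have "inverse (norm x) * 1 \<le> inverse (norm x) * (exp (1/4) * gauss_weight 1 x)" if "norm x < 1"
      using that by (intro mult_left_mono) auto
    then show "ennreal (inverse (norm x)) * indicator (ball 0 1) x \<le> ennreal (exp (1/4)) * (ennreal (inverse (norm x)) * ennreal (gauss_weight 1 x))"
      by (auto simp: indicator_def gauss_weight_nonneg mult_ac simp flip: ennreal_mult intro!: ennreal_leI)
  qed
  also have "\<dots> < \<infinity>"
    by (subst nn_integral_cmult) (auto simp: ennreal_mult_less_top inv_norm_weight_finite[unfolded infinity_ennreal_def])
  finally show ?thesis .
qed

definition decay_const :: "real \<Rightarrow> ennreal" where
  "decay_const s = 5 + ennreal (1 / (2 * pi * s)) * inv_norm_mass"

lemma decay_const_finite: "decay_const s < \<infinity>"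
  using inv_norm_mass_finite by (simp add: decay_const_def ennreal_mult_less_top)

lemma decay_const_antimono: "0 < s \<Longrightarrow> s \<le> s' \<Longrightarrow> decay_const s' \<le> decay_const s"
  unfolding decay_const_def
  by (intro add_left_mono mult_right_mono ennreal_leI divide_left_mono) (auto simp: pi_gt_zero)

lemma norm_mult_heat_kernel_le:
  assumes s: "0 < s" "s \<le> 1"
  shows "(1 + norm y) * heat_kernel s y \<le> 4 * heat_kernel (2 * s) y"
proof -
  define a where "a = (norm y)\<^sup>2 / (8 * s)"
  have "norm y \<le> 1 + (norm y)\<^sup>2 / 4"
    using zero_le_power2[of "norm y / 2 - 1"] by (simp add: power2_eq_square algebra_simps)
  then have "1 + norm y \<le> 2 * (1 + (norm y)\<^sup>2 / 8)" by simp
  also have "(norm y)\<^sup>2 / 8 \<le> a"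
    unfolding a_def using s by (intro divide_left_mono) auto
  also have "1 + a \<le> exp a" by (rule exp_ge_add_one_self)
  finally have "(1 + norm y) * exp (- (2 * a)) \<le> 2 * exp a * exp (- (2 * a))"
    by (intro mult_right_mono) auto
  also have "\<dots> = 2 * exp (- a)" by (simp flip: exp_add)
  finally have "(1 + norm y) * exp (- (2 * a)) / (4 * pi * s) \<le> 2 * exp (- a) / (4 * pi * s)"
    using s by (intro divide_right_mono) auto
  moreover have "- (norm y)\<^sup>2 / (4 * s) = - (2 * a)" "- (norm y)\<^sup>2 / (4 * (2 * s)) = - a"
    using s by (simp_all add: a_def)
  ultimately show ?thesis
    unfolding heat_kernel_def by (simp only:) (simp add: field_simps)
qed

text \<open>
  The heat flow of \<open>1/|z|\<close> is bounded and decays like \<open>1/|x|\<close> for times up to 1, with a constant that depends on the time: since \<open>1 + |x| \<le> |z| + (1 + |x - z|)\<close>, the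
  factor \<open>1 + |x|\<close> either cancels the singularity or is absorbed by widening the heat kernel.
\<close>

lemma heat_nn_inv_norm_le:
  assumes s: "0 < s" "s \<le> 1"
  shows "ennreal (1 + norm x) * heat_nn s (\<lambda>z. ennreal (inverse (norm z))) x \<le> decay_const s"
proof -
  have pw: "(1 + norm x) * (heat_kernel s (x - z) * inverse (norm z))
     \<le> heat_kernel s (x - z) + 4 * heat_kernel (2 * s) (x - z) + 1 / (2 * pi * s) * (inverse (norm z) * indicator (ball 0 1) z)" for z :: "real^2"
  proof -
    have kpos: "heat_kernel s (x - z) \<ge> 0" "heat_kernel (2 * s) (x - z) \<ge> 0" using s by (auto simp: heat_kernel_nonneg)
    have "norm x \<le> norm (x - z) + norm z" using norm_triangle_sub[of x z] by simp
    then have "(1 + norm x) * (heat_kernel s (x - z) * inverse (norm z))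
      \<le> (norm z + (1 + norm (x - z))) * (heat_kernel s (x - z) * inverse (norm z))"
      using kpos by (intro mult_right_mono) auto
    also have "\<dots> = (norm z * inverse (norm z)) * heat_kernel s (x - z) + ((1 + norm (x - z)) * heat_kernel s (x - z)) * inverse (norm z)"
      by (simp add: algebra_simps)
    also have "\<dots> \<le> 1 * heat_kernel s (x - z) + (4 * heat_kernel (2 * s) (x - z)) * inverse (norm z)"
      using kpos by (intro add_mono mult_right_mono norm_mult_heat_kernel_le s) (auto simp: divide_simps)
    also have "(4 * heat_kernel (2 * s) (x - z)) * inverse (norm z) \<le> 4 * heat_kernel (2 * s) (x - z) + 1 / (2 * pi * s) * (inverse (norm z) * indicator (ball 0 1) z)"
    proof (cases "norm z < 1")
      case True
      have "4 * heat_kernel (2 * s) (x - z) \<le> 1 / (2 * pi * s)"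
        using s by (simp add: heat_kernel_def field_simps)
      then have "(4 * heat_kernel (2 * s) (x - z)) * inverse (norm z) \<le> 1 / (2 * pi * s) * inverse (norm z)"
        by (intro mult_right_mono) auto
      then show ?thesis using True kpos by simp
    next
      case False
      then have "inverse (norm z) \<le> 1" by (simp add: inverse_le_1_iff)
      then have "(4 * heat_kernel (2 * s) (x - z)) * inverse (norm z) \<le> (4 * heat_kernel (2 * s) (x - z)) * 1"
        using kpos by (intro mult_left_mono) auto
      then show ?thesis using False by simp
    qed
    finally show ?thesis by simp
  qed
  have "ennreal (1 + norm x) * heat_nn s (\<lambda>z. ennreal (inverse (norm z))) x
     = (\<integral>\<^sup>+z. ennreal (1 + norm x) * (ennreal (heat_kernel s (x - z)) * ennreal (inverse (norm z))) \<partial>lborel)"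
    unfolding heat_nn_def by (rule nn_integral_cmult[symmetric]) measurable
  also have "\<dots> \<le> (\<integral>\<^sup>+z. (ennreal (heat_kernel s (x - z)) + ennreal 4 * ennreal (heat_kernel (2 * s) (x - z)))
       + ennreal (1 / (2 * pi * s)) * (ennreal (inverse (norm z)) * indicator (ball 0 1) z) \<partial>lborel)"
  proof (rule nn_integral_mono)
    fix z :: "real^2"
    have i: "(indicator (ball 0 1) z :: ennreal) = ennreal (indicator (ball 0 1) z)" by (simp add: indicator_def)
    show "ennreal (1 + norm x) * (ennreal (heat_kernel s (x - z)) * ennreal (inverse (norm z)))
      \<le> (ennreal (heat_kernel s (x - z)) + ennreal 4 * ennreal (heat_kernel (2 * s) (x - z)))
       + ennreal (1 / (2 * pi * s)) * (ennreal (inverse (norm z)) * indicator (ball 0 1) z)"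
      unfolding i using pw[of z] s
      by (simp add: heat_kernel_nonneg del: ennreal_numeral ennreal_indicator flip: ennreal_mult ennreal_plus)
  qed
  also have "\<dots> = (1 + 4) + ennreal (1 / (2 * pi * s)) * inv_norm_mass"
  proof -
    have [measurable]: "ball (0::real^2) 1 \<in> sets borel" by simp
    show ?thesis
      using s unfolding inv_norm_mass_def
      by (subst nn_integral_add, measurable, subst nn_integral_add, measurable)
         (simp add: nn_integral_cmult nn_integral_heat_kernel)
  qed
  finally show ?thesis by (simp add: decay_const_def)
qed

locale dss_L2 = dss +
  assumes annulus_energy_finite: "annulus_energy < \<infinity>"
begin

definition annuli_const :: real where "annuli_const = 2 * lam / (lam - 1)"

lemma annuli_const_pos: "annuli_const > 0" using lam by (simp add: annuli_const_def)

lemma radial_square_weight_finite: "r > 0 \<Longrightarrow> (\<integral>\<^sup>+x. radial_square x * ennreal (gauss_weight r x) \<partial>lborel) < \<infinity>"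
  using order.strict_trans1[OF nn_integral_radial_square_weight] annulus_energy_finite by (simp add: ennreal_mult_less_top)

lemma f_gauss_integrable: "gauss_integrable f"
proof -
  have "(\<integral>\<^sup>+z. ennreal \<bar>f z\<bar> * ennreal (gauss_weight r z) \<partial>lborel) < \<infinity>" if r: "r > 0" for r
  proof -
    have "\<bar>f z\<bar> \<le> inverse (norm z) + norm z * (f z)\<^sup>2" for z
    proof (cases "z = 0")
      case False
      define n where "n = norm z"
      have n: "n > 0" using False by (simp add: n_def)
      have "0 \<le> (1 - n * \<bar>f z\<bar>)\<^sup>2" by simp
      then have "2 * (n * \<bar>f z\<bar>) \<le> 1 + n\<^sup>2 * (f z)\<^sup>2"
        by (simp add: power2_diff power_mult_distrib)
      moreover have "0 \<le> n * \<bar>f z\<bar>" using n by simp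
      ultimately have "n * \<bar>f z\<bar> \<le> 1 + n\<^sup>2 * (f z)\<^sup>2" by linarith
      then show ?thesis using n by (simp add: n_def[symmetric] field_simps power2_eq_square)
    qed (simp add: f_zero)
    then have "(\<integral>\<^sup>+z. ennreal \<bar>f z\<bar> * ennreal (gauss_weight r z) \<partial>lborel)
      \<le> (\<integral>\<^sup>+z. ennreal (inverse (norm z)) * ennreal (gauss_weight r z) + radial_square z * ennreal (gauss_weight r z) \<partial>lborel)"
      unfolding radial_square_def
      by (intro nn_integral_mono) (auto simp: distrib_right[symmetric] simp flip: ennreal_plus intro!: mult_right_mono ennreal_leI)
    also have "\<dots> < \<infinity>"
      using inv_norm_weight_finite[OF r] radial_square_weight_finite[OF r] by (subst nn_integral_add) auto
    finally show ?thesis .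
  qed
  then show ?thesis by (simp add: gauss_integrable_def)
qed

text \<open>
  In general \<open>f\<close> is not square integrable near the origin, so \<open>u\<^sup>2 \<le> P\<^sub>s (f\<^sup>2)\<close> has no content. Cauchy-Schwarz with
  \<open>|f| = sqrt (1 / |z|) * sqrt (|z| f\<^sup>2)\<close> moves one power of \<open>|z|\<close> to \<open>f\<^sup>2\<close>, which makes it locally integrable.
\<close>

lemma heat_square_le:
  assumes s: "0 < s" "s \<le> 1"
  shows "ennreal (1 + norm x) * ennreal ((heat s f x)\<^sup>2) \<le> decay_const s * heat_nn s radial_square x"
proof -
  define a where "a = (\<lambda>z. ennreal (sqrt (heat_kernel s (x - z) * inverse (norm z))))"
  define b where "b = (\<lambda>z. ennreal (sqrt (heat_kernel s (x - z) * (norm z * (f z)\<^sup>2))))"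
  have [measurable]: "a \<in> borel_measurable borel" "b \<in> borel_measurable borel"
    unfolding a_def b_def by measurable
  have "ennreal \<bar>heat s f x\<bar> \<le> heat_nn s (\<lambda>z. ennreal \<bar>f z\<bar>) x"
    by (rule heat_abs_le[OF f_gauss_integrable s(1)])
  also have "\<dots> = (\<integral>\<^sup>+z. a z * b z \<partial>lborel)"
    unfolding heat_nn_def
  proof (rule nn_integral_cong)
    fix z
    have "sqrt (heat_kernel s (x - z) * inverse (norm z)) * sqrt (heat_kernel s (x - z) * (norm z * (f z)\<^sup>2)) = heat_kernel s (x - z) * \<bar>f z\<bar>"
    proof (cases "z = 0")
      case False
      have "sqrt (heat_kernel s (x - z) * inverse (norm z)) * sqrt (heat_kernel s (x - z) * (norm z * (f z)\<^sup>2))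
        = sqrt ((heat_kernel s (x - z) * \<bar>f z\<bar>)\<^sup>2)"
        using False by (simp only: real_sqrt_mult[symmetric]) (simp add: power2_eq_square field_simps)
      then show ?thesis using s by (simp add: heat_kernel_nonneg abs_mult)
    qed (simp add: f_zero)
    then show "ennreal (heat_kernel s (x - z)) * ennreal \<bar>f z\<bar> = a z * b z"
      using s by (simp add: a_def b_def heat_kernel_nonneg flip: ennreal_mult)
  qed
  finally have "(ennreal \<bar>heat s f x\<bar>)\<^sup>2 \<le> (\<integral>\<^sup>+z. a z * b z \<partial>lborel)\<^sup>2"
    by (rule power_mono) simp
  also have "\<dots> \<le> (\<integral>\<^sup>+z. (a z)\<^sup>2 \<partial>lborel) * (\<integral>\<^sup>+z. (b z)\<^sup>2 \<partial>lborel)"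
    by (rule Cauchy_Schwarz_nn_integral) auto
  also have "(\<integral>\<^sup>+z. (a z)\<^sup>2 \<partial>lborel) = heat_nn s (\<lambda>z. ennreal (inverse (norm z))) x"
    unfolding a_def heat_nn_def using s by (simp add: ennreal_power heat_kernel_nonneg ennreal_mult)
  also have "(\<integral>\<^sup>+z. (b z)\<^sup>2 \<partial>lborel) = heat_nn s radial_square x"
    unfolding b_def heat_nn_def radial_square_def using s by (simp add: ennreal_power heat_kernel_nonneg ennreal_mult)
  finally have "ennreal ((heat s f x)\<^sup>2) \<le> heat_nn s (\<lambda>z. ennreal (inverse (norm z))) x * heat_nn s radial_square x"
    by (simp add: ennreal_power)
  then have "ennreal (1 + norm x) * ennreal ((heat s f x)\<^sup>2)
     \<le> ennreal (1 + norm x) * (heat_nn s (\<lambda>z. ennreal (inverse (norm z))) x * heat_nn s radial_square x)"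
    by (rule mult_left_mono) simp
  also have "\<dots> \<le> decay_const s * heat_nn s radial_square x"
    unfolding mult.assoc[symmetric] by (intro mult_right_mono heat_nn_inv_norm_le s) simp
  finally show ?thesis .
qed

lemma weighted_heat_square_le:
  assumes s: "0 < s" "s \<le> 1" and r: "r > 0"
  shows "(\<integral>\<^sup>+x. ennreal ((1 + norm x) * gauss_weight r x) * ennreal ((heat s f x)\<^sup>2) \<partial>lborel)
    \<le> decay_const s * (\<integral>\<^sup>+x. radial_square x * ennreal (gauss_weight (r + s) x) \<partial>lborel)"
proof -
  have "(\<integral>\<^sup>+x. ennreal ((1 + norm x) * gauss_weight r x) * ennreal ((heat s f x)\<^sup>2) \<partial>lborel)
    \<le> (\<integral>\<^sup>+x. decay_const s * (ennreal (gauss_weight r x) * heat_nn s radial_square x) \<partial>lborel)"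
  proof (rule nn_integral_mono)
    fix x
    have "ennreal (gauss_weight r x) * (ennreal (1 + norm x) * ennreal ((heat s f x)\<^sup>2))
       \<le> ennreal (gauss_weight r x) * (decay_const s * heat_nn s radial_square x)"
      by (intro mult_left_mono heat_square_le s) simp
    then show "ennreal ((1 + norm x) * gauss_weight r x) * ennreal ((heat s f x)\<^sup>2) \<le> decay_const s * (ennreal (gauss_weight r x) * heat_nn s radial_square x)"
      by (subst ennreal_mult) (auto simp: gauss_weight_nonneg mult_ac)
  qed
  also have "\<dots> = decay_const s * (\<integral>\<^sup>+x. ennreal (gauss_weight r x) * heat_nn s radial_square x \<partial>lborel)"
    by (rule nn_integral_cmult) measurable
  also have "(\<integral>\<^sup>+x. ennreal (gauss_weight r x) * heat_nn s radial_square x \<partial>lborel)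
     = (\<integral>\<^sup>+x. radial_square x * heat_nn s (\<lambda>z. ennreal (gauss_weight r z)) x \<partial>lborel)"
    by (rule heat_nn_symmetric) measurable
  also have "decay_const s * \<dots> \<le> decay_const s * (\<integral>\<^sup>+x. radial_square x * ennreal (gauss_weight (r + s) x) \<partial>lborel)"
    by (intro mult_left_mono nn_integral_mono heat_nn_gauss_weight_le s r) auto
  finally show ?thesis .
qed

definition weighted_energy :: "real \<Rightarrow> real \<Rightarrow> ennreal" where
  "weighted_energy r s = (\<integral>\<^sup>+x. ennreal (gauss_weight r x) * ennreal ((heat s f x)\<^sup>2) \<partial>lborel)"

lemma weighted_energy_le:
  assumes s: "0 < s" "s \<le> 1" and r: "r > 0"
  shows "weighted_energy r s \<le> decay_const s * (\<integral>\<^sup>+x. radial_square x * ennreal (gauss_weight (r + s) x) \<partial>lborel)"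
proof -
  have "weighted_energy r s \<le> (\<integral>\<^sup>+x. ennreal ((1 + norm x) * gauss_weight r x) * ennreal ((heat s f x)\<^sup>2) \<partial>lborel)"
    unfolding weighted_energy_def
    by (intro nn_integral_mono mult_right_mono ennreal_leI) (simp_all add: distrib_right gauss_weight_nonneg)
  also note weighted_heat_square_le[OF s r]
  finally show ?thesis .
qed

lemma weighted_energy_finite:
  assumes s: "0 < s" "s \<le> 1" and r: "r > 0"
  shows "weighted_energy r s < \<infinity>"
  using order.strict_trans1[OF weighted_energy_le[OF assms]] decay_const_finite radial_square_weight_finite[of "r + s"] s r
  by (simp add: ennreal_mult_less_top)

lemma weighted_energy_mono: "0 < r \<Longrightarrow> r \<le> r' \<Longrightarrow> weighted_energy r s \<le> weighted_energy r' s"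
  unfolding weighted_energy_def by (intro nn_integral_mono mult_right_mono ennreal_leI gauss_weight_mono) auto

text \<open>
  Self-similarity of the solution at the level of localised energies: a later time is traded for a
  narrower weight.
\<close>

lemma weighted_energy_scale:
  assumes mu: "scaling_factor mu"
  shows "weighted_energy (mu\<^sup>2 * r) (mu\<^sup>2 * s) = weighted_energy r s"
proof -
  note m0 = scale_pos[OF mu]
  have "weighted_energy (mu\<^sup>2 * r) (mu\<^sup>2 * s) = ennreal (mu\<^sup>2) * (\<integral>\<^sup>+x. ennreal (gauss_weight (mu\<^sup>2 * r) (0 + mu *\<^sub>R x)) * ennreal ((heat (mu\<^sup>2 * s) f (0 + mu *\<^sub>R x))\<^sup>2) \<partial>lborel)"
    unfolding weighted_energy_def using m0
    by (intro nn_integral_affine[where h = "\<lambda>x. ennreal (gauss_weight (mu\<^sup>2 * r) x) * ennreal ((heat (mu\<^sup>2 * s) f x)\<^sup>2)"]) auto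
  also have "\<dots> = (\<integral>\<^sup>+x. ennreal (mu\<^sup>2) * (ennreal (gauss_weight (mu\<^sup>2 * r) (0 + mu *\<^sub>R x)) * ennreal ((heat (mu\<^sup>2 * s) f (0 + mu *\<^sub>R x))\<^sup>2)) \<partial>lborel)"
    by (rule nn_integral_cmult[symmetric]) measurable
  also have "\<dots> = weighted_energy r s"
    unfolding weighted_energy_def
  proof (rule nn_integral_cong)
    fix x
    have 1: "gauss_weight (mu\<^sup>2 * r) (0 + mu *\<^sub>R x) = gauss_weight r x"
      using m0 by (simp add: gauss_weight_def power_mult_distrib)
    have 2: "(heat (mu\<^sup>2 * s) f (0 + mu *\<^sub>R x))\<^sup>2 = (heat s f x)\<^sup>2 / mu\<^sup>2"
      using heat_scale[OF mu, of s x] by (simp add: power_divide)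
    show "ennreal (mu\<^sup>2) * (ennreal (gauss_weight (mu\<^sup>2 * r) (0 + mu *\<^sub>R x)) * ennreal ((heat (mu\<^sup>2 * s) f (0 + mu *\<^sub>R x))\<^sup>2))
      = ennreal (gauss_weight r x) * ennreal ((heat s f x)\<^sup>2)"
      unfolding 1 2 using m0 by (simp add: gauss_weight_nonneg flip: ennreal_mult)
  qed
  finally show ?thesis .
qed

lemma heat_gauss_integrable: "s > 0 \<Longrightarrow> gauss_integrable (heat s f)"
  by (rule gauss_integrable_heat[OF f_gauss_integrable])

lemma heat_square_gauss_integrable:
  assumes s: "0 < s" "s \<le> 1"
  shows "gauss_integrable (\<lambda>y. (heat s f y)\<^sup>2)"
proof -
  have "(\<lambda>y. (heat s f y)\<^sup>2) \<in> borel_measurable borel" by measurable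
  then show ?thesis
    using weighted_energy_finite[OF s] unfolding gauss_integrable_def weighted_energy_def by (simp add: mult.commute)
qed

end

section \<open>The energy identity and the upper bound\<close>

lemma gauss_weight_tendsto_1:
  assumes "filterlim r at_top F"
  shows "((\<lambda>i. gauss_weight (r i) x) \<longlongrightarrow> 1) F"
proof -
  have "((\<lambda>i. - ((norm x)\<^sup>2 / 4) * inverse (r i)) \<longlongrightarrow> - ((norm x)\<^sup>2 / 4) * 0) F"
    by (intro tendsto_mult tendsto_const tendsto_inverse_0_at_top assms)
  then have "((\<lambda>i. exp (- ((norm x)\<^sup>2 / 4) * inverse (r i))) \<longlongrightarrow> exp 0) F"
    by (intro tendsto_exp) simp
  moreover have "(\<lambda>i. exp (- ((norm x)\<^sup>2 / 4) * inverse (r i))) = (\<lambda>i. gauss_weight (r i) x)"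
    by (simp add: gauss_weight_def fun_eq_iff field_simps)
  ultimately show ?thesis by simp
qed

text \<open>
  The weight \<open>exp (-A) - exp (-B)\<close> is at most \<open>exp (-A) B\<close>, hence of order \<open>|x|\<^sup>2 / mu\<^sup>2\<close> near the origin and Gaussian
  beyond \<open>|x| = mu\<close>. One factor \<open>|x| / mu\<close> is kept: it matches the decay of the solution, and the
  factor \<open>1 / mu\<close> later compensates the growth of the Gaussian integrals of \<open>|x| f\<^sup>2\<close>.
\<close>

lemma gauss_weight_diff_le:
  assumes mu: "mu > 0" and tau: "0 < tau" "tau \<le> mu\<^sup>2" and L: "L \<ge> 1"
  shows "gauss_weight (mu\<^sup>2 + tau) x \<le> gauss_weight (mu\<^sup>2 / L) x + L / mu * ((1 + norm x) * gauss_weight (4 * mu\<^sup>2) x)"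
proof -
  define b where "b = norm x / mu"
  define A where "A = (norm x)\<^sup>2 / (4 * (mu\<^sup>2 + tau))"
  define B where "B = L * b\<^sup>2 / 4"
  have b: "b \<ge> 0" using mu by (simp add: b_def)
  have A0: "A \<ge> 0" using tau by (simp add: A_def)
  have "b\<^sup>2 / 8 = (norm x)\<^sup>2 / (8 * mu\<^sup>2)" by (simp add: b_def power_divide)
  also have "\<dots> \<le> A" unfolding A_def using mu tau by (intro divide_left_mono) (auto intro!: mult_pos_pos add_pos_pos)
  finally have A: "b\<^sup>2 / 8 \<le> A" .
  have "1 - exp (A - B) \<le> B" using exp_ge_add_one_self[of "A - B"] A0 by linarith
  then have "exp (- A) * (1 - exp (A - B)) \<le> exp (- A) * B"
    by (intro mult_left_mono) auto
  then have "exp (- A) - exp (- B) \<le> exp (- A) * B"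
    by (simp add: right_diff_distrib flip: exp_add)
  also have "\<dots> \<le> exp (- (b\<^sup>2 / 8)) * B"
    using A L by (intro mult_right_mono) (auto simp: B_def)
  also have "\<dots> = L * b / 4 * (b * exp (- (b\<^sup>2 / 8)))" by (simp add: B_def power2_eq_square)
  also have "\<dots> \<le> L * b / 4 * (4 * exp (- (b\<^sup>2 / 16)))"
  proof (intro mult_left_mono)
    have "b \<le> 1 + b\<^sup>2 / 4"
      using zero_le_power2[of "b / 2 - 1"] by (simp add: power2_eq_square algebra_simps)
    also have "\<dots> \<le> 4 * (1 + b\<^sup>2 / 16)" by simp
    also have "\<dots> \<le> 4 * exp (b\<^sup>2 / 16)" by (intro mult_left_mono exp_ge_add_one_self) simp
    finally have "b * exp (- (b\<^sup>2 / 8)) \<le> 4 * exp (b\<^sup>2 / 16) * exp (- (b\<^sup>2 / 8))" by (intro mult_right_mono) auto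
    also have "\<dots> = 4 * exp (- (b\<^sup>2 / 16))" by (simp flip: exp_add)
    finally show "b * exp (- (b\<^sup>2 / 8)) \<le> 4 * exp (- (b\<^sup>2 / 16))" .
  qed (use L b in auto)
  also have "\<dots> = L / mu * (norm x * gauss_weight (4 * mu\<^sup>2) x)"
    by (simp add: b_def gauss_weight_def power_divide)
  also have "\<dots> \<le> L / mu * ((1 + norm x) * gauss_weight (4 * mu\<^sup>2) x)"
    using L mu by (intro mult_left_mono mult_right_mono) (auto simp: gauss_weight_nonneg)
  finally have "exp (- A) - exp (- B) \<le> L / mu * ((1 + norm x) * gauss_weight (4 * mu\<^sup>2) x)" .
  moreover have "gauss_weight (mu\<^sup>2 + tau) x = exp (- A)" by (simp add: gauss_weight_def A_def)
  moreover have "gauss_weight (mu\<^sup>2 / L) x = exp (- B)"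
    using L by (simp add: gauss_weight_def B_def b_def power_divide mult.commute)
  ultimately show ?thesis by linarith
qed

context dss_L2
begin

text \<open>
  Gaussian weights of growing width increase to 1. Widths that are powers of \<open>lam\<close> suffice, and for these the
  self-similarity of the data is available.
\<close>

lemma exhaust_by_weights:
  assumes [measurable]: "h \<in> borel_measurable borel"
    and le: "\<And>m. (\<integral>\<^sup>+x. ennreal (gauss_weight ((lam ^ Suc m)\<^sup>2) x) * h x \<partial>lborel) \<le> C"
  shows "(\<integral>\<^sup>+x. h x \<partial>lborel) \<le> C"
proof (rule LIMSEQ_le_const2)
  have up: "filterlim (\<lambda>m. (lam ^ Suc m)\<^sup>2) at_top sequentially"
  proof -
    have "filterlim (\<lambda>m. (lam\<^sup>2) ^ m) at_top sequentially"
    proof (rule filterlim_at_infinity_imp_filterlim_at_top)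
      show "filterlim (\<lambda>m. (lam\<^sup>2) ^ m) at_infinity sequentially"
        using lam by (intro filterlim_realpow_sequentially_gt1) (simp add: power2_eq_square less_1_mult)
    qed (use lam in auto)
    then have "filterlim (\<lambda>m. (lam\<^sup>2) ^ Suc m) at_top sequentially"
      by (rule filterlim_compose) (rule filterlim_Suc)
    then show ?thesis by (simp only: power_mult[symmetric] mult.commute)
  qed
  show "(\<lambda>m. (\<integral>\<^sup>+x. ennreal (gauss_weight ((lam ^ Suc m)\<^sup>2) x) * h x \<partial>lborel)) \<longlonglongrightarrow> (\<integral>\<^sup>+x. h x \<partial>lborel)"
  proof (rule nn_integral_LIMSEQ)
    show "incseq (\<lambda>m x. ennreal (gauss_weight ((lam ^ Suc m)\<^sup>2) x) * h x)"
      using lam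
      by (auto simp: incseq_def le_fun_def intro!: mult_right_mono ennreal_leI gauss_weight_mono power_mono mult_left_mono power_increasing)
    show "(\<lambda>m. ennreal (gauss_weight ((lam ^ Suc m)\<^sup>2) x) * h x) \<longlonglongrightarrow> h x" for x
    proof -
      have "(\<lambda>m. ennreal (gauss_weight ((lam ^ Suc m)\<^sup>2) x)) \<longlonglongrightarrow> ennreal 1"
        by (intro tendsto_ennrealI gauss_weight_tendsto_1 up)
      then have "(\<lambda>m. ennreal (gauss_weight ((lam ^ Suc m)\<^sup>2) x) * h x) \<longlonglongrightarrow> ennreal 1 * h x"
        by (intro tendsto_mult_ennreal tendsto_const) auto
      then show ?thesis by simp
    qed
  qed measurable
  show "\<exists>n0. \<forall>n\<ge>n0. (\<integral>\<^sup>+x. ennreal (gauss_weight ((lam ^ Suc n)\<^sup>2) x) * h x \<partial>lborel) \<le> C"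
    using le by blast
qed

text \<open>
  Integrate \<open>P\<^sub>\<tau> (u\<^sub>s\<^sup>2) = V + u\<^sup>2\<close>, where \<open>u\<close> on the right is taken at time \<open>s + \<tau>\<close>, against the weight, and move
  \<open>P\<^sub>\<tau>\<close> onto the weight.
\<close>

lemma energy_identity:
  assumes s: "0 < s" "s \<le> 1" and tau: "tau > 0" and r: "r > 0"
  shows "(\<integral>\<^sup>+x. ennreal (gauss_weight r x) * ennreal (heat_var tau (heat s f) x) \<partial>lborel) + weighted_energy r (s + tau)
    = ennreal (r / (r + tau)) * weighted_energy (r + tau) s"
proof -
  note u = heat_gauss_integrable[OF s(1)] and u2 = heat_square_gauss_integrable[OF s]
  have [measurable]: "heat_var tau (heat s f) \<in> borel_measurable borel"
    by (rule heat_var_measurable[OF u u2 tau])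
  have "(\<integral>\<^sup>+x. ennreal (gauss_weight r x) * ennreal (heat_var tau (heat s f) x) \<partial>lborel) + weighted_energy r (s + tau)
    = (\<integral>\<^sup>+x. ennreal (gauss_weight r x) * heat_nn tau (\<lambda>z. ennreal ((heat s f z)\<^sup>2)) x \<partial>lborel)"
    unfolding weighted_energy_def
  proof (subst nn_integral_add[symmetric], measurable, rule nn_integral_cong)
    fix x
    have "heat_nn tau (\<lambda>z. ennreal ((heat s f z)\<^sup>2)) x = ennreal (heat tau (\<lambda>z. (heat s f z)\<^sup>2) x)"
      by (rule heat_nonneg_eq[OF u2 tau, symmetric]) simp
    also have "\<dots> = ennreal (heat_var tau (heat s f) x) + ennreal ((heat (s + tau) f x)\<^sup>2)"
      unfolding heat_square[OF u u2 tau] heat_semigroup[OF f_gauss_integrable s(1) tau]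
      using heat_var_nonneg[OF tau] by simp
    finally show "ennreal (gauss_weight r x) * ennreal (heat_var tau (heat s f) x) + ennreal (gauss_weight r x) * ennreal ((heat (s + tau) f x)\<^sup>2)
       = ennreal (gauss_weight r x) * heat_nn tau (\<lambda>z. ennreal ((heat s f z)\<^sup>2)) x"
      by (simp only: distrib_left)
  qed
  also have "\<dots> = (\<integral>\<^sup>+x. ennreal ((heat s f x)\<^sup>2) * heat_nn tau (\<lambda>z. ennreal (gauss_weight r z)) x \<partial>lborel)"
    by (rule heat_nn_symmetric) measurable
  also have "\<dots> = (\<integral>\<^sup>+x. ennreal (r / (r + tau)) * (ennreal (gauss_weight (r + tau) x) * ennreal ((heat s f x)\<^sup>2)) \<partial>lborel)"
    unfolding heat_nn_gauss_weight[OF tau r] using tau r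
    by (intro nn_integral_cong, subst ennreal_mult) (simp_all add: gauss_weight_nonneg mult_ac)
  also have "\<dots> = ennreal (r / (r + tau)) * weighted_energy (r + tau) s"
    unfolding weighted_energy_def by (rule nn_integral_cmult) measurable
  finally show ?thesis .
qed

text \<open>
  The total variance, which stands for the energy lost between the times \<open>s\<close> and \<open>lam\<^sup>2 * s\<close>. Both energies may be
  infinite, so it is not defined as their difference.
\<close>

definition energy_drop :: "real \<Rightarrow> ennreal" where
  "energy_drop s = (\<integral>\<^sup>+x. ennreal (heat_var ((lam\<^sup>2 - 1) * s) (heat s f) x) \<partial>lborel)"

lemma lam_square: "lam\<^sup>2 > 1" using lam by (simp add: power2_eq_square less_1_mult)

lemma energy_identity_self_similar:
  assumes s: "0 < s" "s \<le> 1" and r: "r > 0"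
  shows "(\<integral>\<^sup>+x. ennreal (gauss_weight r x) * ennreal (heat_var ((lam\<^sup>2 - 1) * s) (heat s f) x) \<partial>lborel) + weighted_energy (r / lam\<^sup>2) s
    = ennreal (r / (r + (lam\<^sup>2 - 1) * s)) * weighted_energy (r + (lam\<^sup>2 - 1) * s) s"
proof -
  have "weighted_energy r (s + (lam\<^sup>2 - 1) * s) = weighted_energy (lam\<^sup>2 * (r / lam\<^sup>2)) (lam\<^sup>2 * s)"
    using lam_pos by (simp add: algebra_simps)
  also have "\<dots> = weighted_energy (r / lam\<^sup>2) s" by (rule weighted_energy_scale[OF scale_lam])
  finally have n: "weighted_energy r (s + (lam\<^sup>2 - 1) * s) = weighted_energy (r / lam\<^sup>2) s" .
  show ?thesis
    using energy_identity[OF s _ r, of "(lam\<^sup>2 - 1) * s"] lam_square s by (simp add: n)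
qed

text \<open>
  Cancelling the common finite term in the energy balance leaves the energy against the difference of two
  weights of widths comparable to \<open>mu\<close>. The bound is uniform in \<open>mu\<close>, because the integral of \<open>|x| f\<^sup>2\<close>
  against a weight of width \<open>mu\<close> scales exactly like \<open>mu\<close>.
\<close>

lemma energy_drop_le:
  assumes s: "0 < s" "s \<le> 1"
  shows "energy_drop s \<le> decay_const s * (ennreal (20 * lam\<^sup>2 * annuli_const) * annulus_energy)"
  unfolding energy_drop_def
proof (rule exhaust_by_weights)
  define tau where "tau = (lam\<^sup>2 - 1) * s"
  have tau: "0 < tau" using lam_square s by (simp add: tau_def)
  show "(\<lambda>x. ennreal (heat_var ((lam\<^sup>2 - 1) * s) (heat s f) x)) \<in> borel_measurable borel"
    using heat_var_measurable[OF heat_gauss_integrable[OF s(1)] heat_square_gauss_integrable[OF s] tau]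
    by (simp add: tau_def)
  fix m
  define mu where "mu = lam ^ Suc m"
  have mu: "scaling_factor mu" unfolding mu_def by (rule scale_power)
  note m0 = scale_pos[OF mu]
  have "lam * 1 \<le> lam * lam ^ m" using lam by (intro mult_left_mono) auto
  then have "lam \<le> mu" by (simp add: mu_def)
  then have lm: "lam\<^sup>2 \<le> mu\<^sup>2" using lam by (intro power_mono) auto
  have "tau \<le> (lam\<^sup>2 - 1) * 1" unfolding tau_def using lam_square s by (intro mult_left_mono) auto
  then have "tau \<le> lam\<^sup>2 - 1" by simp
  then have tm: "tau \<le> mu\<^sup>2" using lm by linarith
  define n where "n = weighted_energy (mu\<^sup>2 / lam\<^sup>2) s"
  have nfin: "n < \<infinity>" unfolding n_def using m0 lam by (intro weighted_energy_finite s) auto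
  define J where "J = (\<integral>\<^sup>+x. ennreal (gauss_weight (mu\<^sup>2) x) * ennreal (heat_var tau (heat s f) x) \<partial>lborel)"
  define D where "D = (\<integral>\<^sup>+x. ennreal ((1 + norm x) * gauss_weight (4 * mu\<^sup>2) x) * ennreal ((heat s f x)\<^sup>2) \<partial>lborel)"
  have "n + J = ennreal (mu\<^sup>2 / (mu\<^sup>2 + tau)) * weighted_energy (mu\<^sup>2 + tau) s"
    using energy_identity_self_similar[OF s, of "mu\<^sup>2"] m0 by (simp add: n_def J_def tau_def add.commute)
  also have "\<dots> \<le> 1 * weighted_energy (mu\<^sup>2 + tau) s"
    using m0 tau by (intro mult_right_mono ennreal_le_1[THEN iffD2]) (auto simp: divide_le_eq_1_pos add_pos_pos)
  also have "\<dots> \<le> n + ennreal (lam\<^sup>2 / mu) * D"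
  proof -
    have "weighted_energy (mu\<^sup>2 + tau) s \<le> (\<integral>\<^sup>+x. ennreal (gauss_weight (mu\<^sup>2 / lam\<^sup>2) x) * ennreal ((heat s f x)\<^sup>2)
       + ennreal (lam\<^sup>2 / mu) * (ennreal ((1 + norm x) * gauss_weight (4 * mu\<^sup>2) x) * ennreal ((heat s f x)\<^sup>2)) \<partial>lborel)"
      unfolding weighted_energy_def
    proof (rule nn_integral_mono)
      fix x
      have "gauss_weight (mu\<^sup>2 + tau) x * (heat s f x)\<^sup>2
        \<le> (gauss_weight (mu\<^sup>2 / lam\<^sup>2) x + lam\<^sup>2 / mu * ((1 + norm x) * gauss_weight (4 * mu\<^sup>2) x)) * (heat s f x)\<^sup>2"
        using lam_square by (intro mult_right_mono gauss_weight_diff_le m0 tau tm) auto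
      also have "\<dots> = gauss_weight (mu\<^sup>2 / lam\<^sup>2) x * (heat s f x)\<^sup>2 + lam\<^sup>2 / mu * ((1 + norm x) * gauss_weight (4 * mu\<^sup>2) x * (heat s f x)\<^sup>2)"
        by (simp add: algebra_simps)
      finally show "ennreal (gauss_weight (mu\<^sup>2 + tau) x) * ennreal ((heat s f x)\<^sup>2)
         \<le> ennreal (gauss_weight (mu\<^sup>2 / lam\<^sup>2) x) * ennreal ((heat s f x)\<^sup>2)
       + ennreal (lam\<^sup>2 / mu) * (ennreal ((1 + norm x) * gauss_weight (4 * mu\<^sup>2) x) * ennreal ((heat s f x)\<^sup>2))"
        using m0 by (simp add: gauss_weight_nonneg flip: ennreal_mult ennreal_plus)
    qed
    also have "\<dots> = n + ennreal (lam\<^sup>2 / mu) * D"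
      unfolding n_def weighted_energy_def D_def by (subst nn_integral_add) (auto simp: nn_integral_cmult)
    finally show ?thesis by simp
  qed
  finally have "J \<le> ennreal (lam\<^sup>2 / mu) * D"
    using nfin by (auto simp: ennreal_add_left_cancel_le)
  also have "D \<le> decay_const s * (\<integral>\<^sup>+x. radial_square x * ennreal (gauss_weight (4 * mu\<^sup>2 + s) x) \<partial>lborel)"
    unfolding D_def using m0 by (intro weighted_heat_square_le s) auto
  also have "(\<integral>\<^sup>+x. radial_square x * ennreal (gauss_weight (4 * mu\<^sup>2 + s) x) \<partial>lborel) \<le> (\<integral>\<^sup>+x. radial_square x * ennreal (gauss_weight (mu\<^sup>2 * 5) x) \<partial>lborel)"
    using m0 s lm lam_square by (intro nn_integral_mono mult_left_mono ennreal_leI gauss_weight_mono) auto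
  also have "\<dots> = ennreal mu * (\<integral>\<^sup>+x. radial_square x * ennreal (gauss_weight 5 x) \<partial>lborel)"
    by (rule nn_integral_radial_square_weight_scale[OF mu])
  also have "(\<integral>\<^sup>+x. radial_square x * ennreal (gauss_weight 5 x) \<partial>lborel) \<le> ennreal (20 * annuli_const) * annulus_energy"
    using nn_integral_radial_square_weight[of 5] by (simp add: annuli_const_def)
  also have "ennreal (lam\<^sup>2 / mu) * (decay_const s * (ennreal mu * (ennreal (20 * annuli_const) * annulus_energy)))
      = decay_const s * (ennreal (lam\<^sup>2 / mu) * ennreal mu * ennreal (20 * annuli_const) * annulus_energy)"
    by (simp add: mult_ac)
  also have "ennreal (lam\<^sup>2 / mu) * ennreal mu * ennreal (20 * annuli_const) = ennreal (20 * lam\<^sup>2 * annuli_const)"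
    using m0 annuli_const_pos by (simp add: mult_ac flip: ennreal_mult)
  finally have "J \<le> decay_const s * (ennreal (20 * lam\<^sup>2 * annuli_const) * annulus_energy)"
    by (simp add: mult_left_mono)
  then show "(\<integral>\<^sup>+x. ennreal (gauss_weight ((lam ^ Suc m)\<^sup>2) x) * ennreal (heat_var ((lam\<^sup>2 - 1) * s) (heat s f) x) \<partial>lborel)
      \<le> decay_const s * (ennreal (20 * lam\<^sup>2 * annuli_const) * annulus_energy)"
    by (simp add: J_def tau_def mu_def)
qed

lemma energy_drop_finite: "0 < s \<Longrightarrow> s \<le> 1 \<Longrightarrow> energy_drop s < \<infinity>"
  using order.strict_trans1[OF energy_drop_le] decay_const_finite[of s] annulus_energy_finite
  by (simp add: ennreal_mult_less_top)

end

section \<open>Weak continuity of the heat flow at time zero\<close>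

lemma heat_bound:
  assumes \<psi>: "\<psi> \<in> borel_measurable borel" "\<And>z. \<bar>\<psi> z\<bar> \<le> B * gauss_weight 1 z" and s: "0 < s" "s \<le> 1"
  shows "\<bar>heat s \<psi> z\<bar> \<le> B * gauss_weight 2 z"
proof -
  have [measurable]: "\<psi> \<in> borel_measurable borel" by fact
  have B: "B \<ge> 0"
    using order_trans[OF abs_ge_zero \<psi>(2)[of 0]] gauss_weight_pos[of 1 0] by (simp add: zero_le_mult_iff)
  have gw: "gauss_integrable (\<lambda>z. B * gauss_weight 1 z)"
  proof -
    have "gauss_integrable (gauss_weight 1)"
    proof -
      have "(\<integral>\<^sup>+z. ennreal \<bar>gauss_weight 1 z\<bar> * ennreal (gauss_weight r z) \<partial>lborel) < \<infinity>" if "r > 0" for r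
      proof -
        have "(\<integral>\<^sup>+z. ennreal \<bar>gauss_weight 1 z\<bar> * ennreal (gauss_weight r z) \<partial>lborel) \<le> (\<integral>\<^sup>+z. 1 * ennreal (gauss_weight r z) \<partial>lborel)"
          by (intro nn_integral_mono mult_right_mono) (auto simp: gauss_weight_nonneg gauss_weight_le_1)
        also have "\<dots> < \<infinity>" using that by (simp add: nn_integral_gauss_weight)
        finally show ?thesis .
      qed
      then show ?thesis by (simp add: gauss_integrable_def)
    qed
    then show ?thesis by (rule gauss_integrable_cmult)
  qed
  have "ennreal \<bar>heat s \<psi> z\<bar> \<le> heat_nn s (\<lambda>z. ennreal \<bar>\<psi> z\<bar>) z"
  proof (rule heat_abs_le[OF _ s(1)])
    have "(\<integral>\<^sup>+z. ennreal \<bar>\<psi> z\<bar> * ennreal (gauss_weight r z) \<partial>lborel)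
        \<le> (\<integral>\<^sup>+z. ennreal \<bar>B * gauss_weight 1 z\<bar> * ennreal (gauss_weight r z) \<partial>lborel)" for r
      by (intro nn_integral_mono mult_right_mono ennreal_leI) (auto intro: order_trans[OF \<psi>(2) abs_ge_self])
    with gw show "gauss_integrable \<psi>" unfolding gauss_integrable_def using \<psi>(1) by (blast intro: order.strict_trans1)
  qed
  also have "\<dots> \<le> heat_nn s (\<lambda>z. ennreal B * ennreal (gauss_weight 1 z)) z"
    unfolding heat_nn_def using \<psi>(2) B
    by (intro nn_integral_mono mult_left_mono) (auto simp: gauss_weight_nonneg simp flip: ennreal_mult intro!: ennreal_leI)
  also have "\<dots> = (\<integral>\<^sup>+y. ennreal B * (ennreal (heat_kernel s (z - y)) * ennreal (gauss_weight 1 y)) \<partial>lborel)"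
    unfolding heat_nn_def by (simp add: mult_ac)
  also have "\<dots> = ennreal B * heat_nn s (\<lambda>z. ennreal (gauss_weight 1 z)) z"
    unfolding heat_nn_def by (rule nn_integral_cmult) measurable
  also have "\<dots> \<le> ennreal B * ennreal (gauss_weight (1 + s) z)"
    by (intro mult_left_mono heat_nn_gauss_weight_le s) auto
  also have "\<dots> \<le> ennreal B * ennreal (gauss_weight 2 z)"
    using s by (intro mult_left_mono ennreal_leI gauss_weight_mono) auto
  finally show ?thesis
    using B by (simp add: gauss_weight_nonneg flip: ennreal_mult)
qed

lemma heat_symmetric:
  assumes g: "gauss_integrable g" and \<psi>: "\<psi> \<in> borel_measurable borel" "\<And>z. \<bar>\<psi> z\<bar> \<le> B * gauss_weight 1 z"
    and s: "0 < s" "s \<le> 1"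
  shows "(LINT x|lborel. \<psi> x * heat s g x) = (LINT z|lborel. g z * heat s \<psi> z)"
proof -
  have [measurable]: "\<psi> \<in> borel_measurable borel" "g \<in> borel_measurable borel"
    using \<psi> g by (auto simp: gauss_integrable_def)
  have B: "B \<ge> 0"
    using order_trans[OF abs_ge_zero \<psi>(2)[of 0]] gauss_weight_pos[of 1 0] by (simp add: zero_le_mult_iff)
  define F where "F = (\<lambda>x z. \<psi> x * (heat_kernel s (x - z) * g z))"
  have [measurable]: "case_prod F \<in> borel_measurable (lborel \<Otimes>\<^sub>M lborel)"
    unfolding F_def by measurable
  have int: "integrable (lborel \<Otimes>\<^sub>M lborel) (case_prod F)"
  proof (rule integrableI_bounded)
    have "(\<integral>\<^sup>+p. ennreal (norm (case_prod F p)) \<partial>(lborel \<Otimes>\<^sub>M lborel))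
      = (\<integral>\<^sup>+x. (\<integral>\<^sup>+z. ennreal (norm (F x z)) \<partial>lborel) \<partial>lborel)"
      by (subst lborel.nn_integral_fst[symmetric]) auto
    also have "\<dots> = (\<integral>\<^sup>+x. ennreal \<bar>\<psi> x\<bar> * heat_nn s (\<lambda>z. ennreal \<bar>g z\<bar>) x \<partial>lborel)"
      unfolding heat_nn_def F_def
      by (subst nn_integral_cmult[symmetric])
         (auto simp: abs_mult heat_kernel_nonneg s ennreal_mult intro!: nn_integral_cong)
    also have "\<dots> \<le> (\<integral>\<^sup>+x. ennreal B * (ennreal (gauss_weight 1 x) * heat_nn s (\<lambda>z. ennreal \<bar>g z\<bar>) x) \<partial>lborel)"
      unfolding mult.assoc[symmetric] using \<psi>(2) B
      by (intro nn_integral_mono mult_right_mono) (auto simp: gauss_weight_nonneg simp flip: ennreal_mult intro!: ennreal_leI)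
    also have "\<dots> = ennreal B * (\<integral>\<^sup>+x. ennreal (gauss_weight 1 x) * heat_nn s (\<lambda>z. ennreal \<bar>g z\<bar>) x \<partial>lborel)"
      by (rule nn_integral_cmult) measurable
    also have "(\<integral>\<^sup>+x. ennreal (gauss_weight 1 x) * heat_nn s (\<lambda>z. ennreal \<bar>g z\<bar>) x \<partial>lborel)
        = (\<integral>\<^sup>+z. ennreal \<bar>g z\<bar> * heat_nn s (\<lambda>x. ennreal (gauss_weight 1 x)) z \<partial>lborel)"
      by (rule heat_nn_symmetric) measurable
    also have "\<dots> \<le> (\<integral>\<^sup>+z. ennreal \<bar>g z\<bar> * ennreal (gauss_weight (1 + s) z) \<partial>lborel)"
      by (intro nn_integral_mono mult_left_mono heat_nn_gauss_weight_le s) auto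
    also have "ennreal B * \<dots> < \<infinity>"
      using g s by (simp add: gauss_integrable_def ennreal_mult_less_top)
    finally show "(\<integral>\<^sup>+p. ennreal (norm (case_prod F p)) \<partial>(lborel \<Otimes>\<^sub>M lborel)) < \<infinity>"
      by (simp add: mult_left_mono)
  qed measurable
  have "(LINT x|lborel. \<psi> x * heat s g x) = (LINT x|lborel. LINT z|lborel. F x z)"
    unfolding heat_def F_def by simp
  also have "\<dots> = (LINT z|lborel. LINT x|lborel. F x z)"
    by (rule lborel_pair.Fubini_integral[OF int, symmetric])
  also have "\<dots> = (LINT z|lborel. LINT x|lborel. g z * (heat_kernel s (z - x) * \<psi> x))"
    unfolding F_def by (simp add: heat_kernel_commute mult_ac)
  also have "\<dots> = (LINT z|lborel. g z * heat s \<psi> z)"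
    unfolding heat_def by simp
  finally show ?thesis .
qed

text \<open>
  Scaling turns the approximate identity into a fixed Gaussian average of \<open>\<psi> (z - \<rho> w)\<close>, to which dominated
  convergence applies.
\<close>

lemma heat_tendsto_initial:
  assumes c: "continuous_on UNIV \<psi>" and b: "\<And>z. \<bar>\<psi> z\<bar> \<le> B"
    and \<rho>: "\<rho> \<longlonglongrightarrow> 0" "\<And>m. \<rho> m > 0"
  shows "(\<lambda>m. heat ((\<rho> m)\<^sup>2) \<psi> z) \<longlonglongrightarrow> \<psi> z"
proof -
  have [measurable]: "\<psi> \<in> borel_measurable borel" using c by (rule borel_measurable_continuous_onI)
  have eq: "heat ((\<rho> m)\<^sup>2) \<psi> z = (LINT w|lborel. heat_kernel 1 w * \<psi> (z - \<rho> m *\<^sub>R w))" for m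
  proof -
    have "heat ((\<rho> m)\<^sup>2) \<psi> z = (- \<rho> m)\<^sup>2 * (LINT w|lborel. heat_kernel ((\<rho> m)\<^sup>2) (z - (z + (- \<rho> m) *\<^sub>R w)) * \<psi> (z + (- \<rho> m) *\<^sub>R w))"
      unfolding heat_def using \<rho>(2)[of m]
      by (intro integral_affine[where h = "\<lambda>y. heat_kernel ((\<rho> m)\<^sup>2) (z - y) * \<psi> y"]) auto
    also have "\<dots> = (LINT w|lborel. (- \<rho> m)\<^sup>2 * (heat_kernel ((\<rho> m)\<^sup>2) (z - (z + (- \<rho> m) *\<^sub>R w)) * \<psi> (z + (- \<rho> m) *\<^sub>R w)))"
      by simp
    also have "\<dots> = (LINT w|lborel. heat_kernel 1 w * \<psi> (z - \<rho> m *\<^sub>R w))"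
      using \<rho>(2)[of m]
      by (intro Bochner_Integration.integral_cong refl) (simp add: heat_kernel_def power_mult_distrib)
    finally show ?thesis .
  qed
  have one: "integrable lborel (heat_kernel 1)" "(LINT w|lborel. heat_kernel 1 w) = 1"
  proof -
    have "integrable lborel (\<lambda>w. heat_kernel 1 (0 - w) * 1)"
      by (rule integrable_heat[OF gauss_integrable_const]) simp
    then show "integrable lborel (heat_kernel 1)" by (simp add: heat_kernel_minus)
    show "(LINT w|lborel. heat_kernel 1 w) = 1"
      using heat_const[of 1 1 0] by (simp add: heat_def heat_kernel_minus)
  qed
  have "(\<lambda>m. LINT w|lborel. heat_kernel 1 w * \<psi> (z - \<rho> m *\<^sub>R w)) \<longlonglongrightarrow> (LINT w|lborel. heat_kernel 1 w * \<psi> z)"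
  proof (rule integral_dominated_convergence)
    show "integrable lborel (\<lambda>w. B * heat_kernel 1 w)" using one by simp
    show "AE w in lborel. (\<lambda>m. heat_kernel 1 w * \<psi> (z - \<rho> m *\<^sub>R w)) \<longlonglongrightarrow> heat_kernel 1 w * \<psi> z"
    proof (rule AE_I2)
      fix w :: "real^2"
      have "(\<lambda>m. z - \<rho> m *\<^sub>R w) \<longlonglongrightarrow> z - 0 *\<^sub>R w" by (intro tendsto_intros \<rho>)
      then have "(\<lambda>m. \<psi> (z - \<rho> m *\<^sub>R w)) \<longlonglongrightarrow> \<psi> (z - 0 *\<^sub>R w)"
        using c by (intro isCont_tendsto_compose[of _ \<psi>]) (auto simp: continuous_on_eq_continuous_at)
      then show "(\<lambda>m. heat_kernel 1 w * \<psi> (z - \<rho> m *\<^sub>R w)) \<longlonglongrightarrow> heat_kernel 1 w * \<psi> z"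
        by (intro tendsto_mult tendsto_const) simp
    qed
    show "AE w in lborel. norm (heat_kernel 1 w * \<psi> (z - \<rho> m *\<^sub>R w)) \<le> B * heat_kernel 1 w" for m
    proof (rule AE_I2)
      fix w
      have "heat_kernel 1 w * \<bar>\<psi> (z - \<rho> m *\<^sub>R w)\<bar> \<le> heat_kernel 1 w * B"
        by (intro mult_left_mono b) (simp add: heat_kernel_nonneg)
      then show "norm (heat_kernel 1 w * \<psi> (z - \<rho> m *\<^sub>R w)) \<le> B * heat_kernel 1 w"
        by (simp add: abs_mult heat_kernel_nonneg mult.commute)
    qed
  qed measurable
  then show ?thesis using one by (simp add: eq)
qed

text \<open>
  By symmetry the flow is moved to the test function, whose flow converges pointwise and stays
  below a fixed Gaussian weight.
\<close>

lemma heat_weakly_continuous: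
  assumes g: "gauss_integrable g" and c: "continuous_on UNIV \<psi>" and b: "\<And>z. \<bar>\<psi> z\<bar> \<le> B * gauss_weight 1 z"
    and \<rho>: "\<rho> \<longlonglongrightarrow> 0" "\<And>m. 0 < \<rho> m" "\<And>m. \<rho> m \<le> 1"
  shows "(\<lambda>m. LINT x|lborel. \<psi> x * heat ((\<rho> m)\<^sup>2) g x) \<longlonglongrightarrow> (LINT x|lborel. \<psi> x * g x)"
proof -
  have [measurable]: "\<psi> \<in> borel_measurable borel" using c by (rule borel_measurable_continuous_onI)
  have [measurable]: "g \<in> borel_measurable borel" using g by (simp add: gauss_integrable_def)
  have B: "B \<ge> 0"
    using order_trans[OF abs_ge_zero b[of 0]] gauss_weight_pos[of 1 0] by (simp add: zero_le_mult_iff)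
  have b': "\<bar>\<psi> z\<bar> \<le> B" for z
    using order_trans[OF b mult_left_mono[OF gauss_weight_le_1 B]] by simp
  have s: "0 < (\<rho> m)\<^sup>2" "(\<rho> m)\<^sup>2 \<le> 1" for m
    using \<rho>(2,3)[of m] by (auto simp: power_le_one)
  have "(\<lambda>m. LINT z|lborel. g z * heat ((\<rho> m)\<^sup>2) \<psi> z) \<longlonglongrightarrow> (LINT z|lborel. g z * \<psi> z)"
  proof (rule integral_dominated_convergence)
    show "integrable lborel (\<lambda>z. B * \<bar>gauss_weight 2 z * g z\<bar>)"
      by (intro integrable_mult_right integrable_abs gauss_integrableD g) simp
    show "AE z in lborel. (\<lambda>m. g z * heat ((\<rho> m)\<^sup>2) \<psi> z) \<longlonglongrightarrow> g z * \<psi> z"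
      by (intro AE_I2 tendsto_mult tendsto_const heat_tendsto_initial[OF c b'] \<rho>)
    show "AE z in lborel. norm (g z * heat ((\<rho> m)\<^sup>2) \<psi> z) \<le> B * \<bar>gauss_weight 2 z * g z\<bar>" for m
    proof (rule AE_I2)
      fix z
      have "\<bar>g z\<bar> * \<bar>heat ((\<rho> m)\<^sup>2) \<psi> z\<bar> \<le> \<bar>g z\<bar> * (B * gauss_weight 2 z)"
        by (intro mult_left_mono heat_bound[OF _ b s]) auto
      then show "norm (g z * heat ((\<rho> m)\<^sup>2) \<psi> z) \<le> B * \<bar>gauss_weight 2 z * g z\<bar>"
        by (simp add: abs_mult gauss_weight_nonneg mult_ac)
    qed
  qed measurable
  moreover have "(LINT x|lborel. \<psi> x * heat ((\<rho> m)\<^sup>2) g x) = (LINT z|lborel. g z * heat ((\<rho> m)\<^sup>2) \<psi> z)" for m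
    by (rule heat_symmetric[OF g _ b s]) simp
  ultimately show ?thesis by (simp add: mult.commute)
qed

section \<open>The lower bound\<close>

text \<open>
  Lebesgue measurable functions are almost everywhere limits of continuous functions; truncation
  keeps the approximants bounded.
\<close>

lemma bounded_approx_continuous:
  fixes \<eta> :: "real^2 \<Rightarrow> real"
  assumes [measurable]: "\<eta> \<in> borel_measurable borel" and b: "\<And>x. \<bar>\<eta> x\<bar> \<le> B"
  obtains g where "\<And>n::nat. continuous_on UNIV (g n)" "\<And>n x. \<bar>g n x\<bar> \<le> B"
    "AE x in lborel. (\<lambda>n. g n x) \<longlonglongrightarrow> \<eta> x"
proof -
  have "\<eta> \<in> borel_measurable (lebesgue_on UNIV)"
    by (simp add: lebesgue_on_UNIV_eq measurable_completion)
  then have "\<eta> measurable_on UNIV"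
    by (subst measurable_on_iff_borel_measurable) simp_all
  then obtain M h where M: "negligible M" and h: "\<And>n. continuous_on UNIV (h n)"
    and lim: "\<And>x. x \<notin> M \<Longrightarrow> (\<lambda>n. h n x) \<longlonglongrightarrow> \<eta> x"
    unfolding measurable_on_def by auto
  have B: "B \<ge> 0" using b[of 0] by linarith
  define g where "g = (\<lambda>n::nat. \<lambda>x. max (- B) (min B (h n x)))"
  show ?thesis
  proof
    show "continuous_on UNIV (g n)" for n unfolding g_def by (intro continuous_intros h)
    show "\<bar>g n x\<bar> \<le> B" for n x using B unfolding g_def by auto
    have "(\<lambda>n. g n x) \<longlonglongrightarrow> \<eta> x" if "x \<notin> M" for x
    proof -
      have "(\<lambda>n. g n x) \<longlonglongrightarrow> max (- B) (min B (\<eta> x))"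
        unfolding g_def by (intro tendsto_intros lim that)
      then show ?thesis using b[of x] by (simp add: abs_le_iff max_def min_def split: if_splits)
    qed
    moreover have "AE x in lebesgue. x \<notin> M"
      using M by (simp add: negligible_iff_null_sets AE_not_in)
    ultimately have "AE x in lebesgue. (\<lambda>n. g n x) \<longlonglongrightarrow> \<eta> x" by (auto elim: eventually_mono)
    then show "AE x in lborel. (\<lambda>n. g n x) \<longlonglongrightarrow> \<eta> x" by (simp add: AE_completion_iff)
  qed
qed

context dss_L2
begin

text \<open>
  The difference of two cut-offs of the energy balance, rescaled to unit size: a smooth substitute for the
  indicator of one annulus.
\<close>

definition shell_weight :: "real^2 \<Rightarrow> real" where
  "shell_weight x = gauss_weight 1 x - gauss_weight (1 / lam\<^sup>2) x"

lemma shell_weight_measurable [measurable]: "shell_weight \<in> borel_measurable borel"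
  unfolding shell_weight_def[abs_def] by measurable

lemma inverse_lam_square: "0 < 1 / lam\<^sup>2" "1 / lam\<^sup>2 \<le> 1"
  using lam lam_square by simp_all

lemma shell_weight_nonneg: "shell_weight x \<ge> 0"
  unfolding shell_weight_def using gauss_weight_mono[OF inverse_lam_square] by simp

lemma shell_weight_le: "shell_weight x \<le> gauss_weight 1 x"
  unfolding shell_weight_def by (simp add: gauss_weight_nonneg)

lemma continuous_on_shell_weight: "continuous_on UNIV shell_weight"
  unfolding shell_weight_def[abs_def] gauss_weight_def using lam by (intro continuous_intros) auto

lemma integrable_shell_weight_mult:
  assumes g: "gauss_integrable g" and [measurable]: "\<eta> \<in> borel_measurable borel" and b: "\<And>x. \<bar>\<eta> x\<bar> \<le> B"
  shows "integrable lborel (\<lambda>x. shell_weight x * \<eta> x * g x)"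
proof (rule integrable_dominated)
  have [measurable]: "g \<in> borel_measurable borel" using g by (simp add: gauss_integrable_def)
  show "integrable lborel (\<lambda>x. B * (gauss_weight 1 x * g x))"
    by (intro integrable_mult_right gauss_integrableD g) simp
  show "(\<lambda>x. shell_weight x * \<eta> x * g x) \<in> borel_measurable borel" by measurable
  fix x
  have "\<bar>shell_weight x\<bar> * \<bar>\<eta> x\<bar> * \<bar>g x\<bar> \<le> gauss_weight 1 x * B * \<bar>g x\<bar>"
    using shell_weight_nonneg shell_weight_le b[of x] by (intro mult_right_mono mult_mono) (auto simp: gauss_weight_nonneg)
  moreover have "B \<ge> 0" using b[of 0] by linarith
  ultimately show "\<bar>shell_weight x * \<eta> x * g x\<bar> \<le> \<bar>B * (gauss_weight 1 x * g x)\<bar>"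
    by (simp add: abs_mult gauss_weight_nonneg mult_ac)
qed

lemma weighted_energy_as_integral:
  assumes s: "0 < s" "s \<le> 1" and r: "r > 0"
  shows "integrable lborel (\<lambda>x. gauss_weight r x * (heat s f x)\<^sup>2)"
    "weighted_energy r s = ennreal (LINT x|lborel. gauss_weight r x * (heat s f x)\<^sup>2)"
proof -
  show i: "integrable lborel (\<lambda>x. gauss_weight r x * (heat s f x)\<^sup>2)"
    by (intro gauss_integrableD heat_square_gauss_integrable s r)
  show "weighted_energy r s = ennreal (LINT x|lborel. gauss_weight r x * (heat s f x)\<^sup>2)"
    unfolding weighted_energy_def
    by (subst nn_integral_eq_integral[OF i, symmetric]) (simp_all add: gauss_weight_nonneg ennreal_mult)
qed

text \<open>
  The energy balance at time 1 with a weight of squared width \<open>mu\<^sup>2\<close>, where \<open>mu = lam ^ m\<close>, rescaled by \<open>mu\<close>: the solution is now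
  taken at the small time \<open>1 / mu\<^sup>2\<close>. The correction vanishes as \<open>m\<close> grows, because the localised
  energy at time 1 is at most of order \<open>mu\<close> and enters with the factor \<open>1 / mu\<^sup>2\<close>.
\<close>

lemma shell_energy_le:
  fixes m :: nat
  defines "s \<equiv> (1 / lam ^ m)\<^sup>2"
  shows "(LINT x|lborel. shell_weight x * (heat s f x)\<^sup>2) \<le> enn2real (energy_drop 1)
     + (lam\<^sup>2 - 1) * (s * enn2real (energy_drop 1) + (1 / lam ^ m) * enn2real (decay_const 1 * (ennreal (8 * annuli_const) * annulus_energy)))"
proof -
  define mu where "mu = lam ^ m"
  have mu: "scaling_factor mu" unfolding mu_def by (rule scale_power)
  note m0 = scale_pos[OF mu]
  have mu1: "mu \<ge> 1" using lam by (simp add: mu_def)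
  have s_eq: "s = 1 / mu\<^sup>2" by (simp add: s_def mu_def power_divide)
  have s: "0 < s" "s \<le> 1" using m0 mu1 by (auto simp: s_eq)
  define tau where "tau = lam\<^sup>2 - 1"
  have tau: "tau > 0" using lam_square by (simp add: tau_def)
  define v where "v = enn2real (energy_drop 1)"
  have v: "energy_drop 1 = ennreal v" using energy_drop_finite[of 1] by (simp add: v_def)
  have v0: "v \<ge> 0" by (simp add: v_def)
  \<comment> \<open>The constant that bounds the weighted energy at time 1 by \<open>mu * c\<close>; the 8 comes from the weight with parameter 2.\<close>
  define c where "c = enn2real (decay_const 1 * (ennreal (8 * annuli_const) * annulus_energy))"
  have c: "decay_const 1 * (ennreal (8 * annuli_const) * annulus_energy) = ennreal c"
    using decay_const_finite[of 1] annulus_energy_finite by (simp add: c_def ennreal_mult_less_top)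
  have c0: "c \<ge> 0" by (simp add: c_def)
  have sc: "weighted_energy (mu\<^sup>2 * r) 1 = weighted_energy r s" for r
    using weighted_energy_scale[OF mu, of r s] m0 by (simp add: s_eq)
  define A where "A = (LINT x|lborel. gauss_weight 1 x * (heat s f x)\<^sup>2)"
  define B where "B = (LINT x|lborel. gauss_weight (1 / lam\<^sup>2) x * (heat s f x)\<^sup>2)"
  have A: "weighted_energy (mu\<^sup>2) 1 = ennreal A" using sc[of 1] weighted_energy_as_integral(2)[OF s, of 1] by (simp add: A_def)
  have l2: "1 / lam\<^sup>2 > 0" using lam by simp
  have B: "weighted_energy (mu\<^sup>2 / lam\<^sup>2) 1 = ennreal B" using sc[of "1 / lam\<^sup>2"] weighted_energy_as_integral(2)[OF s l2] by (simp add: B_def)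
  have A0: "A \<ge> 0" "B \<ge> 0" unfolding A_def B_def
    by (auto intro!: Bochner_Integration.integral_nonneg simp: gauss_weight_nonneg)
  have BA: "B \<le> A" unfolding A_def B_def
    by (intro integral_mono weighted_energy_as_integral s l2 mult_right_mono gauss_weight_mono inverse_lam_square) auto
  have Ac: "A \<le> mu * c"
  proof -
    have "weighted_energy (mu\<^sup>2) 1 \<le> decay_const 1 * (\<integral>\<^sup>+x. radial_square x * ennreal (gauss_weight (mu\<^sup>2 + 1) x) \<partial>lborel)"
      using m0 by (intro weighted_energy_le) auto
    also have "\<dots> \<le> decay_const 1 * (\<integral>\<^sup>+x. radial_square x * ennreal (gauss_weight (mu\<^sup>2 * 2) x) \<partial>lborel)"
      using mu1 by (intro mult_left_mono nn_integral_mono ennreal_leI gauss_weight_mono) (auto intro: add_nonneg_pos)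
    also have "\<dots> = decay_const 1 * (ennreal mu * (\<integral>\<^sup>+x. radial_square x * ennreal (gauss_weight 2 x) \<partial>lborel))"
      by (simp add: nn_integral_radial_square_weight_scale[OF mu])
    also have "\<dots> \<le> decay_const 1 * (ennreal mu * (ennreal (8 * annuli_const) * annulus_energy))"
      using nn_integral_radial_square_weight[of 2] by (intro mult_left_mono) (simp_all add: annuli_const_def)
    also have "\<dots> = ennreal mu * ennreal c" by (simp add: c[symmetric] mult_ac)
    finally show ?thesis using m0 c0 by (simp add: A flip: ennreal_mult)
  qed
  define J where "J = (\<integral>\<^sup>+x. ennreal (gauss_weight (mu\<^sup>2) x) * ennreal (heat_var tau (heat 1 f) x) \<partial>lborel)"
  have J: "J \<le> ennreal v"
  proof -
    have "J \<le> (\<integral>\<^sup>+x. 1 * ennreal (heat_var tau (heat 1 f) x) \<partial>lborel)"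
      unfolding J_def using m0 by (intro nn_integral_mono mult_right_mono ennreal_le_1[THEN iffD2] gauss_weight_le_1) auto
    then show ?thesis by (simp add: v[symmetric] energy_drop_def tau_def)
  qed
  have "ennreal (mu\<^sup>2 / (mu\<^sup>2 + tau)) * weighted_energy (mu\<^sup>2) 1 \<le> ennreal (mu\<^sup>2 / (mu\<^sup>2 + tau)) * weighted_energy (mu\<^sup>2 + tau) 1"
    using m0 tau by (intro mult_left_mono weighted_energy_mono) auto
  also have "\<dots> = J + weighted_energy (mu\<^sup>2 / lam\<^sup>2) 1"
    using energy_identity_self_similar[of 1 "mu\<^sup>2"] m0 by (simp add: J_def tau_def)
  also have "\<dots> \<le> ennreal v + ennreal B" unfolding B by (intro add_right_mono J)
  finally have "ennreal (mu\<^sup>2 / (mu\<^sup>2 + tau) * A) \<le> ennreal (v + B)"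
    using A0 v0 m0 tau unfolding A by (subst ennreal_mult) simp_all
  then have "mu\<^sup>2 / (mu\<^sup>2 + tau) * A \<le> v + B"
    using A0 v0 by (subst (asm) ennreal_le_iff) auto
  moreover have p: "mu\<^sup>2 + tau > 0" using tau m0 by (simp add: add_pos_pos)
  ultimately have "mu\<^sup>2 * A \<le> (v + B) * (mu\<^sup>2 + tau)" by (simp add: field_simps)
  also have "\<dots> \<le> mu\<^sup>2 * (v + B) + tau * (v + mu * c)"
    using BA Ac tau by (simp add: algebra_simps)
  finally have "mu\<^sup>2 * (A - B) \<le> mu\<^sup>2 * v + tau * (v + mu * c)" by (simp add: algebra_simps)
  then have "A - B \<le> (mu\<^sup>2 * v + tau * (v + mu * c)) / mu\<^sup>2"
    using m0 by (simp add: field_simps)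
  also have "\<dots> = v + tau * (s * v + (1 / mu) * c)"
    using m0 by (simp add: s_eq field_simps power2_eq_square)
  finally have "A - B \<le> v + tau * (s * v + (1 / mu) * c)" .
  moreover have "(LINT x|lborel. shell_weight x * (heat s f x)\<^sup>2) = A - B"
    unfolding A_def B_def shell_weight_def left_diff_distrib
    by (intro Bochner_Integration.integral_diff weighted_energy_as_integral s l2) simp
  ultimately show ?thesis by (simp add: v_def c_def tau_def mu_def)
qed

text \<open>
  Expanding \<open>(u - \<eta>)\<^sup>2 \<ge> 0\<close> bounds the energy of \<open>u\<close> from below by an expression that is affine in \<open>u\<close> and therefore
  passes to the limit under weak convergence. This is the lower semicontinuity of the energy.
\<close>

lemma test_function_bound_continuous:
  assumes c: "continuous_on UNIV \<eta>" and b: "\<And>x. \<bar>\<eta> x\<bar> \<le> B"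
  shows "2 * (LINT x|lborel. shell_weight x * \<eta> x * f x) - (LINT x|lborel. shell_weight x * \<eta> x * \<eta> x) \<le> enn2real (energy_drop 1)"
proof -
  have [measurable]: "\<eta> \<in> borel_measurable borel" using c by (rule borel_measurable_continuous_onI)
  have B: "B \<ge> 0" using b[of 0] by linarith
  define \<rho> where "\<rho> = (\<lambda>m::nat. 1 / lam ^ m)"
  have \<rho>: "\<rho> \<longlonglongrightarrow> 0" "\<And>m. 0 < \<rho> m" "\<And>m. \<rho> m \<le> 1"
    using lam LIMSEQ_inverse_realpow_zero[OF lam] by (auto simp: \<rho>_def inverse_eq_divide)
  have s: "0 < (\<rho> m)\<^sup>2" "(\<rho> m)\<^sup>2 \<le> 1" for m
    using \<rho>(2,3)[of m] by (auto simp: power_le_one)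
  define v where "v = enn2real (energy_drop 1)"
  define d where "d = enn2real (decay_const 1 * (ennreal (8 * annuli_const) * annulus_energy))"
  define I where "I = (LINT x|lborel. shell_weight x * \<eta> x * \<eta> x)"
  have int\<eta>: "integrable lborel (\<lambda>x. shell_weight x * \<eta> x * \<eta> x)"
  proof (rule integrable_shell_weight_mult[OF _ _ b])
    show "gauss_integrable \<eta>"
    proof -
      have "(\<integral>\<^sup>+z. ennreal \<bar>\<eta> z\<bar> * ennreal (gauss_weight r z) \<partial>lborel) \<le> (\<integral>\<^sup>+z. ennreal \<bar>B\<bar> * ennreal (gauss_weight r z) \<partial>lborel)" for r
        using b B by (intro nn_integral_mono mult_right_mono) (auto intro!: ennreal_leI)
      with gauss_integrable_const[of B] show ?thesis
        unfolding gauss_integrable_def by (auto intro: order.strict_trans1)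
    qed
  qed measurable
  have "2 * (LINT x|lborel. shell_weight x * \<eta> x * heat ((\<rho> m)\<^sup>2) f x) - I \<le> v + (lam\<^sup>2 - 1) * ((\<rho> m)\<^sup>2 * v + \<rho> m * d)" for m
  proof -
    define u where "u = heat ((\<rho> m)\<^sup>2) f"
    have [measurable]: "u \<in> borel_measurable borel" unfolding u_def by measurable
    have iu: "integrable lborel (\<lambda>x. shell_weight x * \<eta> x * u x)"
      unfolding u_def by (intro integrable_shell_weight_mult[OF _ _ b] heat_gauss_integrable s) measurable
    have iuu: "integrable lborel (\<lambda>x. shell_weight x * (u x)\<^sup>2)"
      using integrable_shell_weight_mult[OF heat_square_gauss_integrable[OF s[of m]], of "\<lambda>_. 1" 1] by (simp add: u_def)
    have "2 * (LINT x|lborel. shell_weight x * \<eta> x * u x) - I = (LINT x|lborel. 2 * (shell_weight x * \<eta> x * u x) - shell_weight x * \<eta> x * \<eta> x)"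
      unfolding I_def using iu int\<eta> by simp
    also have "\<dots> \<le> (LINT x|lborel. shell_weight x * (u x)\<^sup>2)"
    proof (intro integral_mono Bochner_Integration.integrable_diff integrable_mult_right iu int\<eta> iuu)
      fix x
      have "0 \<le> shell_weight x * (u x - \<eta> x)\<^sup>2" using shell_weight_nonneg by simp
      then show "2 * (shell_weight x * \<eta> x * u x) - shell_weight x * \<eta> x * \<eta> x \<le> shell_weight x * (u x)\<^sup>2"
        by (simp add: power2_eq_square algebra_simps)
    qed
    also have "\<dots> \<le> v + (lam\<^sup>2 - 1) * ((\<rho> m)\<^sup>2 * v + \<rho> m * d)"
      using shell_energy_le[of m] by (simp add: u_def v_def d_def \<rho>_def)
    finally show ?thesis by (simp add: u_def)
  qed
  moreover have "(\<lambda>m. 2 * (LINT x|lborel. shell_weight x * \<eta> x * heat ((\<rho> m)\<^sup>2) f x) - I) \<longlonglongrightarrow> 2 * (LINT x|lborel. shell_weight x * \<eta> x * f x) - I"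
  proof (intro tendsto_intros heat_weakly_continuous[OF f_gauss_integrable _ _ \<rho>])
    show "continuous_on UNIV (\<lambda>x. shell_weight x * \<eta> x)" by (intro continuous_intros continuous_on_shell_weight c)
    show "\<bar>shell_weight z * \<eta> z\<bar> \<le> B * gauss_weight 1 z" for z
      using mult_mono[OF shell_weight_le[of z] b[of z]] shell_weight_nonneg[of z] gauss_weight_nonneg[of 1 z] by (simp add: abs_mult mult.commute)
  qed
  moreover have "(\<lambda>m. v + (lam\<^sup>2 - 1) * ((\<rho> m)\<^sup>2 * v + \<rho> m * d)) \<longlonglongrightarrow> v + (lam\<^sup>2 - 1) * (0\<^sup>2 * v + 0 * d)"
    by (intro tendsto_intros \<rho>)
  ultimately have "2 * (LINT x|lborel. shell_weight x * \<eta> x * f x) - I \<le> v + (lam\<^sup>2 - 1) * (0\<^sup>2 * v + 0 * d)"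
    by (intro LIMSEQ_le) auto
  then show ?thesis by (simp add: I_def v_def)
qed

lemma test_function_bound:
  assumes [measurable]: "\<eta> \<in> borel_measurable borel" and b: "\<And>x. \<bar>\<eta> x\<bar> \<le> B"
  shows "2 * (LINT x|lborel. shell_weight x * \<eta> x * f x) - (LINT x|lborel. shell_weight x * \<eta> x * \<eta> x) \<le> enn2real (energy_drop 1)"
proof -
  have B: "B \<ge> 0" using b[of 0] by linarith
  obtain g where g: "\<And>n::nat. continuous_on UNIV (g n)" "\<And>n x. \<bar>g n x\<bar> \<le> B"
    and lim: "AE x in lborel. (\<lambda>n. g n x) \<longlonglongrightarrow> \<eta> x"
    using bounded_approx_continuous[OF assms] by blast
  have [measurable]: "g n \<in> borel_measurable borel" for n using g(1) by (rule borel_measurable_continuous_onI)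
  have 1: "(\<lambda>n. LINT x|lborel. shell_weight x * g n x * f x) \<longlonglongrightarrow> (LINT x|lborel. shell_weight x * \<eta> x * f x)"
  proof (rule integral_dominated_convergence)
    show "integrable lborel (\<lambda>x. \<bar>shell_weight x * B * f x\<bar>)"
      by (intro integrable_abs integrable_shell_weight_mult[OF f_gauss_integrable, of "\<lambda>_. B" B]) (use B in auto)
    show "AE x in lborel. (\<lambda>n. shell_weight x * g n x * f x) \<longlonglongrightarrow> shell_weight x * \<eta> x * f x"
      using lim by eventually_elim (intro tendsto_intros)
    show "AE x in lborel. norm (shell_weight x * g n x * f x) \<le> \<bar>shell_weight x * B * f x\<bar>" for n
      using g(2) B by (intro AE_I2) (auto simp: abs_mult intro!: mult_right_mono mult_left_mono)
  qed measurable
  have 2: "(\<lambda>n. LINT x|lborel. shell_weight x * g n x * g n x) \<longlonglongrightarrow> (LINT x|lborel. shell_weight x * \<eta> x * \<eta> x)"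
  proof (rule integral_dominated_convergence)
    show "integrable lborel (\<lambda>x. shell_weight x * B * B)"
      by (intro integrable_shell_weight_mult[OF gauss_integrable_const, of "\<lambda>_. B" B]) (use B in auto)
    show "AE x in lborel. (\<lambda>n. shell_weight x * g n x * g n x) \<longlonglongrightarrow> shell_weight x * \<eta> x * \<eta> x"
      using lim by eventually_elim (intro tendsto_intros)
    show "AE x in lborel. norm (shell_weight x * g n x * g n x) \<le> shell_weight x * B * B" for n
      using g(2) B shell_weight_nonneg by (intro AE_I2) (auto simp: abs_mult intro!: mult_mono)
  qed measurable
  have "(\<lambda>n. 2 * (LINT x|lborel. shell_weight x * g n x * f x) - (LINT x|lborel. shell_weight x * g n x * g n x))
     \<longlonglongrightarrow> 2 * (LINT x|lborel. shell_weight x * \<eta> x * f x) - (LINT x|lborel. shell_weight x * \<eta> x * \<eta> x)"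
    by (intro tendsto_intros 1 2)
  then show ?thesis
    by (rule LIMSEQ_le_const2) (use test_function_bound_continuous[OF g] in blast)
qed

definition shell_const :: real where
  "shell_const = exp (- (lam\<^sup>2 / 4)) * (1 - exp (- ((lam\<^sup>2 - 1) / 4)))"

lemma shell_const_pos: "shell_const > 0"
  using lam_square by (simp add: shell_const_def)

lemma shell_weight_ge:
  assumes x: "x \<in> annulus lam"
  shows "shell_const \<le> shell_weight x"
proof -
  define a where "a = (norm x)\<^sup>2 / 4"
  have "1\<^sup>2 \<le> (norm x)\<^sup>2" using x by (intro power_mono) (auto simp: annulus_def)
  then have a1: "1 / 4 \<le> a" by (simp add: a_def)
  have "(norm x)\<^sup>2 \<le> lam\<^sup>2" using x by (intro power_mono) (auto simp: annulus_def)
  then have a2: "a \<le> lam\<^sup>2 / 4" by (simp add: a_def)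
  have "(lam\<^sup>2 - 1) * (1 / 4) \<le> (lam\<^sup>2 - 1) * a" using a1 lam_square by (intro mult_left_mono) auto
  then have "shell_const \<le> exp (- a) * (1 - exp (- ((lam\<^sup>2 - 1) * a)))"
    unfolding shell_const_def using a2 lam_square by (intro mult_mono) auto
  also have "\<dots> = exp (- a) - exp (- (lam\<^sup>2 * a))" by (simp add: right_diff_distrib left_diff_distrib flip: exp_add)
  also have "\<dots> = shell_weight x" by (simp add: shell_weight_def gauss_weight_def a_def mult.commute)
  finally show ?thesis .
qed

text \<open>
  The optimal test function would be \<open>f\<close> on the annulus and zero elsewhere; truncation makes it bounded,
  and monotone convergence removes the truncation.
\<close>

lemma annulus_energy_le_energy_drop: "ennreal shell_const * annulus_energy \<le> energy_drop 1"
proof -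
  define v where "v = enn2real (energy_drop 1)"
  have v: "energy_drop 1 = ennreal v" using energy_drop_finite[of 1] by (simp add: v_def)
  define \<eta> where "\<eta> = (\<lambda>(n::nat) x. indicator (annulus lam) x * max (- real n) (min (real n) (f x)))"
  have [measurable]: "\<eta> n \<in> borel_measurable borel" for n unfolding \<eta>_def by measurable
  have b: "\<bar>\<eta> n x\<bar> \<le> real n" for n x unfolding \<eta>_def by (auto simp: indicator_def)
  have f\<eta>: "\<eta> n x * \<eta> n x \<le> \<eta> n x * f x" for n x
  proof -
    have "max (- real n) (min (real n) (f x)) * max (- real n) (min (real n) (f x)) \<le> max (- real n) (min (real n) (f x)) * f x"
    proof (cases "f x \<ge> 0")
      case True then show ?thesis by (intro mult_left_mono) (auto simp: max_def min_def)
    next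
      case False then show ?thesis by (intro mult_left_mono_neg) (auto simp: max_def min_def)
    qed
    then show ?thesis unfolding \<eta>_def by (auto simp: indicator_def)
  qed
  have le: "(\<integral>\<^sup>+x. ennreal shell_const * ennreal ((\<eta> n x)\<^sup>2) \<partial>lborel) \<le> ennreal v" for n
  proof -
    have i1: "integrable lborel (\<lambda>x. shell_weight x * \<eta> n x * f x)"
      by (rule integrable_shell_weight_mult[OF f_gauss_integrable _ b]) measurable
    have i2: "integrable lborel (\<lambda>x. shell_weight x * \<eta> n x * \<eta> n x)"
    proof (rule Bochner_Integration.integrable_bound[OF i1])
      show "AE x in lborel. norm (shell_weight x * \<eta> n x * \<eta> n x) \<le> norm (shell_weight x * \<eta> n x * f x)"
      proof (rule AE_I2)
        fix x
        have "0 \<le> \<eta> n x * \<eta> n x" by simp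
        then have "\<bar>\<eta> n x * \<eta> n x\<bar> \<le> \<bar>\<eta> n x * f x\<bar>" using f\<eta>[of n x] by linarith
        then have "\<bar>shell_weight x\<bar> * \<bar>\<eta> n x * \<eta> n x\<bar> \<le> \<bar>shell_weight x\<bar> * \<bar>\<eta> n x * f x\<bar>" by (intro mult_left_mono) auto
        then show "norm (shell_weight x * \<eta> n x * \<eta> n x) \<le> norm (shell_weight x * \<eta> n x * f x)" by (simp only: real_norm_def abs_mult mult.assoc)
      qed
    qed measurable
    have "(LINT x|lborel. shell_weight x * \<eta> n x * \<eta> n x) \<le> (LINT x|lborel. shell_weight x * \<eta> n x * f x)"
      unfolding mult.assoc
      by (intro integral_mono mult_left_mono f\<eta> shell_weight_nonneg i1[unfolded mult.assoc] i2[unfolded mult.assoc])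
    then have vv: "(LINT x|lborel. shell_weight x * \<eta> n x * \<eta> n x) \<le> v"
      using test_function_bound[of "\<eta> n", OF _ b] unfolding v_def by simp
    have "(\<integral>\<^sup>+x. ennreal shell_const * ennreal ((\<eta> n x)\<^sup>2) \<partial>lborel) \<le> (\<integral>\<^sup>+x. ennreal (shell_weight x * \<eta> n x * \<eta> n x) \<partial>lborel)"
    proof (rule nn_integral_mono)
      fix x
      have "shell_const * (\<eta> n x)\<^sup>2 \<le> shell_weight x * (\<eta> n x)\<^sup>2"
      proof (cases "x \<in> annulus lam")
        case True then show ?thesis by (intro mult_right_mono shell_weight_ge) auto
      next
        case False then show ?thesis by (simp add: \<eta>_def)
      qed
      then show "ennreal shell_const * ennreal ((\<eta> n x)\<^sup>2) \<le> ennreal (shell_weight x * \<eta> n x * \<eta> n x)"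
        using shell_const_pos by (auto simp: power2_eq_square mult.assoc simp flip: ennreal_mult intro!: ennreal_leI)
    qed
    also have "\<dots> = ennreal (LINT x|lborel. shell_weight x * \<eta> n x * \<eta> n x)"
      using shell_weight_nonneg by (intro nn_integral_eq_integral i2 AE_I2) (simp add: mult.assoc)
    also have "\<dots> \<le> ennreal v" using vv by (rule ennreal_leI)
    finally show ?thesis .
  qed
  have "(\<integral>\<^sup>+x. ennreal shell_const * (ennreal ((f x)\<^sup>2) * indicator (annulus lam) x) \<partial>lborel) \<le> ennreal v"
  proof (rule LIMSEQ_le_const2)
    show "(\<lambda>n. \<integral>\<^sup>+x. ennreal shell_const * ennreal ((\<eta> n x)\<^sup>2) \<partial>lborel) \<longlonglongrightarrow> (\<integral>\<^sup>+x. ennreal shell_const * (ennreal ((f x)\<^sup>2) * indicator (annulus lam) x) \<partial>lborel)"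
    proof (rule nn_integral_LIMSEQ)
      show "incseq (\<lambda>n x. ennreal shell_const * ennreal ((\<eta> n x)\<^sup>2))"
      proof (rule incseq_SucI, rule le_funI)
        fix n x
        have "\<bar>max (- real n) (min (real n) (f x))\<bar> \<le> \<bar>max (- real (Suc n)) (min (real (Suc n)) (f x))\<bar>" by auto
        then have "(\<eta> n x)\<^sup>2 \<le> (\<eta> (Suc n) x)\<^sup>2"
          unfolding \<eta>_def by (subst abs_le_square_iff[symmetric]) (simp only: abs_mult, intro mult_left_mono, auto)
        then show "ennreal shell_const * ennreal ((\<eta> n x)\<^sup>2) \<le> ennreal shell_const * ennreal ((\<eta> (Suc n) x)\<^sup>2)"
          by (intro mult_left_mono ennreal_leI) auto
      qed
      show "(\<lambda>n. ennreal shell_const * ennreal ((\<eta> n x)\<^sup>2)) \<longlonglongrightarrow> ennreal shell_const * (ennreal ((f x)\<^sup>2) * indicator (annulus lam) x)" for x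
      proof (rule tendsto_eventually)
        obtain k :: nat where k: "\<bar>f x\<bar> \<le> real k" using real_arch_simple by blast
        have "ennreal ((\<eta> n x)\<^sup>2) = ennreal ((f x)\<^sup>2) * indicator (annulus lam) x" if "n \<ge> k" for n
        proof -
          have "\<bar>f x\<bar> \<le> real n" using k that by linarith
          then have "max (- real n) (min (real n) (f x)) = f x" by auto
          then show ?thesis by (simp add: \<eta>_def indicator_def)
        qed
        then show "\<forall>\<^sub>F n in sequentially. ennreal shell_const * ennreal ((\<eta> n x)\<^sup>2) = ennreal shell_const * (ennreal ((f x)\<^sup>2) * indicator (annulus lam) x)"
          unfolding eventually_sequentially by (intro exI[of _ k]) simp
      qed
    qed measurable
  qed (use le in blast)
  then show ?thesis unfolding v annulus_energy_def by (subst (asm) nn_integral_cmult) auto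
qed

end

section \<open>Borel representatives and similarity variables\<close>

lemma gradient_eq: "GDERIV g y :> D \<Longrightarrow> gradient g y = D"
  unfolding gradient_def by (intro the_equality) (auto dest: GDERIV_unique)

text \<open>
  The square root that underlies the norm, so that norm inequalities reduce to inequalities
  between the squared norms.
\<close>

definition root_nn :: "ennreal \<Rightarrow> ennreal" where
  "root_nn I = (if I = \<infinity> then \<infinity> else ennreal (sqrt (enn2real I)))"

lemma L2norm_root: "L2norm A g = root_nn (\<integral>\<^sup>+x\<in>A. ennreal ((norm (g x))\<^sup>2) \<partial>lebesgue)"
  by (simp add: L2norm_def root_nn_def Let_def)

lemma root_nn_le:
  assumes "I \<le> ennreal (c\<^sup>2) * J" "c > 0"
  shows "root_nn I \<le> ennreal c * root_nn J"
proof (cases "J = \<infinity>")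
  case True
  then show ?thesis using assms(2) by (simp add: root_nn_def ennreal_mult_top)
next
  case False
  then obtain j where j: "J = ennreal j" "j \<ge> 0" by (cases J) auto
  then have I: "I \<le> ennreal (c\<^sup>2 * j)" using assms by (simp add: ennreal_mult)
  then obtain i where i: "I = ennreal i" "i \<ge> 0" by (cases I) (auto simp: top_unique)
  have "i \<le> c\<^sup>2 * j" using I i j by simp
  then have "sqrt i \<le> sqrt (c\<^sup>2 * j)" by simp
  also have "\<dots> = c * sqrt j" using assms(2) by (simp add: real_sqrt_mult)
  finally show ?thesis using i j assms(2) by (simp add: root_nn_def ennreal_leI flip: ennreal_mult)
qed

lemma AE_scaleR:
  fixes P :: "real^2 \<Rightarrow> bool"
  assumes "AE x in lborel. P x" and c: "c \<noteq> 0"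
  shows "AE x in lborel. P (c *\<^sub>R x)"
proof -
  obtain M where M: "M \<in> sets lborel" "emeasure lborel M = 0" "\<And>x. x \<notin> M \<Longrightarrow> P x"
    using assms(1) by (rule AE_E) auto
  have [measurable]: "M \<in> sets borel" using M by simp
  have "0 = (\<integral>\<^sup>+x. indicator M x \<partial>lborel)" using M by simp
  also have "\<dots> = ennreal (c\<^sup>2) * (\<integral>\<^sup>+x. indicator M (0 + c *\<^sub>R x) \<partial>lborel)"
    by (rule nn_integral_affine[OF _ c]) measurable
  finally have "(\<integral>\<^sup>+x. indicator M (c *\<^sub>R x) \<partial>lborel) = 0" using c by simp
  then have "AE x in lborel. indicator M (c *\<^sub>R x) = (0::ennreal)"
    by (subst (asm) nn_integral_0_iff_AE) auto
  then show ?thesis by eventually_elim (auto simp: indicator_def M(3) split: if_splits)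
qed

lemma discretely_self_similar_power:
  assumes f: "discretely_self_similar lam f" and lam: "lam > 1" and x: "x \<noteq> 0"
  shows "f (lam ^ n *\<^sub>R x) = f x / lam ^ n"
proof (induction n)
  case (Suc n)
  have "f (lam ^ Suc n *\<^sub>R x) = f (lam *\<^sub>R (lam ^ n *\<^sub>R x))" by simp
  also have "\<dots> = inverse lam * f (lam ^ n *\<^sub>R x)"
    using f lam x unfolding discretely_self_similar_def by (simp del: scaleR_scaleR)
  finally show ?case using Suc lam by (simp add: field_simps)
qed simp

lemma discretely_self_similar_powr:
  assumes f: "discretely_self_similar lam f" and lam: "lam > 1" and x: "x \<noteq> 0"
  shows "f x = lam powr (- real_of_int k) * f (lam powr (- real_of_int k) *\<^sub>R x)"
proof (cases "k \<ge> 0")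
  case True
  then obtain n where n: "k = int n" using nonneg_int_cases by blast
  have c: "lam powr (- real_of_int k) = 1 / lam ^ n" using lam by (simp add: n powr_minus_divide powr_realpow)
  have "f (lam ^ n *\<^sub>R ((1 / lam ^ n) *\<^sub>R x)) = f ((1 / lam ^ n) *\<^sub>R x) / lam ^ n"
    using lam x by (intro discretely_self_similar_power f) auto
  then show ?thesis using lam unfolding c by simp
next
  case False
  then have "0 \<le> - k" by simp
  then obtain n where n: "- k = int n" by (rule nonneg_int_cases)
  then have "- real_of_int k = real n" by (metis of_int_minus of_int_of_nat_eq)
  then have c: "lam powr (- real_of_int k) = lam ^ n" using lam by (simp add: powr_realpow)
  show ?thesis unfolding c discretely_self_similar_power[OF f lam x] using lam by simp
qed

text \<open>
  Take a Borel function that agrees almost everywhere with \<open>f\<close> on the annulus and extend it by the scaling law. The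
  factor \<open>c x\<close> is the power of \<open>lam\<close> that moves \<open>x\<close> into the annulus. The exceptional set is contained in
  the countable union of the rescaled copies of one null set and the origin.
\<close>

lemma Borel_representative:
  assumes lam: "lam > 1" and f: "discretely_self_similar lam f" and L2: "in_L2 (annulus lam) f"
  obtains f' where "dss lam f'" "AE x in lborel. f x = f' x"
proof -
  define A where "A = annulus lam"
  have "(\<lambda>x. indicator A x *\<^sub>R f x) \<in> borel_measurable lebesgue"
    using L2 by (simp add: in_L2_def set_borel_measurable_def A_def)
  from completion_ex_borel_measurable_real[OF this]
  obtain g where g: "g \<in> borel_measurable lborel" and ae: "AE x in lborel. indicator A x *\<^sub>R f x = g x"
    by blast
  have [measurable]: "g \<in> borel_measurable borel" using g by simp
  define c where "c = (\<lambda>x::real^2. lam powr (- real_of_int \<lfloor>log lam (norm x)\<rfloor>))"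
  have [measurable]: "c \<in> borel_measurable borel" unfolding c_def by measurable
  define f' where "f' = (\<lambda>x. if x = 0 then 0 else c x * g (c x *\<^sub>R x))"
  have "f' \<in> borel_measurable borel" unfolding f'_def by measurable
  moreover have "f' (lam *\<^sub>R x) = f' x / lam" for x
  proof (cases "x = 0")
    case False
    have "log lam (norm (lam *\<^sub>R x)) = log lam (norm x) + 1"
      using lam False by (simp add: log_mult)
    then have "c (lam *\<^sub>R x) = c x / lam"
      using lam by (simp add: c_def powr_diff)
    then show ?thesis using lam False by (simp add: f'_def)
  qed (simp add: f'_def)
  ultimately have dss: "dss lam f'" using lam by unfold_locales auto
  have "AE x in lborel. \<forall>k::int. indicator A (lam powr (- real_of_int k) *\<^sub>R x) *\<^sub>R f (lam powr (- real_of_int k) *\<^sub>R x) = g (lam powr (- real_of_int k) *\<^sub>R x)"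
    unfolding AE_all_countable using lam by (intro allI AE_scaleR ae) auto
  then have "AE x in lborel. f x = f' x"
    using AE_lborel_singleton[of "0::real^2"]
  proof eventually_elim
    case (elim x)
    define k where "k = \<lfloor>log lam (norm x)\<rfloor>"
    have n: "norm x > 0" using elim by simp
    have "real_of_int k \<le> log lam (norm x)" "log lam (norm x) < real_of_int k + 1" by (auto simp: k_def)
    then have "lam powr real_of_int k \<le> norm x" "norm x < lam powr (real_of_int k + 1)"
      using lam n by (auto simp: le_log_iff log_less_iff)
    then have "c x *\<^sub>R x \<in> A"
      using lam by (simp add: A_def annulus_def c_def k_def[symmetric] powr_minus powr_add field_simps)
    then have "f (c x *\<^sub>R x) = g (c x *\<^sub>R x)"
      using elim(1)[rule_format, of k] by (simp add: c_def k_def)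
    moreover have "f x = c x * f (c x *\<^sub>R x)"
      unfolding c_def using elim by (intro discretely_self_similar_powr f lam) auto
    ultimately show ?case using elim by (simp add: f'_def)
  qed
  with dss show ?thesis using that by blast
qed

lemma heat_solution_eq_heat:
  assumes "AE x in lborel. f x = f' x" and [measurable]: "f' \<in> borel_measurable borel"
  shows "heat_solution f x t = heat t f' x"
proof -
  have ae: "AE x in lebesgue. f' x = f x" using assms(1) by (simp add: AE_completion_iff eq_commute)
  have f': "f' \<in> borel_measurable lebesgue" by (simp add: measurable_completion)
  then have f: "f \<in> borel_measurable lebesgue" using ae by (rule borel_measurable_AE)
  have km: "(\<lambda>z. heat_kernel t (x - z)) \<in> borel_measurable lebesgue"
    by (intro measurable_completion) simp
  have "heat_solution f x t = (LINT z|lebesgue. heat_kernel t (x - z) * f z)"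
    unfolding heat_solution_def by (intro Bochner_Integration.integral_cong refl) (simp add: heat_kernel_def)
  also have "\<dots> = (LINT z|lebesgue. heat_kernel t (x - z) * f' z)"
    using ae by (intro integral_cong_AE borel_measurable_times km f f') (auto elim: eventually_mono)
  also have "\<dots> = heat t f' x"
    unfolding heat_def by (rule integral_completion) measurable
  finally show ?thesis .
qed

context dss_L2
begin

definition grad_energy :: "real \<Rightarrow> ennreal" where
  "grad_energy t = (\<integral>\<^sup>+x. ennreal ((norm (heat_grad t f x))\<^sup>2) \<partial>lborel)"

lemma heat_grad_measurable [measurable]: "t > 0 \<Longrightarrow> heat_grad t f \<in> borel_measurable borel"
  by (rule borel_measurable_continuous_onI[OF continuous_on_heat_grad[OF f_gauss_integrable]])

lemma gradient_U0_energy: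
  assumes F: "\<And>x t. heat_solution F x t = heat t f x"
  shows "(\<integral>\<^sup>+y\<in>UNIV. ennreal ((norm (gradient (\<lambda>y. U0 F y s) y))\<^sup>2) \<partial>lebesgue) = ennreal (exp s) * grad_energy (exp s)"
proof -
  define t where "t = exp s"
  have t: "t > 0" by (simp add: t_def)
  have grad: "gradient (\<lambda>y. U0 F y s) y = t *\<^sub>R heat_grad t f (sqrt t *\<^sub>R y)" for y
  proof (rule gradient_eq)
    have lin: "((\<lambda>y. sqrt t *\<^sub>R y) has_derivative (\<lambda>h. sqrt t *\<^sub>R h)) (at y)"
      by (auto intro!: derivative_eq_intros)
    have "((\<lambda>y. sqrt t * heat t f (sqrt t *\<^sub>R y)) has_derivative (\<lambda>h. sqrt t * ((sqrt t *\<^sub>R h) \<bullet> heat_grad t f (sqrt t *\<^sub>R y)))) (at y)"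
      by (intro has_derivative_mult_right has_derivative_compose[OF lin]
            heat_has_gradient[OF f_gauss_integrable t, unfolded gderiv_def])
    moreover have "(\<lambda>h. sqrt t * ((sqrt t *\<^sub>R h) \<bullet> heat_grad t f (sqrt t *\<^sub>R y))) = (\<lambda>h. h \<bullet> (t *\<^sub>R heat_grad t f (sqrt t *\<^sub>R y)))"
      using t by (simp add: fun_eq_iff mult.assoc[symmetric])
    moreover have "(\<lambda>y. U0 F y s) = (\<lambda>y. sqrt t * heat t f (sqrt t *\<^sub>R y))"
      by (simp add: U0_def F t_def Let_def)
    ultimately show "GDERIV (\<lambda>y. U0 F y s) y :> t *\<^sub>R heat_grad t f (sqrt t *\<^sub>R y)"
      unfolding gderiv_def by simp
  qed
  have "grad_energy t = ennreal ((sqrt t)\<^sup>2) * (\<integral>\<^sup>+y. ennreal ((norm (heat_grad t f (0 + sqrt t *\<^sub>R y)))\<^sup>2) \<partial>lborel)"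
    unfolding grad_energy_def using t
    by (intro nn_integral_affine[where h = "\<lambda>x. ennreal ((norm (heat_grad t f x))\<^sup>2)"]) auto
  then have ge: "grad_energy t = ennreal t * (\<integral>\<^sup>+y. ennreal ((norm (heat_grad t f (sqrt t *\<^sub>R y)))\<^sup>2) \<partial>lborel)"
    using t by simp
  have "(\<integral>\<^sup>+y\<in>UNIV. ennreal ((norm (gradient (\<lambda>y. U0 F y s) y))\<^sup>2) \<partial>lebesgue)
     = (\<integral>\<^sup>+y. ennreal (t\<^sup>2) * ennreal ((norm (heat_grad t f (sqrt t *\<^sub>R y)))\<^sup>2) \<partial>lborel)"
    using t by (simp add: nn_integral_completion grad power_mult_distrib flip: ennreal_mult)
  also have "\<dots> = ennreal (t\<^sup>2) * (\<integral>\<^sup>+y. ennreal ((norm (heat_grad t f (sqrt t *\<^sub>R y)))\<^sup>2) \<partial>lborel)"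
  proof (rule nn_integral_cmult)
    have [measurable]: "heat_grad t f \<in> borel_measurable borel" using t by (rule heat_grad_measurable)
    show "(\<lambda>y. ennreal ((norm (heat_grad t f (sqrt t *\<^sub>R y)))\<^sup>2)) \<in> borel_measurable lborel" by measurable
  qed
  also have "\<dots> = ennreal t * grad_energy t"
    unfolding ge using t by (simp add: power2_eq_square ennreal_mult mult.assoc)
  finally show ?thesis by (simp add: t_def)
qed

text \<open>
  The time \<open>t\<close> is reached from \<open>s = t / lam\<^sup>2\<close>, so that the energy balance between \<open>s\<close> and \<open>lam\<^sup>2 * s\<close> ends at \<open>t\<close>. As
  \<open>s \<ge> 1 / lam\<^sup>2\<close>, the decay constant is uniform in \<open>t\<close>.
\<close>

lemma grad_energy_le:
  assumes t: "1 \<le> t" "t \<le> lam\<^sup>2"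
  shows "ennreal t * grad_energy t \<le> ennreal (4 * lam\<^sup>2 / (lam\<^sup>2 - 1)) * (decay_const (1 / lam\<^sup>2) * (ennreal (20 * lam\<^sup>2 * annuli_const) * annulus_energy))"
proof -
  let ?D = "(decay_const (1 / lam\<^sup>2) * (ennreal (20 * lam\<^sup>2 * annuli_const) * annulus_energy))"
  define s where "s = t / lam\<^sup>2"
  have s: "0 < s" "s \<le> 1" "1 / lam\<^sup>2 \<le> s" using t lam by (auto simp: s_def divide_simps)
  define tau where "tau = (lam\<^sup>2 - 1) * s"
  have tau: "tau > 0" using lam_square s by (simp add: tau_def)
  have st: "s + tau = t" using lam by (simp add: tau_def s_def field_simps)
  note u = heat_gauss_integrable[OF s(1)] and u2 = heat_square_gauss_integrable[OF s(1,2)]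
  have [measurable]: "heat_var tau (heat s f) \<in> borel_measurable borel"
    by (rule heat_var_measurable[OF u u2 tau])
  have "heat_grad t f x = heat_grad tau (heat s f) x" for x
  proof (rule GDERIV_unique)
    show "GDERIV (heat t f) x :> heat_grad t f x" using t by (intro heat_has_gradient f_gauss_integrable) auto
    have "heat t f = heat tau (heat s f)"
      using heat_semigroup[OF f_gauss_integrable s(1) tau] by (simp add: st fun_eq_iff)
    then show "GDERIV (heat t f) x :> heat_grad tau (heat s f) x" using heat_has_gradient[OF u tau] by simp
  qed
  then have "grad_energy t \<le> (\<integral>\<^sup>+x. ennreal (4 / tau) * ennreal (heat_var tau (heat s f) x) \<partial>lborel)"
    unfolding grad_energy_def
    using norm_heat_grad_le_var[OF u u2 tau] tau heat_var_nonneg[OF tau]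
    by (intro nn_integral_mono) (simp flip: ennreal_mult add: ennreal_leI)
  also have "\<dots> = ennreal (4 / tau) * energy_drop s"
    unfolding energy_drop_def tau_def[symmetric] by (rule nn_integral_cmult) measurable
  also have "energy_drop s \<le> decay_const (1 / lam\<^sup>2) * (ennreal (20 * lam\<^sup>2 * annuli_const) * annulus_energy)"
    by (rule order_trans[OF energy_drop_le[OF s(1,2)]])
       (intro mult_right_mono decay_const_antimono s inverse_lam_square, simp)
  finally have "ennreal t * grad_energy t \<le> ennreal t * (ennreal (4 / tau) * ?D)"
    by (intro mult_left_mono) (simp_all add: mult_left_mono)
  also have "ennreal t * (ennreal (4 / tau) * ?D)
      = ennreal (t * (4 / tau)) * ?D"
    using t tau by (subst ennreal_mult) (auto simp: mult.assoc)
  also have "t * (4 / tau) = 4 * lam\<^sup>2 / (lam\<^sup>2 - 1)"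
    using t lam lam_square by (simp add: tau_def s_def)
  finally show ?thesis .
qed

lemma annulus_energy_le_grad_energy: "annulus_energy \<le> ennreal (16 * (lam\<^sup>2 - 1) / shell_const) * grad_energy 1"
proof -
  have u: "gauss_integrable (heat 1 f)" by (rule heat_gauss_integrable) simp
  have u2: "gauss_integrable (\<lambda>y. (heat 1 f y)\<^sup>2)" by (rule heat_square_gauss_integrable) simp_all
  have tau: "lam\<^sup>2 - 1 > 0" using lam_square by simp
  have "ennreal shell_const * annulus_energy \<le> energy_drop 1" by (rule annulus_energy_le_energy_drop)
  also have "\<dots> \<le> ennreal (16 * (lam\<^sup>2 - 1)) * grad_energy 1"
    unfolding energy_drop_def grad_energy_def mult_1_right
    by (rule nn_integral_heat_var_le[OF u u2 tau heat_has_gradient[OF f_gauss_integrable] continuous_on_heat_grad[OF f_gauss_integrable]]) simp_all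
  finally have "ennreal (1 / shell_const) * (ennreal shell_const * annulus_energy) \<le> ennreal (1 / shell_const) * (ennreal (16 * (lam\<^sup>2 - 1)) * grad_energy 1)"
    by (rule mult_left_mono) simp
  moreover have "ennreal (1 / shell_const) * (ennreal shell_const * annulus_energy) = annulus_energy"
    using shell_const_pos by (simp add: mult.assoc[symmetric] flip: ennreal_mult)
  moreover have "ennreal (1 / shell_const) * (ennreal (16 * (lam\<^sup>2 - 1)) * grad_energy 1) = ennreal (16 * (lam\<^sup>2 - 1) / shell_const) * grad_energy 1"
    using shell_const_pos tau by (simp add: mult.assoc[symmetric] flip: ennreal_mult)
  ultimately show ?thesis by simp
qed

end

theorem proposition2p2:
  fixes lam :: real
  assumes "lam > 1"
  shows "\<exists>C::real. C > 0 \<and>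
    (\<forall>f :: real^2 \<Rightarrow> real.
       discretely_self_similar lam f \<longrightarrow> in_L2 (annulus lam) f \<longrightarrow>
         ennreal (1 / C) * L2norm (annulus lam) f
           \<le> (SUP s\<in>{0..2 * ln lam}. L2norm UNIV (gradient (\<lambda>y. U0 f y s))) \<and>
         (SUP s\<in>{0..2 * ln lam}. L2norm UNIV (gradient (\<lambda>y. U0 f y s)))
           \<le> ennreal C * L2norm (annulus lam) f)"
proof -
  define cu where "cu = enn2real (ennreal (4 * lam\<^sup>2 / (lam\<^sup>2 - 1)) * (decay_const (1 / lam\<^sup>2) * ennreal (20 * lam\<^sup>2 * (2 * lam / (lam - 1)))))"
  have cu: "ennreal (4 * lam\<^sup>2 / (lam\<^sup>2 - 1)) * (decay_const (1 / lam\<^sup>2) * ennreal (20 * lam\<^sup>2 * (2 * lam / (lam - 1)))) = ennreal cu"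
    using decay_const_finite[of "1 / lam\<^sup>2"] by (simp add: cu_def ennreal_mult_less_top)
  define cl where "cl = 16 * (lam\<^sup>2 - 1) / (exp (- (lam\<^sup>2 / 4)) * (1 - exp (- ((lam\<^sup>2 - 1) / 4))))"
  \<comment> \<open>At least 1, so that its square dominates both constants for the squared norms.\<close>
  define C where "C = 1 + \<bar>cu\<bar> + \<bar>cl\<bar>"
  have C1: "C \<ge> 1" by (simp add: C_def)
  have "C \<le> C\<^sup>2" using C1 by (simp add: power2_eq_square mult_le_cancel_left1)
  then have C: "cu \<le> C\<^sup>2" "cl \<le> C\<^sup>2" unfolding C_def by linarith+
  show ?thesis
  proof (intro exI conjI allI impI)
    show "C > 0" using C1 by simp
    fix F :: "real^2 \<Rightarrow> real"
    assume F: "discretely_self_similar lam F" "in_L2 (annulus lam) F"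
    obtain f where dss: "dss lam f" and ae: "AE x in lborel. F x = f x"
      using Borel_representative[OF assms F] by blast
    interpret dss lam f by (rule dss)
    have annulus_energy: "(\<integral>\<^sup>+x\<in>annulus lam. ennreal ((norm (F x))\<^sup>2) \<partial>lebesgue) = annulus_energy"
      unfolding annulus_energy_def nn_integral_completion using ae by (intro nn_integral_cong_AE) (auto elim: eventually_mono)
    have norm: "L2norm (annulus lam) F = root_nn annulus_energy" unfolding L2norm_root annulus_energy ..
    have "annulus_energy < \<infinity>" using F(2) unfolding in_L2_def norm by (auto simp: root_nn_def less_top split: if_splits)
    then interpret dss_L2 lam f by unfold_locales
    note hs = heat_solution_eq_heat[OF ae f_measurable]
    have gradnorm: "L2norm UNIV (gradient (\<lambda>y. U0 F y s)) = root_nn (ennreal (exp s) * grad_energy (exp s))" for s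
      unfolding L2norm_root by (subst gradient_U0_energy[OF hs]) simp
    show "ennreal (1 / C) * L2norm (annulus lam) F \<le> (SUP s\<in>{0..2 * ln lam}. L2norm UNIV (gradient (\<lambda>y. U0 F y s)))"
    proof -
      have "annulus_energy \<le> ennreal cl * grad_energy 1" using annulus_energy_le_grad_energy by (simp add: cl_def shell_const_def)
      also have "\<dots> \<le> ennreal (C\<^sup>2) * grad_energy 1" by (intro mult_right_mono ennreal_leI C) simp
      finally have "root_nn annulus_energy \<le> ennreal C * root_nn (grad_energy 1)" using C1 by (intro root_nn_le) auto
      then have "ennreal (1 / C) * root_nn annulus_energy \<le> ennreal (1 / C) * (ennreal C * root_nn (grad_energy 1))" by (rule mult_left_mono) simp
      also have "\<dots> = L2norm UNIV (gradient (\<lambda>y. U0 F y 0))"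
        unfolding gradnorm using C1 by (simp add: mult.assoc[symmetric] flip: ennreal_mult)
      also have "\<dots> \<le> (SUP s\<in>{0..2 * ln lam}. L2norm UNIV (gradient (\<lambda>y. U0 F y s)))"
        using assms by (intro SUP_upper) auto
      finally show ?thesis by (simp add: norm)
    qed
    show "(SUP s\<in>{0..2 * ln lam}. L2norm UNIV (gradient (\<lambda>y. U0 F y s))) \<le> ennreal C * L2norm (annulus lam) F"
    proof (rule SUP_least)
      fix s assume s: "s \<in> {0..2 * ln lam}"
      have "exp s \<le> exp (2 * ln lam)" using s by (simp only: exp_le_cancel_iff atLeastAtMost_iff)
      also have "exp (2 * ln lam) = lam\<^sup>2" using assms by (simp add: exp_double)
      finally have t: "1 \<le> exp s" "exp s \<le> lam\<^sup>2" using s by auto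
      have "ennreal (exp s) * grad_energy (exp s) \<le> ennreal cu * annulus_energy"
        using grad_energy_le[OF t] unfolding cu[symmetric] annuli_const_def by (simp only: mult.assoc)
      also have "\<dots> \<le> ennreal (C\<^sup>2) * annulus_energy" by (intro mult_right_mono ennreal_leI C) simp
      finally show "L2norm UNIV (gradient (\<lambda>y. U0 F y s)) \<le> ennreal C * L2norm (annulus lam) F"
        unfolding gradnorm norm using C1 by (intro root_nn_le) auto
    qed
  qed
qed

end
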